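(* For all $0<\varepsilon\leqslant\frac14$ and all $n\geqslant1$, $$d_{\mathrm{KS}}\left(\frac{Y_n}{n},X\right)\leqslant\omega_\varepsilon\,n^{-1/2+\varepsilon},\qquad \omega_\varepsilon:=\left(\frac{1}{2\varepsilon}\right)^{2\varepsilon}\Big\{\|f\|_\infty\,\kappa_{-1+1/(2\varepsilon)}\Big\}^{1-2\varepsilon},$$ where $f$ denotes the density of $X$, and for $1\leqslant p<\infty$ $$\kappa_p:=\frac{2p+3}{2p-1}(7+\tau_p),\qquad \tau_p:=\left(\frac12+\frac{\Gamma(p/2+1)}{2^{p/2+1}}\right)^{1/p}.$$ Here $Y_n$ is the number of key exchanges of Hoare's Quickselect on a uniformly random permutation of size $n$ with an independent uniform rank, and $X$ has the distribution that is the unique solution of $X\stackrel{d}{=}\sqrt{U}X+\sqrt{U}(1-\sqrt{U})$.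
   Context: Partitioning procedure (Hoare's version as in Cormen, Leiserson and Rivest). Input: a list $A[1..n]$ of $n\geqslant 2$ distinct elements of an ordered set. Set $a:=A[1]$ (the pivot), $i:=0$, $j:=n+1$. Repeat: decrease $j$ in steps of $1$ (at least one step) until $A[j]\leqslant a$; increase $i$ in steps of $1$ (at least one step) until $A[i]\geqslant a$; if $i<j$, exchange $A[i]$ and $A[j]$ (this counts as one key exchange) and continue; otherwise stop and return $I_n:=j$. The left sub-list is $A[1..I_n]$ (size $I_n$), the right sub-list is $A[I_n+1..n]$ (size $n-I_n$). Quickselect with rank $r\in\{1,\ldots,n\}$: if $n=1$, stop (no exchanges). If $n\geqslant2$, apply the partitioning procedure; if $r\leqslant I_n$, recurse on the left sub-list with rank $r$; otherwise recurse on the right sub-list with rank $r-I_n$. $Y_n$ is the total number of key exchanges over all calls to the partitioning procedure, when the input list is a uniformly random permutation of $n$ distinct elements and the rank is uniformly distributed on $\{1,\ldots,n\}$ and independent of the permutation. The law of $X$ is the unique probability distribution on $\mathbb{R}$ such that $X\stackrel{d}{=}\sqrt{U}X+\sqrt{U}(1-\sqrt{U})$, with $X$ and $U$ independent on the right-hand side and $U$ uniform on $[0,1]$. This law has a bounded Lebesgue density $f$, and $\|f\|_\infty$ is its $L^\infty$-norm. The Kolmogorov–Smirnov distance is $d_{\mathrm{KS}}(W,Z):=\sup_{x\in\mathbb{R}}|\mathbb{P}(W\leqslant x)-\mathbb{P}(Z\leqslant x)|$. $\Gamma$ is Euler's gamma function. *)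

theory Defs
  imports "HOL-Probability.Probability" "HOL-Combinatorics.Multiset_Permutations"
begin

section \<open>Hoare's partitioning procedure and Quickselect\<close>

text \<open>
  Positions are counted from 1, so position \<open>k\<close> of the list \<open>A\<close> is \<open>A ! (k - 1)\<close>.

  \<open>scan_down A a j\<close> is the value of the index \<open>j\<close> after it has been decreased in steps of 1, by at
  least one step, until \<open>A[j] \<le> a\<close>; \<open>scan_up A a i\<close> is the corresponding new value of \<open>i\<close>.
  The tests against the two ends of the list only serve to make the functions total: in a run
  started with the pivot \<open>a = A[1]\<close> each scan meets an entry that stops it.
\<close>

fun scan_down :: "'a::linorder list \<Rightarrow> 'a \<Rightarrow> nat \<Rightarrow> nat" where
  "scan_down A a 0 = 0"
| "scan_down A a (Suc j) = (if j \<le> 1 \<or> A ! (j - 1) \<le> a then j else scan_down A a j)"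

function scan_up :: "'a::linorder list \<Rightarrow> 'a \<Rightarrow> nat \<Rightarrow> nat" where
  "scan_up A a i =
     (if length A \<le> Suc i \<or> a \<le> A ! i then Suc i else scan_up A a (Suc i))"
  by auto
termination by (relation "Wellfounded.measure (\<lambda>(A, a, i). length A - i)") auto

declare scan_up.simps [simp del]

definition exchange :: "'a list \<Rightarrow> nat \<Rightarrow> nat \<Rightarrow> 'a list" where
  "exchange A i j = A[i - 1 := A ! (j - 1), j - 1 := A ! (i - 1)]"

lemma scan_down_less: "0 < j \<Longrightarrow> scan_down A a j < j"
  by (induction A a j rule: scan_down.induct) (auto intro: less_SucI)

lemma scan_down_ge_1: "2 \<le> j \<Longrightarrow> 1 \<le> scan_down A a j"
  by (induction A a j rule: scan_down.induct) auto

lemma scan_up_greater: "i < scan_up A a i"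
proof (induction A a i rule: scan_up.induct)
  case (1 A a i)
  show ?case
    by (subst scan_up.simps) (use 1 in \<open>auto intro: less_trans[OF lessI]\<close>)
qed

text \<open>
  The main loop, started with the indices \<open>i\<close> and \<open>j\<close>. The result consists of the rearranged
  list, the final value of \<open>j\<close>, and the number of key exchanges.
\<close>

function hoare_loop :: "'a::linorder list \<Rightarrow> 'a \<Rightarrow> nat \<Rightarrow> nat \<Rightarrow> 'a list \<times> nat \<times> nat" where
  "hoare_loop A a i j =
     (let j' = scan_down A a j; i' = scan_up A a i in
      if i' < j' then
        (case hoare_loop (exchange A i' j') a i' j' of (B, m, c) \<Rightarrow> (B, m, Suc c))
      else (A, j', 0))"
  by auto
termination
proof (relation "Wellfounded.measure (\<lambda>(A, a, i, j). j)", goal_cases)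
  case (2 A a i j j' i')
  then show ?case
    using scan_down_less[of j A a] by (cases j) auto
qed simp

declare hoare_loop.simps [simp del]

definition hoare_partition :: "'a::linorder list \<Rightarrow> 'a list \<times> nat \<times> nat" where
  "hoare_partition A = hoare_loop A (hd A) 0 (length A + 1)"

lemma length_exchange [simp]: "length (exchange A i j) = length A"
  by (simp add: exchange_def)

lemma hoare_loop_bounds:
  assumes "hoare_loop A a i j = (B, m, c)" "2 \<le> j"
  shows "length B = length A \<and> 1 \<le> m \<and> m < j"
  using assms
proof (induction A a i j arbitrary: B m c rule: hoare_loop.induct)
  case (1 A a i j)
  show ?case
  proof (cases "scan_up A a i < scan_down A a j")
    case True
    obtain B' m' c' where rec: "hoare_loop (exchange A (scan_up A a i) (scan_down A a j)) a
        (scan_up A a i) (scan_down A a j) = (B', m', c')"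
      by (metis prod_cases3)
    have "2 \<le> scan_down A a j"
      using True scan_up_greater[of i A a] by linarith
    from "1.IH"[OF refl refl True rec this] show ?thesis
      using "1.prems" True rec scan_down_less[of j A a]
      by (subst (asm) hoare_loop.simps) (auto simp: Let_def)
  next
    case False
    then show ?thesis
      using "1.prems" scan_down_less[of j A a] scan_down_ge_1[of j A a]
      by (subst (asm) hoare_loop.simps) (auto simp: Let_def)
  qed
qed

lemma hoare_partition_bounds:
  assumes "hoare_partition A = (B, m, c)" "2 \<le> length A"
  shows "length B = length A \<and> 1 \<le> m \<and> m < length A"
proof -
  define j where "j = scan_down A (hd A) (Suc (length A))"
  have up: "scan_up A (hd A) 0 = 1"
    using assms(2) by (subst scan_up.simps) (cases A; simp)
  have j: "1 \<le> j" "j \<le> length A"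
    using assms(2) scan_down_less[of "Suc (length A)" A "hd A"]
      scan_down_ge_1[of "Suc (length A)" A "hd A"] by (simp_all add: j_def)
  show ?thesis
  proof (cases "1 < j")
    case True
    obtain B' m' c' where rec: "hoare_loop (exchange A 1 j) (hd A) 1 j = (B', m', c')"
      by (metis prod_cases3)
    have "hoare_partition A = (B', m', Suc c')"
      unfolding hoare_partition_def
      by (subst hoare_loop.simps)
        (use True rec in \<open>simp add: Let_def up j_def[symmetric] del: scan_down.simps\<close>)
    then show ?thesis
      using hoare_loop_bounds[OF rec] True j assms(1) by auto
  next
    case False
    have "hoare_partition A = (A, j, 0)"
      unfolding hoare_partition_def
      by (subst hoare_loop.simps)
        (use False in \<open>simp add: Let_def up j_def[symmetric] del: scan_down.simps\<close>)
    then show ?thesis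
      using False j assms by auto
  qed
qed

text \<open>
  The number of key exchanges made by Quickselect on the list \<open>A\<close> with rank \<open>r\<close>, summed over all
  calls to the partitioning procedure.
\<close>

function quickselect_exchanges :: "'a::linorder list \<Rightarrow> nat \<Rightarrow> nat" where
  "quickselect_exchanges A r =
     (if length A \<le> 1 then 0
      else case hoare_partition A of (B, m, c) \<Rightarrow>
        c + (if r \<le> m then quickselect_exchanges (take m B) r
             else quickselect_exchanges (drop m B) (r - m)))"
  by auto
termination
proof (relation "Wellfounded.measure (\<lambda>(A, r). length A)", goal_cases)
  case (2 A r)
  then show ?case by (auto dest: hoare_partition_bounds[OF sym])
next
  case (3 A r)
  then show ?case by (auto dest: hoare_partition_bounds[OF sym])
qed simp

declare quickselect_exchanges.simps [simp del]

definition quickselect_input :: "nat \<Rightarrow> (nat list \<times> nat) pmf" where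
  "quickselect_input n =
     pair_pmf (pmf_of_set (permutations_of_set {1..n})) (pmf_of_set {1..n})"

definition Y_pmf :: "nat \<Rightarrow> nat pmf" where
  "Y_pmf n = map_pmf (\<lambda>(A, r). quickselect_exchanges A r) (quickselect_input n)"

definition scaled_Y_law :: "nat \<Rightarrow> real measure" where
  "scaled_Y_law n = distr (measure_pmf (Y_pmf n)) borel (\<lambda>y. real y / real n)"


section \<open>The limit law\<close>

abbreviation uniform01 :: "real measure" where
  "uniform01 \<equiv> uniform_measure lborel {0..1}"

definition solves_fixed_point :: "real measure \<Rightarrow> bool" where
  "solves_fixed_point \<mu> \<longleftrightarrow>
     prob_space \<mu> \<and> sets \<mu> = sets borel \<and>
     \<mu> = distr (\<mu> \<Otimes>\<^sub>M uniform01) borel (\<lambda>(x, u). sqrt u * x + sqrt u * (1 - sqrt u))"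

definition X_law :: "real measure" where
  "X_law = (THE \<mu>. solves_fixed_point \<mu>)"

lemma prob_space_uniform01: "prob_space uniform01"
  by (rule prob_space_uniform_measure) auto

text \<open>Iterating the equation yields a solution: a perpetuity driven by i.i.d. uniform variables.\<close>

definition clip_sqrt :: "real \<Rightarrow> real" where
  "clip_sqrt u = sqrt (max 0 (min 1 u))"

definition perp_term :: "real stream \<Rightarrow> nat \<Rightarrow> real" where
  "perp_term \<omega> n =
     (\<Prod>k<n. clip_sqrt (\<omega> !! k)) * (clip_sqrt (\<omega> !! n) * (1 - clip_sqrt (\<omega> !! n)))"

lemma clip_sqrt_bounds: "0 \<le> clip_sqrt u" "clip_sqrt u \<le> 1"
  by (auto simp: clip_sqrt_def)

lemma clip_sqrt_eq: "u \<in> {0..1} \<Longrightarrow> clip_sqrt u = sqrt u"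
  by (auto simp: clip_sqrt_def)

lemma measurable_clip_sqrt [measurable]: "clip_sqrt \<in> borel_measurable borel"
  unfolding clip_sqrt_def by measurable

lemma summable_perp_term: "summable (perp_term \<omega>)"
proof (rule bounded_imp_summable)
  show "0 \<le> perp_term \<omega> n" for n
    unfolding perp_term_def
    by (intro mult_nonneg_nonneg prod_nonneg) (auto simp: clip_sqrt_bounds)
  have le: "perp_term \<omega> k \<le> (\<Prod>i<k. clip_sqrt (\<omega> !! i)) - (\<Prod>i<Suc k. clip_sqrt (\<omega> !! i))" for k
  proof -
    have "clip_sqrt (\<omega> !! k) * (1 - clip_sqrt (\<omega> !! k)) \<le> 1 - clip_sqrt (\<omega> !! k)"
      using clip_sqrt_bounds[of "\<omega> !! k"] by (intro mult_left_le_one_le) auto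
    then have "perp_term \<omega> k \<le> (\<Prod>i<k. clip_sqrt (\<omega> !! i)) * (1 - clip_sqrt (\<omega> !! k))"
      unfolding perp_term_def by (intro mult_left_mono prod_nonneg) (auto simp: clip_sqrt_bounds)
    then show ?thesis by (simp add: algebra_simps)
  qed
  show "(\<Sum>k\<le>n. perp_term \<omega> k) \<le> 1" for n
  proof -
    have "(\<Sum>k\<le>n. perp_term \<omega> k) \<le>
        (\<Sum>k\<le>n. (\<Prod>i<k. clip_sqrt (\<omega> !! i)) - (\<Prod>i<Suc k. clip_sqrt (\<omega> !! i)))"
      by (intro sum_mono le)
    also have "\<dots> = 1 - (\<Prod>i<Suc n. clip_sqrt (\<omega> !! i))"
      by (subst sum_telescope) simp
    also have "\<dots> \<le> 1"
      using prod_nonneg[of "{..<Suc n}" "\<lambda>i. clip_sqrt (\<omega> !! i)"] clip_sqrt_bounds(1) by simp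
    finally show ?thesis .
  qed
qed

lemma suminf_perp_Stream:
  "(\<Sum>n. perp_term (u ## \<omega>) n) =
     clip_sqrt u * (\<Sum>n. perp_term \<omega> n) + clip_sqrt u * (1 - clip_sqrt u)"
proof -
  have "perp_term (u ## \<omega>) (Suc n) = clip_sqrt u * perp_term \<omega> n" for n
    unfolding perp_term_def by (subst prod.lessThan_Suc_shift) simp
  then have "(\<Sum>n. perp_term (u ## \<omega>) (Suc n)) = clip_sqrt u * (\<Sum>n. perp_term \<omega> n)"
    by (simp add: suminf_mult[OF summable_perp_term])
  then show ?thesis
    using suminf_split_head[OF summable_perp_term, of "u ## \<omega>"]
    by (simp add: perp_term_def[of "u ## \<omega>" 0])
qed

lemma ex_solves_fixed_point: "\<exists>\<mu>. solves_fixed_point \<mu>"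
proof
  interpret U: prob_space uniform01 by (rule prob_space_uniform01)
  interpret S: prob_space "stream_space uniform01" by (rule U.prob_space_stream_space)
  let ?X = "\<lambda>\<omega>. \<Sum>n. perp_term \<omega> n"
  let ?h = "\<lambda>(x, u). sqrt u * x + sqrt u * (1 - sqrt u) :: real"
  have nth [measurable]: "(\<lambda>\<omega>. \<omega> !! k) \<in> borel_measurable (stream_space uniform01)" for k
    using measurable_snth[of k uniform01] by (simp cong: measurable_cong_sets)
  have X [measurable]: "?X \<in> borel_measurable (stream_space uniform01)"
    unfolding perp_term_def by measurable
  define \<mu> where "\<mu> = distr (stream_space uniform01) borel ?X"
  interpret M: prob_space \<mu>
    unfolding \<mu>_def by (intro S.prob_space_distr) simp
  interpret P: pair_sigma_finite \<mu> uniform01 ..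
  have [measurable_cong]: "sets \<mu> = sets borel" by (simp add: \<mu>_def)
  have h [measurable]: "?h \<in> borel_measurable (\<mu> \<Otimes>\<^sub>M uniform01)" by measurable
  have "\<mu> = distr (\<mu> \<Otimes>\<^sub>M uniform01) borel ?h"
  proof (rule measure_eqI)
    show "sets \<mu> = sets (distr (\<mu> \<Otimes>\<^sub>M uniform01) borel ?h)" by (simp add: \<mu>_def)
    fix A assume "A \<in> sets \<mu>"
    then have A [measurable]: "A \<in> sets borel" by (simp add: \<mu>_def)
    have "emeasure \<mu> A = (\<integral>\<^sup>+y. indicator A y \<partial>\<mu>)" by (simp add: \<mu>_def)
    also have "\<dots> = (\<integral>\<^sup>+\<omega>. indicator A (?X \<omega>) \<partial>stream_space uniform01)"
      unfolding \<mu>_def by (rule nn_integral_distr) auto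
    also have "\<dots> = (\<integral>\<^sup>+u. \<integral>\<^sup>+\<omega>. indicator A (?X (u ## \<omega>)) \<partial>stream_space uniform01 \<partial>uniform01)"
      by (rule U.nn_integral_stream_space) simp
    also have "\<dots> = (\<integral>\<^sup>+u. \<integral>\<^sup>+\<omega>. indicator A (?h (?X \<omega>, u)) \<partial>stream_space uniform01 \<partial>uniform01)"
    proof (rule nn_integral_cong_AE)
      have "AE u in uniform01. u \<in> {0..1::real}"
        by (rule AE_uniform_measureI) auto
      then show "AE u in uniform01.
          (\<integral>\<^sup>+\<omega>. indicator A (?X (u ## \<omega>)) \<partial>stream_space uniform01) =
          (\<integral>\<^sup>+\<omega>. indicator A (?h (?X \<omega>, u)) \<partial>stream_space uniform01)"
        by eventually_elim (simp add: suminf_perp_Stream clip_sqrt_eq)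
    qed
    also have "\<dots> = (\<integral>\<^sup>+u. \<integral>\<^sup>+x. indicator A (?h (x, u)) \<partial>\<mu> \<partial>uniform01)"
    proof (rule nn_integral_cong)
      fix u
      show "(\<integral>\<^sup>+\<omega>. indicator A (?h (?X \<omega>, u)) \<partial>stream_space uniform01) =
          (\<integral>\<^sup>+x. indicator A (?h (x, u)) \<partial>\<mu>)"
        unfolding \<mu>_def by (subst nn_integral_distr) auto
    qed
    also have "\<dots> = (\<integral>\<^sup>+z. indicator A (?h z) \<partial>(\<mu> \<Otimes>\<^sub>M uniform01))"
      by (rule P.nn_integral_snd) measurable
    also have "\<dots> = (\<integral>\<^sup>+y. indicator A y \<partial>distr (\<mu> \<Otimes>\<^sub>M uniform01) borel ?h)"
      by (rule nn_integral_distr[symmetric]) auto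
    also have "\<dots> = emeasure (distr (\<mu> \<Otimes>\<^sub>M uniform01) borel ?h) A"
      by simp
    finally show "emeasure \<mu> A = emeasure (distr (\<mu> \<Otimes>\<^sub>M uniform01) borel ?h) A" .
  qed
  then show "solves_fixed_point \<mu>"
    by (simp add: solves_fixed_point_def M.prob_space_axioms \<open>sets \<mu> = sets borel\<close>)
qed

lemma solves_fixed_point_real_distribution:
  "solves_fixed_point \<mu> \<Longrightarrow> real_distribution \<mu>"
  unfolding solves_fixed_point_def real_distribution_def real_distribution_axioms_def by simp

lemma char_solves_fixed_point:
  assumes "solves_fixed_point \<mu>"
  shows "char \<mu> t = (CLINT u|uniform01. iexp (t * (sqrt u * (1 - sqrt u))) * char \<mu> (t * sqrt u))"
proof -
  interpret M: real_distribution \<mu>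
    using assms by (rule solves_fixed_point_real_distribution)
  interpret U: prob_space uniform01 by (rule prob_space_uniform01)
  interpret P: pair_prob_space \<mu> uniform01 ..
  let ?h = "\<lambda>(x, u). sqrt u * x + sqrt u * (1 - sqrt u) :: real"
  have h [measurable]: "?h \<in> borel_measurable (\<mu> \<Otimes>\<^sub>M uniform01)" by measurable
  have eq: "\<mu> = distr (\<mu> \<Otimes>\<^sub>M uniform01) borel ?h"
    using assms by (simp add: solves_fixed_point_def)
  let ?g = "\<lambda>x u. iexp (t * (sqrt u * x + sqrt u * (1 - sqrt u)))"
  have int: "integrable (\<mu> \<Otimes>\<^sub>M uniform01) (\<lambda>(x, u). ?g x u)"
    by (rule P.integrable_const_bound[where B = 1]) (auto simp: case_prod_beta)
  have "char \<mu> t = (CLINT y|distr (\<mu> \<Otimes>\<^sub>M uniform01) borel ?h. iexp (t * y))"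
    unfolding char_def using eq by simp
  also have "\<dots> = (CLINT z|(\<mu> \<Otimes>\<^sub>M uniform01). iexp (t * ?h z))"
    by (rule integral_distr[OF h]) measurable
  also have "\<dots> = (CLINT z|(\<mu> \<Otimes>\<^sub>M uniform01). (\<lambda>(x, u). ?g x u) z)"
    by (simp add: case_prod_beta)
  also have "\<dots> = (CLINT u|uniform01. CLINT x|\<mu>. ?g x u)"
    by (rule P.integral_snd[symmetric, OF int])
  also have "\<dots> = (CLINT u|uniform01. iexp (t * (sqrt u * (1 - sqrt u))) * char \<mu> (t * sqrt u))"
    unfolding char_def
    by (subst integral_mult_right_zero[symmetric])
      (auto simp: exp_add[symmetric] algebra_simps intro!: Bochner_Integration.integral_cong)
  finally show ?thesis .
qed

lemma solves_fixed_point_unique: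
  assumes \<mu>: "solves_fixed_point \<mu>" and \<nu>: "solves_fixed_point \<nu>"
  shows "\<mu> = \<nu>"
proof (rule Levy_uniqueness)
  interpret M: real_distribution \<mu> using \<mu> by (rule solves_fixed_point_real_distribution)
  interpret N: real_distribution \<nu> using \<nu> by (rule solves_fixed_point_real_distribution)
  interpret U: prob_space uniform01 by (rule prob_space_uniform01)
  show "real_distribution \<mu>" "real_distribution \<nu>" by unfold_locales
  define D where "D t = cmod (char \<mu> t - char \<nu> t)" for t
  have cont: "isCont D t" for t
    unfolding D_def by (intro continuous_intros M.isCont_char N.isCont_char)
  have D_meas [measurable]: "D \<in> borel_measurable borel" unfolding D_def by measurable
  have D_le: "D t \<le> 2" for t
    using norm_triangle_ineq4[of "char \<mu> t" "char \<nu> t"] M.cmod_char_le_1[of t]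
      N.cmod_char_le_1[of t] by (simp add: D_def)
  have D_int: "integrable uniform01 (\<lambda>u. D (t * sqrt u))" for t
    by (rule U.integrable_const_bound[where B = 2]) (use D_le in \<open>auto simp: D_def\<close>)
  have contr: "D t \<le> (LINT u|uniform01. D (t * sqrt u))" for t
  proof -
    let ?e = "\<lambda>u. iexp (t * (sqrt u * (1 - sqrt u)))"
    have int: "integrable uniform01 (\<lambda>u. ?e u * char \<mu> (t * sqrt u))"
      "integrable uniform01 (\<lambda>u. ?e u * char \<nu> (t * sqrt u))"
      by (rule U.integrable_const_bound[where B = 1];
          use M.cmod_char_le_1 N.cmod_char_le_1 in \<open>auto simp: norm_mult\<close>)+
    let ?d = "\<lambda>u. ?e u * char \<mu> (t * sqrt u) - ?e u * char \<nu> (t * sqrt u)"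
    have "D t = cmod (CLINT u|uniform01. ?d u)"
      unfolding D_def Bochner_Integration.integral_diff[OF int]
      by (simp only: char_solves_fixed_point[OF \<mu>, symmetric] char_solves_fixed_point[OF \<nu>, symmetric])
    also have "\<dots> \<le> (LINT u|uniform01. cmod (?d u))"
      by (rule integral_norm_bound)
    also have "\<dots> = (LINT u|uniform01. D (t * sqrt u))"
    proof (rule Bochner_Integration.integral_cong[OF refl])
      fix u
      have "?d u = ?e u * (char \<mu> (t * sqrt u) - char \<nu> (t * sqrt u))"
        by (rule right_diff_distrib[symmetric])
      then show "cmod (?d u) = D (t * sqrt u)"
        by (simp only: norm_mult norm_exp_i_times D_def mult_1)
    qed
    finally show ?thesis .
  qed
  have D_0: "D 0 = 0" by (simp add: D_def M.char_zero N.char_zero)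
  have "D t \<le> 0" for t
  proof (rule ccontr)
    assume "\<not> D t \<le> 0"
    have "\<exists>s\<in>{-\<bar>t\<bar>..\<bar>t\<bar>}. \<forall>y\<in>{-\<bar>t\<bar>..\<bar>t\<bar>}. D y \<le> D s"
      by (rule continuous_attains_sup)
        (use cont in \<open>auto intro: continuous_at_imp_continuous_on\<close>)
    then obtain s where s_mem: "s \<in> {-\<bar>t\<bar>..\<bar>t\<bar>}"
      and s_max: "\<forall>y\<in>{-\<bar>t\<bar>..\<bar>t\<bar>}. D y \<le> D s"
      by blast
    have s: "\<bar>s\<bar> \<le> \<bar>t\<bar>" and max: "\<And>y. \<bar>y\<bar> \<le> \<bar>t\<bar> \<Longrightarrow> D y \<le> D s"
      using s_mem s_max by (auto simp: abs_le_iff)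
    have pos: "0 < D s" using \<open>\<not> D t \<le> 0\<close> max[of t] by simp
    have "isCont (\<lambda>u. D (s * sqrt u)) 0"
      by (rule isCont_o2[where g = D, OF _ cont]) (auto intro!: continuous_intros)
    then have "(\<lambda>u. D (s * sqrt u)) \<midarrow>0\<rightarrow> 0"
      by (simp add: isCont_def D_0)
    then have "\<forall>\<^sub>F u in at 0. D (s * sqrt u) < D s / 2"
      by (rule order_tendstoD(2)) (use pos in simp)
    then obtain d where d: "d > 0" "\<And>u. u \<noteq> 0 \<Longrightarrow> \<bar>u\<bar> < d \<Longrightarrow> D (s * sqrt u) < D s / 2"
      by (auto simp: eventually_at)
    define \<eta> where "\<eta> = min 1 (d / 2)"
    have \<eta>: "0 < \<eta>" "\<eta> \<le> 1" "\<eta> < d" using d(1) by (auto simp: \<eta>_def)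
    have "D s \<le> (LINT u|uniform01. D (s * sqrt u))" by (rule contr)
    also have "\<dots> \<le> (LINT u|uniform01. D s - D s / 2 * indicator {0..\<eta>} u)"
    proof (rule integral_mono_AE[OF D_int])
      show "integrable uniform01 (\<lambda>u. D s - D s / 2 * indicator {0..\<eta>} u)"
        by (rule U.integrable_const_bound[where B = "2 * D s"])
          (use pos in \<open>auto simp: indicator_def\<close>)
      have "AE u in uniform01. u \<in> {0..1::real}" by (rule AE_uniform_measureI) auto
      then show "AE u in uniform01. D (s * sqrt u) \<le> D s - D s / 2 * indicator {0..\<eta>} u"
      proof eventually_elim
        case (elim u)
        have "\<bar>s * sqrt u\<bar> \<le> \<bar>s\<bar>"
          using elim by (auto simp: abs_mult intro!: mult_left_le)
        then show ?case
          using max[of "s * sqrt u"] s d(2)[of u] D_0 pos \<eta> elim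
          by (cases "u = 0") (auto simp: indicator_def)
      qed
    qed
    also have "\<dots> = D s - D s / 2 * measure uniform01 {0..\<eta>}"
      using U.prob_space
      by (subst Bochner_Integration.integral_diff) (auto simp: U.emeasure_eq_measure)
    also have "measure uniform01 {0..\<eta>} = \<eta>"
    proof -
      have "{0..1} \<inter> {0..\<eta>} = {0..\<eta>}" using \<eta> by auto
      then show ?thesis using \<eta> by (subst measure_uniform_measure) auto
    qed
    finally show False using mult_pos_pos[OF pos \<eta>(1)] by simp
  qed
  then have "char \<mu> t = char \<nu> t" for t
    by (simp add: D_def)
  then show "char \<mu> = char \<nu>" by auto
qed

lemma solves_fixed_point_X_law: "solves_fixed_point X_law"
  unfolding X_law_def
  using ex_solves_fixed_point solves_fixed_point_unique by (metis theI)

text \<open>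
  If the essential supremum below were infinite, \<open>enn2real\<close> would turn it into 0, and the bound
  built from it would collapse; finiteness is thus part of any upper bound stated with it.
\<close>

definition X_density :: "real \<Rightarrow> ennreal" where
  "X_density = RN_deriv lborel X_law"

definition X_density_norm :: real where
  "X_density_norm = enn2real (esssup lborel X_density)"


section \<open>Distance and constants\<close>

definition ks_dist :: "real measure \<Rightarrow> real measure \<Rightarrow> real" where
  "ks_dist \<mu> \<nu> = (SUP x. \<bar>cdf \<mu> x - cdf \<nu> x\<bar>)"

definition tau :: "real \<Rightarrow> real" where
  "tau p = (1 / 2 + Gamma (p / 2 + 1) / 2 powr (p / 2 + 1)) powr (1 / p)"

definition kappa :: "real \<Rightarrow> real" where
  "kappa p = (2 * p + 3) / (2 * p - 1) * (7 + tau p)"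

definition omega :: "real \<Rightarrow> real" where
  "omega \<epsilon> = (1 / (2 * \<epsilon>)) powr (2 * \<epsilon>) *
     (X_density_norm * kappa (-1 + 1 / (2 * \<epsilon>))) powr (1 - 2 * \<epsilon>)"

end

theory Submission
  imports Defs
begin

text \<open>
  Write \<open>F\<close> for the distribution function of \<open>X\<close>. For \<open>0 < l \<le> 4\<close>, induction on \<open>n\<close> compares
  the number \<open>Y\<close> of exchanges with \<open>n X\<close>, for all real \<open>y\<close> and \<open>z\<close>:
  \<open>P(Y \<le> y) \<le> F z + exp (7 l sqrt n + l^2 n / 8 - l (n z - y))\<close> and
  \<open>F z \<le> P(Y \<le> y) + exp (7 l sqrt n + l^2 n / 8 - l (y - n z))\<close>.
  The right sublist produced by Hoare's procedure is not a uniformly random permutation: it is uniform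
  only given the position of its minimum, the pivot. The induction therefore runs over lists with
  prescribed position of the minimum. In one step the fixed-point equation, in the form
  \<open>F z = (INTEGRAL u=0..1. F (z / sqrt u - 1 + sqrt u))\<close>, is cut into intervals of \<open>u\<close> that correspond to
  the possible sizes of the sublist searched next, and the exchanges of a single partitioning step are
  hypergeometric, hence controlled by Hoeffding's lemma.

  With \<open>l = 4 t / sqrt n\<close>, and as \<open>F\<close> is Lipschitz with constant \<open>M\<close>, the supremum norm of the density,
  the distance \<open>G\<close> of the distribution functions at any point satisfies
  \<open>G \<le> M (7 + t) / sqrt n + exp (- 2 t^2)\<close> for all \<open>t \<ge> 0\<close>. Choosing \<open>t\<close> such that
  \<open>exp (- 2 t^2) = G / (p + 1)\<close>, where \<open>p = -1 + 1 / (2 \<epsilon>)\<close>, and bounding \<open>Gamma (x + 1)\<close> below by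
  \<open>(x / e)^x\<close> gives the theorem.
\<close>

section \<open>The support of the limit law\<close>

text \<open>Errors are carried through the recursion only as exponentials with one fixed
  \<open>l\<close>. The exchanges of a step then enter as a factor, so that nothing but their moment
  generating function is needed. In passing from size n to size k, Hoeffding's lemma costs l^2 (n -
  k) / 8, which telescopes to l^2 n / 8. The obstacle is the rounding: cutting the range of u and
  replacing the means costs a constant even for k close to n, and a constant per step would
  accumulate. The term 7 l sqrt n therefore pays more than the cost when k is smaller. A step leaves
  the factor exp (l (1 - 2 sqrt n (1 - k / n))), which exceeds 1 only for k near n, and its mean
  over k is at most 1. The two directions are not symmetric. Bounding P(Y <= y) from above, the rank
  of the pivot may be counted as cheap for free; bounding it from below, no rank can be given away.
  Hence two recursions with slightly different sizes. No formula for the density is used. That its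
  supremum is finite follows from the fixed-point equation by absorption: the largest mass of a
  short interval is bounded by half of itself plus a multiple of the length.\<close>

interpretation XL: real_distribution X_law
  by (rule solves_fixed_point_real_distribution[OF solves_fixed_point_X_law])

interpretation U01: prob_space uniform01
  by (rule prob_space_uniform01)

interpretation XU: pair_prob_space X_law uniform01 ..

definition split_map :: "real \<Rightarrow> real \<Rightarrow> real" where
  "split_map u x = sqrt u * x + sqrt u * (1 - sqrt u)"

lemma measurable_split_map [measurable]:
  "case_prod (\<lambda>x u. split_map u x) \<in> borel_measurable (borel \<Otimes>\<^sub>M borel)"
  unfolding split_map_def by measurable

lemma measurable_split_map' [measurable]:
  "(\<lambda>z. split_map (f z) (g z)) \<in> borel_measurable N" if [measurable]: "f \<in> borel_measurable N" "g \<in> borel_measurable N"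
  unfolding split_map_def by measurable

lemma sets_split_map:
  assumes "A \<in> sets borel"
  shows "{z. split_map (snd z) (fst z) \<in> A} \<in> sets (borel \<Otimes>\<^sub>M borel)"
proof -
  have "(\<lambda>z. split_map (snd z) (fst z)) \<in> borel_measurable (borel \<Otimes>\<^sub>M borel)"
    by measurable
  from measurable_sets[OF this assms] show ?thesis
    by (simp add: space_pair_measure vimage_def)
qed

lemma measure_X_law_eq_pair:
  assumes [measurable]: "A \<in> sets borel"
  shows "measure X_law A = measure (X_law \<Otimes>\<^sub>M uniform01) {z. split_map (snd z) (fst z) \<in> A}"
proof -
  have eq: "X_law = distr (X_law \<Otimes>\<^sub>M uniform01) borel (\<lambda>z. split_map (snd z) (fst z))"
    using solves_fixed_point_X_law unfolding solves_fixed_point_def split_map_def case_prod_unfold by blast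
  have "measure X_law A = measure (distr (X_law \<Otimes>\<^sub>M uniform01) borel (\<lambda>z. split_map (snd z) (fst z))) A"
    using eq by simp
  also have "\<dots> = measure (X_law \<Otimes>\<^sub>M uniform01) {z. split_map (snd z) (fst z) \<in> A}"
    by (subst measure_distr) (auto simp: space_pair_measure vimage_def)
  finally show ?thesis .
qed

lemma measure_pair_eq_snd:
  assumes [measurable]: "B \<in> sets (borel \<Otimes>\<^sub>M borel)"
  shows "integrable uniform01 (\<lambda>u. measure X_law {x. (x, u) \<in> B})"
    and "measure (X_law \<Otimes>\<^sub>M uniform01) B = (LINT u|uniform01. measure X_law {x. (x, u) \<in> B})"
proof -
  have B: "B \<in> sets (X_law \<Otimes>\<^sub>M uniform01)"
    using assms by (simp cong: sets_pair_measure_cong)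
  have int: "integrable (X_law \<Otimes>\<^sub>M uniform01) (\<lambda>(x, u). indicator B (x, u) :: real)"
    by (rule XU.integrable_const_bound[where B = 1]) (use B in \<open>auto simp: indicator_def\<close>)
  have eq: "(LINT x|X_law. indicator B (x, u)) = measure X_law {x. (x, u) \<in> B}" for u
  proof -
    have "(\<lambda>x. indicator B (x, u)) = (indicator {x. (x, u) \<in> B} :: real \<Rightarrow> real)"
      by (auto simp: indicator_def fun_eq_iff)
    then show ?thesis by simp
  qed
  show "measure (X_law \<Otimes>\<^sub>M uniform01) B = (LINT u|uniform01. measure X_law {x. (x, u) \<in> B})"
    using XU.integral_snd[OF int] B by (simp add: eq space_pair_measure)
  show "integrable uniform01 (\<lambda>u. measure X_law {x. (x, u) \<in> B})"
    using XU.integrable_snd[OF int] by (simp add: eq)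
qed

lemma measure_pair_eq_fst:
  assumes [measurable]: "B \<in> sets (borel \<Otimes>\<^sub>M borel)"
  shows "integrable X_law (\<lambda>x. measure uniform01 {u. (x, u) \<in> B})"
    and "measure (X_law \<Otimes>\<^sub>M uniform01) B = (LINT x|X_law. measure uniform01 {u. (x, u) \<in> B})"
proof -
  have B: "B \<in> sets (X_law \<Otimes>\<^sub>M uniform01)"
    using assms by (simp cong: sets_pair_measure_cong)
  have int: "integrable (X_law \<Otimes>\<^sub>M uniform01) (\<lambda>(x, u). indicator B (x, u) :: real)"
    by (rule XU.integrable_const_bound[where B = 1]) (use B in \<open>auto simp: indicator_def\<close>)
  have eq: "(LINT u|uniform01. indicator B (x, u)) = measure uniform01 {u. (x, u) \<in> B}" for x
  proof -
    have "(\<lambda>u. indicator B (x, u)) = (indicator {u. (x, u) \<in> B} :: real \<Rightarrow> real)"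
      by (auto simp: indicator_def fun_eq_iff)
    then show ?thesis by simp
  qed
  show "measure (X_law \<Otimes>\<^sub>M uniform01) B = (LINT x|X_law. measure uniform01 {u. (x, u) \<in> B})"
    using XU.integral_fst[OF int] B by (simp add: eq space_pair_measure)
  show "integrable X_law (\<lambda>x. measure uniform01 {u. (x, u) \<in> B})"
    using XU.integrable_fst[OF int] by (simp add: eq)
qed

lemma AE_uniform01: "AE u in uniform01. u \<in> {0..1}"
  by (rule AE_uniform_measureI) auto

lemma measure_uniform01:
  assumes "A \<in> sets borel"
  shows "measure uniform01 A = measure lborel ({0..1} \<inter> A)"
  using assms by (subst measure_uniform_measure) auto

lemma integral_uniform01:
  fixes f :: "real \<Rightarrow> real"
  assumes "f \<in> borel_measurable borel"
  shows "(LINT u|uniform01. f u) = (LINT u|lborel. indicator {0..1} u * f u)"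
proof -
  have "uniform01 = density lborel (\<lambda>x. ennreal (indicator {0..1} x))"
    by (simp add: uniform_measure_def ennreal_indicator divide_ennreal_def)
  then show ?thesis using assms by (simp add: integral_density)
qed

text \<open>If the image under \<open>split_map u\<close> is further than \<open>c\<close> from
  [0,1], then the argument is further than \<open>c / sqrt u\<close> from it. With probability 1/4
  this is at least 2 c, so the fixed-point equation gives p c <= 3/4 p c + 1/4 p (2 c). Iterating p
  c <= p (2 c) pushes the mass to infinity.\<close>

lemma X_law_outside_unit_interval:
  assumes "c > 0"
  shows "measure X_law ({..< - c} \<union> {1 + c <..}) = 0"
proof -
  define A where "A c = {..< - c} \<union> {1 + c <..}" for c :: real
  define p where "p c = measure X_law (A c)" for c
  have A [measurable]: "A c \<in> sets borel" for c by (simp add: A_def)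
  have mono: "p d \<le> p c" if "c \<le> d" for c d
    unfolding p_def using that by (intro XL.finite_measure_mono) (auto simp: A_def)
  have shrink: "x \<in> A (c / sqrt u)" if "split_map u x \<in> A c" "0 < c" "0 < u" "u \<le> 1" for c u x
  proof -
    define v where "v = sqrt u"
    have v: "0 < v" "v \<le> 1" using that by (auto simp: v_def)
    \<comment> \<open>Both ends of [0,1] are respected: v x + v (1 - v) >= v x, and 1 - (v x + v (1
      - v)) = v (1 - x) + (1 - v)^2.\<close>
    have "0 \<le> v * (1 - v)" "0 \<le> (1 - v) * (1 - v)" using v by auto
    then have "v * x < - c \<or> v * (x - 1) > c"
      using that(1) by (auto simp: A_def split_map_def v_def[symmetric] algebra_simps)
    then show ?thesis using v by (auto simp: A_def v_def[symmetric] field_simps)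
  qed
  have step: "p c \<le> p (2 * c)" if "0 < c" for c
  proof -
    let ?g = "\<lambda>u. p c - (p c - p (2 * c)) * indicator {..1/4} u :: real"
    have B: "{z :: real \<times> real. split_map (snd z) (fst z) \<in> A c} \<in> sets (borel \<Otimes>\<^sub>M borel)"
      by (rule sets_split_map) simp
    have "p c = (LINT u|uniform01. measure X_law {x. split_map u x \<in> A c})"
      unfolding p_def measure_X_law_eq_pair[OF A] measure_pair_eq_snd(2)[OF B] by simp
    also have "\<dots> \<le> (LINT u|uniform01. ?g u)"
    proof (rule integral_mono_AE)
      show "integrable uniform01 (\<lambda>u. measure X_law {x. split_map u x \<in> A c})"
        using measure_pair_eq_snd(1)[OF B] by simp
      show "integrable uniform01 ?g"
        by (intro Bochner_Integration.integrable_diff) (auto simp: U01.emeasure_eq_measure)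
      show "AE u in uniform01. measure X_law {x. split_map u x \<in> A c} \<le> ?g u"
        using AE_uniform01
      proof eventually_elim
        case (elim u)
        show ?case
        proof (cases "u = 0")
          case True
          then have "{x. split_map u x \<in> A c} = {}" using that by (auto simp: split_map_def A_def)
          then show ?thesis using True by (simp add: p_def)
        next
          case False
          then have u: "0 < u" "u \<le> 1" using elim by auto
          have "measure X_law {x. split_map u x \<in> A c} \<le> p (c / sqrt u)"
            unfolding p_def using shrink[of u _ c] that u by (intro XL.finite_measure_mono) auto
          also have "\<dots> \<le> ?g u"
          proof (cases "u \<le> 1 / 4")
            case True
            then have "sqrt u \<le> 1 / 2" using real_sqrt_le_mono[of u "1 / 4"] by (simp add: real_sqrt_divide)
            then have "p (c / sqrt u) \<le> p (2 * c)" using u that by (intro mono) (simp add: field_simps)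
            then show ?thesis using True by simp
          next
            case False
            have "p (c / sqrt u) \<le> p c" using u that by (intro mono) (simp add: field_simps)
            then show ?thesis using False by simp
          qed
          finally show ?thesis .
        qed
      qed
    qed
    also have "\<dots> = p c - (p c - p (2 * c)) * measure uniform01 {..1/4}"
      using U01.prob_space
      by (subst Bochner_Integration.integral_diff) (auto simp: U01.emeasure_eq_measure)
    also have "measure uniform01 {..1/4} = 1 / 4"
    proof -
      have "{0..1} \<inter> {..1/4} = {0..1/4::real}" by auto
      then show ?thesis by (subst measure_uniform01) auto
    qed
    finally show ?thesis by simp
  qed
  have iter: "p c \<le> p (2 ^ k * c)" for k
  proof (induction k)
    case (Suc k)
    then show ?case using step[of "2 ^ k * c"] assms by (simp add: mult_ac)
  qed simp
  have "(\<lambda>k. p (2 ^ k * c)) \<longlonglongrightarrow> 0"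
  proof -
    have lim: "filterlim (\<lambda>k. 2 ^ k * c) at_top sequentially"
    proof (rule filterlim_at_top_mult_tendsto_pos[OF tendsto_const assms])
      show "filterlim (\<lambda>k. 2 ^ k :: real) at_top sequentially"
        by (rule filterlim_at_top_mono[OF filterlim_real_sequentially])
          (auto intro!: always_eventually less_imp_le of_nat_less_two_power)
    qed
    have "(\<lambda>k. cdf X_law (- (2 ^ k * c)) + (1 - cdf X_law (1 + 2 ^ k * c))) \<longlonglongrightarrow> 0 + (1 - 1)"
      by (intro tendsto_intros filterlim_compose[OF XL.cdf_lim_at_bot]
          filterlim_compose[OF XL.cdf_lim_at_top_prob] filterlim_tendsto_add_at_top[OF tendsto_const] lim
          filterlim_compose[OF filterlim_uminus_at_bot_at_top])
    then have lim0: "(\<lambda>k. cdf X_law (- (2 ^ k * c)) + (1 - cdf X_law (1 + 2 ^ k * c))) \<longlonglongrightarrow> 0" by simp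
    show ?thesis
    proof (rule tendsto_sandwich[OF _ _ tendsto_const lim0])
      show "\<forall>\<^sub>F k in sequentially. p (2 ^ k * c) \<le> cdf X_law (- (2 ^ k * c)) + (1 - cdf X_law (1 + 2 ^ k * c))"
      proof (intro always_eventually allI)
        fix k
        have "p (2 ^ k * c) \<le> measure X_law {.. - (2 ^ k * c)} + measure X_law {1 + 2 ^ k * c <..}"
          unfolding p_def
          by (intro order.trans[OF XL.finite_measure_mono measure_Un_le]) (auto simp: A_def)
        also have "measure X_law {1 + 2 ^ k * c <..} = 1 - cdf X_law (1 + 2 ^ k * c)"
        proof -
          have "{1 + 2 ^ k * c <..} = space X_law - {..1 + 2 ^ k * c}" by auto
          then show ?thesis using XL.prob_compl[of "{..1 + 2 ^ k * c}"] by (simp add: cdf_def)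
        qed
        finally show "p (2 ^ k * c) \<le> cdf X_law (- (2 ^ k * c)) + (1 - cdf X_law (1 + 2 ^ k * c))"
          by (simp add: cdf_def)
      qed
    qed (simp add: p_def)
  qed
  then have "p c \<le> 0" using iter by (intro LIMSEQ_le_const) auto
  then show ?thesis by (simp add: p_def A_def measure_le_0_iff)
qed

lemma AE_X_law_unit_interval: "AE x in X_law. x \<in> {0..1}"
proof -
  have "AE x in X_law. x \<notin> {..< - inverse (Suc n)} \<union> {1 + inverse (Suc n) <..}" for n
    using X_law_outside_unit_interval[of "inverse (Suc n)"]
    by (intro AE_not_in) (simp add: null_sets_def XL.emeasure_eq_measure)
  then have "AE x in X_law. \<forall>n. x \<notin> {..< - inverse (Suc n)} \<union> {1 + inverse (Suc n) <..}"
    by (simp add: AE_all_countable)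
  then show ?thesis
  proof eventually_elim
    case (elim x)
    show ?case
    proof (rule ccontr)
      assume "x \<notin> {0..1}"
      then have "0 < max (- x) (x - 1)" by auto
      then obtain n where "inverse (Suc n) < max (- x) (x - 1)"
        using reals_Archimedean by blast
      then show False using elim[rule_format, of n] by (auto simp: max_def split: if_splits)
    qed
  qed
qed

section \<open>Bounded density of the limit law\<close>

lemma measure_uniform01_le_diam:
  assumes [measurable]: "S \<in> sets borel" and \<delta>: "0 \<le> \<delta>"
    and diam: "\<And>a b. a \<in> S \<Longrightarrow> b \<in> S \<Longrightarrow> 0 \<le> a \<Longrightarrow> a \<le> b \<Longrightarrow> b \<le> 1 \<Longrightarrow> b - a \<le> \<delta>"
  shows "measure uniform01 S \<le> 2 * \<delta>"
proof (cases "{0..1} \<inter> S = {}")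
  case True
  then show ?thesis using \<delta> by (simp add: measure_uniform01)
next
  case False
  then obtain c where c: "c \<in> S" "0 \<le> c" "c \<le> 1" by auto
  have "{0..1} \<inter> S \<subseteq> {c - \<delta>..c + \<delta>}"
    using diam[OF c(1)] diam[OF _ c(1)] c by (fastforce simp: not_le dest: less_imp_le)
  then have "measure lborel ({0..1} \<inter> S) \<le> measure lborel {c - \<delta>..c + \<delta>}"
    by (intro measure_mono_fmeasurable) (auto simp: fmeasurable_def emeasure_lborel_Icc_eq)
  then show ?thesis using \<delta> by (simp add: measure_uniform01)
qed

text \<open>
  Away from \<open>sqrt u = sqrt y\<close> the concave parabola \<open>v \<mapsto> v x + v (1 - v)\<close> has slope bounded
  away from \<open>0\<close> wherever its value is close to \<open>y\<close>.
\<close>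

lemma measure_split_map_far:
  assumes y: "0 \<le> y" and d: "0 < d" "d \<le> 1 / 256" and x: "0 \<le> x"
  shows "measure uniform01 {u. split_map u x \<in> {y..y + d} \<and> (u \<le> 1 / 16 \<or> 1 / 32 < \<bar>sqrt u - sqrt y\<bar>)}
    \<le> 2048 * d" (is "measure uniform01 ?T \<le> _")
proof -
  have [measurable]: "?T \<in> sets borel"
  proof -
    have "Measurable.pred borel (\<lambda>u. split_map u x \<in> {y..y + d} \<and> (u \<le> 1 / 16 \<or> 1 / 32 < \<bar>sqrt u - sqrt y\<bar>))"
      by measurable
    then show ?thesis by (simp add: pred_def)
  qed
  have slope: "1 / 256 \<le> \<bar>1 + x - 2 * sqrt u\<bar>" if u: "u \<in> ?T" "0 \<le> u" "u \<le> 1" for u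
  proof (cases "u \<le> 1 / 16")
    case True
    then have "sqrt u \<le> 1 / 4" using real_sqrt_le_mono[of u "1 / 16"]
      by (simp add: real_sqrt_divide)
    then show ?thesis using x by simp
  next
    case False
    define v where "v = sqrt u"
    have "sqrt (1 / 16) < v" unfolding v_def using False by (intro real_sqrt_less_mono) auto
    then have v: "1 / 4 < v" "v \<le> 1" using u by (auto simp: real_sqrt_divide v_def)
    define w where "w = sqrt y"
    have w: "0 \<le> w" "y = w\<^sup>2" using y by (auto simp: w_def)
    have far: "1 / 32 < \<bar>v - w\<bar>" using u False by (auto simp: v_def w_def)
    have h: "y \<le> v * x + v * (1 - v)" "v * x + v * (1 - v) \<le> y + d"
      using u by (auto simp: split_map_def v_def)
    \<comment> \<open>With h(v) = v x + v (1 - v) one has v h'(v) = h(v) - v^2. As h(v) lies within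
      1/256 of y = w^2, while v^2 and w^2 differ by at least 1/128, the slope h'(v) is at least
      1/256 in modulus.\<close>
    have "1 / 32 * (1 / 4) \<le> \<bar>v - w\<bar> * (v + w)"
      using far v w by (intro mult_mono) auto
    also have "\<dots> = \<bar>v\<^sup>2 - y\<bar>"
    proof -
      have "v\<^sup>2 - y = (v - w) * (v + w)" by (simp add: w power2_eq_square algebra_simps)
      then show ?thesis using v w by (simp add: abs_mult)
    qed
    finally have "1 / 256 \<le> \<bar>v * x + v * (1 - v) - v\<^sup>2\<bar>" using h d by linarith
    also have "v * x + v * (1 - v) - v\<^sup>2 = v * (1 + x - 2 * v)"
      by (simp add: power2_eq_square algebra_simps)
    also have "\<bar>v * (1 + x - 2 * v)\<bar> \<le> \<bar>1 + x - 2 * v\<bar>"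
      using v by (simp add: abs_mult mult_left_le_one_le)
    finally show ?thesis by (simp add: v_def)
  qed
  \<comment> \<open>Between p and q the parabola has difference quotient 1 + x - p - q, the mean of
    its slopes at p and q. If these have the same sign, the quotient inherits the bound 1/256; this
    is why the set is cut at the vertex below.\<close>
  have sep: "b - a \<le> 512 * d"
    if ab: "a \<in> ?T" "b \<in> ?T" "0 \<le> a" "a \<le> b" "b \<le> 1"
      and sg: "1 + x - 2 * sqrt a \<ge> 0 \<longleftrightarrow> 1 + x - 2 * sqrt b \<ge> 0" for a b
  proof -
    define p q where "p = sqrt a" and "q = sqrt b"
    have pq: "0 \<le> p" "p \<le> q" "q \<le> 1" "a = p\<^sup>2" "b = q\<^sup>2" using ab by (auto simp: p_def q_def)
    have "split_map b x - split_map a x = (q - p) * (1 + x - p - q)"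
      using pq by (simp add: split_map_def p_def[symmetric] q_def[symmetric] algebra_simps power2_eq_square)
    then have "\<bar>(q - p) * (1 + x - p - q)\<bar> \<le> d" using ab by auto
    moreover have "1 / 256 \<le> \<bar>1 + x - p - q\<bar>"
      using slope[OF ab(1)] slope[OF ab(2)] ab sg unfolding p_def[symmetric] q_def[symmetric]
      by (auto simp: abs_if split: if_splits)
    then have "(q - p) * (1 / 256) \<le> \<bar>(q - p) * (1 + x - p - q)\<bar>"
      using pq unfolding abs_mult by (intro mult_mono) auto
    ultimately have "(q - p) * (1 / 256) \<le> d" by (rule order.trans[rotated])
    then have "q - p \<le> 256 * d" by simp
    then have "(q - p) * (q + p) \<le> 256 * d * 2" using pq by (intro mult_mono) auto
    then show ?thesis by (simp add: pq power2_eq_square algebra_simps)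
  qed
  have "measure uniform01 ?T \<le> measure uniform01 (?T \<inter> {u. 1 + x - 2 * sqrt u \<ge> 0})
      + measure uniform01 (?T \<inter> {u. 1 + x - 2 * sqrt u < 0})"
    by (intro order.trans[OF U01.finite_measure_mono measure_Un_le]) auto
  also have "\<dots> \<le> 2 * (512 * d) + 2 * (512 * d)"
    using d by (intro add_mono measure_uniform01_le_diam sep) auto
  finally show ?thesis by simp
qed

text \<open>Let \<open>q\<close> be the largest mass of an interval of length \<open>d\<close>.
  Where \<open>u\<close> is small or \<open>sqrt u\<close> is far from \<open>sqrt y\<close>, fix x:
  the admissible u have measure at most 2048 d. Elsewhere fix u: the admissible x have mass at most
  4 q, and such u fill an interval of length at most 1/8. Hence q <= q/2 + 2048 d, and
  \<open>q\<close>, being finite, can be absorbed.\<close>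

lemma measure_X_law_Icc_short:
  assumes d: "0 < d" "d \<le> 1 / 256"
  shows "measure X_law {y..y + d} \<le> 4096 * d"
proof -
  define q where "q = (SUP y. measure X_law {y..y + d})"
  have bdd: "bdd_above (range (\<lambda>y. measure X_law {y..y + d}))"
    by (rule bdd_aboveI[of _ 1]) auto
  have le_q: "measure X_law {y..y + d} \<le> q" for y
    unfolding q_def by (rule cSUP_upper[OF _ bdd]) auto
  have q0: "0 \<le> q" using le_q[of 0] measure_nonneg[of X_law "{0..0+d}"] by linarith
  have main: "measure X_law {y..y + d} \<le> q / 2 + 2048 * d" if y: "0 \<le> y" "y \<le> 1" for y
  proof -
    define w where "w = sqrt y"
    have w: "0 \<le> w" "w \<le> 1" using y by (auto simp: w_def)
    define F where "F = {z :: real \<times> real. split_map (snd z) (fst z) \<in> {y..y + d} \<and>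
        (snd z \<le> 1 / 16 \<or> 1 / 32 < \<bar>sqrt (snd z) - w\<bar>)}"
    define N where "N = {z :: real \<times> real. split_map (snd z) (fst z) \<in> {y..y + d} \<and>
        \<not> (snd z \<le> 1 / 16 \<or> 1 / 32 < \<bar>sqrt (snd z) - w\<bar>)}"
    have "Measurable.pred (borel \<Otimes>\<^sub>M borel) (\<lambda>z. split_map (snd z) (fst z) \<in> {y..y + d} \<and>
        (snd z \<le> 1 / 16 \<or> 1 / 32 < \<bar>sqrt (snd z) - w\<bar>))"
      by measurable
    then have F: "F \<in> sets (borel \<Otimes>\<^sub>M borel)" by (simp add: F_def pred_def space_pair_measure)
    have "Measurable.pred (borel \<Otimes>\<^sub>M borel) (\<lambda>z. split_map (snd z) (fst z) \<in> {y..y + d} \<and>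
        \<not> (snd z \<le> 1 / 16 \<or> 1 / 32 < \<bar>sqrt (snd z) - w\<bar>))"
      by measurable
    then have N: "N \<in> sets (borel \<Otimes>\<^sub>M borel)" by (simp add: N_def pred_def space_pair_measure)
    have "measure (X_law \<Otimes>\<^sub>M uniform01) F = (LINT x|X_law. measure uniform01 {u. (x, u) \<in> F})"
      by (rule measure_pair_eq_fst(2)[OF F])
    also have "\<dots> \<le> (LINT x|X_law. 2048 * d)"
    proof (rule integral_mono_AE[OF measure_pair_eq_fst(1)[OF F]])
      show "AE x in X_law. measure uniform01 {u. (x, u) \<in> F} \<le> 2048 * d"
        using AE_X_law_unit_interval
        by eventually_elim (use measure_split_map_far[OF y(1) d] in \<open>simp add: F_def w_def\<close>)
    qed simp
    finally have Fle: "measure (X_law \<Otimes>\<^sub>M uniform01) F \<le> 2048 * d" using XL.prob_space by simp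
    let ?I = "{(max 0 (w - 1 / 32))\<^sup>2..(w + 1 / 32)\<^sup>2}"
    have slice: "measure X_law {x. (x, u) \<in> N} \<le> 4 * q * indicator ?I u" if u: "0 \<le> u" for u
    proof (cases "u \<le> 1 / 16 \<or> 1 / 32 < \<bar>sqrt u - w\<bar>")
      case True
      then have "{x. (x, u) \<in> N} = {}" by (auto simp: N_def)
      then show ?thesis using q0 by (auto simp: indicator_def)
    next
      case False
      define v where "v = sqrt u"
      have "sqrt (1 / 16) < v" unfolding v_def using False by (intro real_sqrt_less_mono) auto
      then have v: "1 / 4 < v" "u = v\<^sup>2" using u by (auto simp: real_sqrt_divide v_def)
      have "max 0 (w - 1 / 32) \<le> v" "v \<le> w + 1 / 32"
        using False v(1) unfolding v_def[symmetric] by linarith+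
      then have "u \<in> ?I" using v by (auto intro!: power_mono)
      define s where "s = (y - v * (1 - v)) / v"
      \<comment> \<open>For fixed u the condition confines x to an interval of length d / sqrt u <=
        4 d, as u > 1/16; four intervals of length d cover it.\<close>
      have "{x. (x, u) \<in> N} \<subseteq> ({s..s + d} \<union> {s + d..s + d + d}) \<union> ({s + 2 * d..s + 2 * d + d} \<union> {s + 3 * d..s + 3 * d + d})"
      proof
        fix x assume "x \<in> {x. (x, u) \<in> N}"
        then have h: "y \<le> v * x + v * (1 - v)" "v * x + v * (1 - v) \<le> y + d"
          by (auto simp: N_def split_map_def v_def)
        have "s \<le> x" using h v by (simp add: s_def field_simps)
        moreover have "x \<le> s + d / v" using h v by (simp add: s_def field_simps)
        moreover have "d / v \<le> 4 * d" using v d by (simp add: field_simps)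
        ultimately show "x \<in> ({s..s + d} \<union> {s + d..s + d + d}) \<union> ({s + 2 * d..s + 2 * d + d} \<union> {s + 3 * d..s + 3 * d + d})"
          by auto
      qed
      then have "measure X_law {x. (x, u) \<in> N} \<le>
         measure X_law (({s..s + d} \<union> {s + d..s + d + d}) \<union> ({s + 2 * d..s + 2 * d + d} \<union> {s + 3 * d..s + 3 * d + d}))"
        by (intro XL.finite_measure_mono) auto
      also have "\<dots> \<le> (measure X_law {s..s + d} + measure X_law {s + d..s + d + d}) +
          (measure X_law {s + 2 * d..s + 2 * d + d} + measure X_law {s + 3 * d..s + 3 * d + d})"
        by (intro order.trans[OF measure_Un_le] add_mono measure_Un_le) auto
      also have "\<dots> \<le> (q + q) + (q + q)" by (intro add_mono le_q)
      finally show ?thesis using \<open>u \<in> ?I\<close> by simp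
    qed
    have lenI: "measure lborel ?I \<le> 1 / 8 \<or> w < 1 / 32"
    proof (cases "w < 1 / 32")
      case False
      have "(w + 1 / 32)\<^sup>2 - (w - 1 / 32)\<^sup>2 = w / 8" by (simp add: power2_eq_square algebra_simps)
      then show ?thesis using False w by (simp add: measure_lborel_Icc power_mono)
    qed simp
    have Nle: "measure (X_law \<Otimes>\<^sub>M uniform01) N \<le> q / 2"
    proof (cases "w < 1 / 32")
      case True
      have "N = {}"
      proof -
        have False if "\<not> u \<le> 1 / 16" "\<not> 1 / 32 < \<bar>sqrt u - w\<bar>" for u
        proof -
          have "sqrt (1 / 16) < sqrt u" using that by (intro real_sqrt_less_mono) auto
          then show False using that True by (simp add: real_sqrt_divide)
        qed
        then show ?thesis by (auto simp: N_def)
      qed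
      then show ?thesis using q0 by simp
    next
      case False
      have "measure (X_law \<Otimes>\<^sub>M uniform01) N = (LINT u|uniform01. measure X_law {x. (x, u) \<in> N})"
        by (rule measure_pair_eq_snd(2)[OF N])
      also have "\<dots> \<le> (LINT u|uniform01. 4 * q * indicator ?I u)"
      proof (rule integral_mono_AE[OF measure_pair_eq_snd(1)[OF N]])
        show "AE u in uniform01. measure X_law {x. (x, u) \<in> N} \<le> 4 * q * indicator ?I u"
          using AE_uniform01 by eventually_elim (use slice in auto)
      qed (auto simp: U01.emeasure_eq_measure)
      also have "\<dots> = 4 * q * measure uniform01 ?I" by simp
      also have "\<dots> \<le> 4 * q * (1 / 8)"
      proof (rule mult_left_mono)
        have "measure uniform01 ?I \<le> measure lborel ?I"
          unfolding measure_uniform01[OF borel_closed[OF closed_atLeastAtMost]]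
          by (intro measure_mono_fmeasurable) (auto simp: fmeasurable_def emeasure_lborel_Icc_eq)
        then show "measure uniform01 ?I \<le> 1 / 8" using lenI False by linarith
      qed (use q0 in simp)
      finally show ?thesis by simp
    qed
    have "measure X_law {y..y + d} = measure (X_law \<Otimes>\<^sub>M uniform01) {z. split_map (snd z) (fst z) \<in> {y..y + d}}"
      by (rule measure_X_law_eq_pair) simp
    also have "{z. split_map (snd z) (fst z) \<in> {y..y + d}} = N \<union> F"
      by (auto simp: N_def F_def)
    also have "measure (X_law \<Otimes>\<^sub>M uniform01) (N \<union> F) \<le> measure (X_law \<Otimes>\<^sub>M uniform01) N + measure (X_law \<Otimes>\<^sub>M uniform01) F"
      by (rule measure_Un_le) (use N F in \<open>auto cong: sets_pair_measure_cong\<close>)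
    finally show ?thesis using Fle Nle by linarith
  qed
  have all: "measure X_law {y..y + d} \<le> q / 2 + 2048 * d" for y
  proof -
    consider "0 \<le> y" "y \<le> 1" | "y < 0" | "y > 1" by linarith
    then show ?thesis
    proof cases
      case 1 then show ?thesis by (rule main)
    next
      case 2
      have "measure X_law {y..y + d} \<le> measure X_law {0..0 + d}"
        by (intro XL.finite_measure_mono_AE) (use AE_X_law_unit_interval 2 in \<open>auto elim!: eventually_mono\<close>)
      then show ?thesis using main[of 0] by simp
    next
      case 3
      have "measure X_law {y..y + d} \<le> measure X_law {}"
      proof (rule XL.finite_measure_mono_AE)
        show "AE x in X_law. x \<in> {y..y + d} \<longrightarrow> x \<in> {}"
          using AE_X_law_unit_interval by eventually_elim (use 3 in auto)
      qed simp
      then show ?thesis using q0 d by simp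
    qed
  qed
  have "(SUP y. measure X_law {y..y + d}) \<le> q / 2 + 2048 * d"
    by (rule cSUP_least) (use all in auto)
  then have "q \<le> q / 2 + 2048 * d" by (simp only: q_def)
  then show ?thesis using le_q[of y] by linarith
qed

lemma measure_X_law_Icc:
  assumes "a \<le> b"
  shows "measure X_law {a..b} \<le> 4096 * (b - a)"
proof -
  have pos: "measure X_law {a..a + d} \<le> 4096 * d" if "0 < d" for a d
  proof (cases "d \<le> 1 / 256")
    case False
    have "measure X_law {a..a + d} \<le> 1" by simp
    then show ?thesis using False by linarith
  qed (use measure_X_law_Icc_short that in auto)
  show ?thesis
  proof (cases "a = b")
    case True
    have "measure X_law {a..b} \<le> 0 + e" if "0 < e" for e
    proof -
      have "measure X_law {a..b} \<le> measure X_law {a..a + e / 4096}"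
        by (rule XL.finite_measure_mono) (use True that in auto)
      also have "\<dots> \<le> 4096 * (e / 4096)" using that by (intro pos) auto
      finally show ?thesis by simp
    qed
    then show ?thesis using True field_le_epsilon[of "measure X_law {a..b}" 0] by simp
  qed (use assms pos[of "b - a" a] in simp)
qed

lemma cdf_X_law_diff:
  assumes "a \<le> b"
  shows "cdf X_law b - cdf X_law a = measure X_law {a<..b}"
  using XL.cdf_diff_eq[of a b] assms by (cases "a = b") auto

lemma cdf_X_law_lipschitz:
  assumes "a \<le> b"
  shows "cdf X_law b - cdf X_law a \<le> 4096 * (b - a)"
proof -
  have "measure X_law {a<..b} \<le> measure X_law {a..b}"
    by (rule XL.finite_measure_mono) auto
  then show ?thesis using measure_X_law_Icc[OF assms] cdf_X_law_diff[OF assms] by linarith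
qed

text \<open>
  The complementary distribution function \<open>4096 x - F x\<close> is nondecreasing; the measure it induces
  and \<open>X_law\<close> add up to a multiple of Lebesgue measure.
\<close>

lemma emeasure_X_law_le_lborel:
  assumes "A \<in> sets borel"
  shows "emeasure X_law A \<le> 4096 * emeasure lborel A"
proof -
  define G where "G x = 4096 * x - cdf X_law x" for x
  have G_mono: "G x \<le> G y" if "x \<le> y" for x y
    using cdf_X_law_lipschitz[OF that] by (simp add: G_def algebra_simps)
  have "isCont (cdf X_law) x" for x
    unfolding XL.isCont_cdf using measure_X_law_Icc[of x x] by (simp add: measure_le_0_iff)
  then have G_cont: "continuous_on UNIV G"
    unfolding G_def by (intro continuous_intros continuous_at_imp_continuous_on) auto
  let ?I = "interval_measure G"
  define \<mu> where "\<mu> A = (emeasure ?I A + emeasure X_law A) / 4096" for A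
  define M where "M = measure_of UNIV (sets borel) \<mu>"
  have M: "emeasure M A = \<mu> A" if "A \<in> sets borel" for A
    unfolding M_def
  proof (rule emeasure_measure_of_sigma)
    show "sigma_algebra UNIV (sets (borel :: real measure))"
      using sets.sigma_algebra_axioms[of "borel :: real measure"] by simp
    show "positive (sets borel) \<mu>" by (simp add: positive_def \<mu>_def)
    show "countably_additive (sets borel) \<mu>"
    proof (rule countably_additiveI)
      fix A :: "nat \<Rightarrow> real set"
      assume A: "range A \<subseteq> sets borel" "disjoint_family A"
      have "(\<Sum>i. \<mu> (A i)) = ((\<Sum>i. emeasure ?I (A i)) + (\<Sum>i. emeasure X_law (A i))) / 4096"
        unfolding \<mu>_def divide_ennreal_def
        by (simp add: ennreal_suminf_multc suminf_add)
      also have "\<dots> = \<mu> (\<Union> (range A))"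
        unfolding \<mu>_def using A by (subst (1 2) suminf_emeasure) auto
      finally show "(\<Sum>i. \<mu> (A i)) = \<mu> (\<Union> (range A))" .
    qed
  qed fact
  have "lborel = M"
  proof (rule lborel_eqI)
    show "sets M = sets borel"
      unfolding M_def by (simp add: sets.sigma_sets_eq[of borel, simplified])
    fix l u :: real assume "\<And>b. b \<in> Basis \<Longrightarrow> l \<bullet> b \<le> u \<bullet> b"
    then have lu: "l \<le> u" by simp
    have I_pt: "{c} \<in> null_sets ?I" and X_pt: "{c} \<in> null_sets X_law" for c
      using emeasure_interval_measure_Icc[of c c G] G_mono G_cont measure_X_law_Icc[of c c]
      by (auto simp: null_sets_def XL.emeasure_eq_measure measure_le_0_iff)
    have "emeasure ?I {l<..<u} = emeasure ?I ({l..u} - ({l} \<union> {u}))"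
      by (rule arg_cong[where f = "emeasure ?I"]) auto
    also have "\<dots> = ennreal (G u - G l)"
      using null_sets.Un[OF I_pt I_pt] emeasure_interval_measure_Icc[OF lu G_mono G_cont]
      by (subst emeasure_Diff_null_set) auto
    finally have I: "emeasure ?I {l<..<u} = ennreal (G u - G l)" .
    have "emeasure X_law {l<..<u} = emeasure X_law ({l<..u} - {u})"
      by (rule arg_cong[where f = "emeasure X_law"]) auto
    also have "\<dots> = ennreal (cdf X_law u - cdf X_law l)"
      using X_pt[of u] cdf_X_law_diff[OF lu]
      by (subst emeasure_Diff_null_set) (auto simp: XL.emeasure_eq_measure)
    finally have X: "emeasure X_law {l<..<u} = ennreal (cdf X_law u - cdf X_law l)" .
    have "emeasure M (box l u) = (ennreal (G u - G l) + ennreal (cdf X_law u - cdf X_law l)) / ennreal 4096"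
      by (simp add: M box_real \<mu>_def I X)
    also have "ennreal (G u - G l) + ennreal (cdf X_law u - cdf X_law l) = ennreal (4096 * (u - l))"
    proof -
      have "0 \<le> G u - G l" "0 \<le> cdf X_law u - cdf X_law l"
        using G_mono[OF lu] cdf_X_law_diff[OF lu] by auto
      then have "ennreal (G u - G l) + ennreal (cdf X_law u - cdf X_law l) =
          ennreal ((G u - G l) + (cdf X_law u - cdf X_law l))"
        by (rule ennreal_plus[symmetric])
      then show ?thesis by (simp add: G_def algebra_simps)
    qed
    also have "ennreal (4096 * (u - l)) / ennreal 4096 = ennreal (u - l)"
      using lu by (subst divide_ennreal) auto
    finally show "emeasure M (box l u) = (\<Prod>b\<in>Basis. (u - l) \<bullet> b)" by simp
  qed
  then have "emeasure lborel A = \<mu> A" using M[OF assms] by simp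
  then have "4096 * emeasure lborel A = (emeasure ?I A + emeasure X_law A) * 4096 / 4096"
    by (simp only: \<mu>_def ennreal_times_divide mult.commute)
  also have "\<dots> = emeasure ?I A + emeasure X_law A"
    by (rule mult_divide_eq_ennreal) auto
  finally have "4096 * emeasure lborel A = emeasure ?I A + emeasure X_law A" .
  then show ?thesis by simp
qed

lemma absolutely_continuous_X_law: "absolutely_continuous lborel X_law"
  unfolding absolutely_continuous_def
proof
  fix A :: "real set" assume "A \<in> null_sets lborel"
  then show "A \<in> null_sets X_law"
    using emeasure_X_law_le_lborel[of A] by (auto simp: null_sets_def)
qed

lemma density_X_density: "density lborel X_density = X_law"
  unfolding X_density_def using absolutely_continuous_X_law
  by (intro sigma_finite_measure.density_RN_deriv sigma_finite_lborel) auto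

lemma measurable_X_density [measurable]: "X_density \<in> borel_measurable borel"
  unfolding X_density_def by measurable

text \<open>On the set \<open>A\<close> where the density exceeds 4096, domination by 4096 times
  Lebesgue measure makes the integral of the excess zero, so the excess vanishes almost
  everywhere.\<close>

lemma AE_X_density_le: "AE x in lborel. X_density x \<le> 4096"
proof -
  define A where "A = {x. X_density x > 4096}"
  have A [measurable]: "A \<in> sets borel" unfolding A_def by measurable
  have X: "emeasure X_law A = (\<integral>\<^sup>+x. X_density x * indicator A x \<partial>lborel)"
    by (subst density_X_density[symmetric]) (simp add: emeasure_density)
  have eq: "(\<integral>\<^sup>+x. 4096 * indicator A x \<partial>lborel) = 4096 * emeasure lborel A"
    by (rule nn_integral_cmult_indicator) simp
  have "(\<integral>\<^sup>+x. 4096 * indicator A x \<partial>lborel) \<le> emeasure X_law A"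
    unfolding X by (intro nn_integral_mono) (auto simp: A_def indicator_def)
  then have le: "4096 * emeasure lborel A \<le> emeasure X_law A" unfolding eq .
  have fin: "emeasure X_law A < \<top>" by (simp add: XL.emeasure_eq_measure)
  have "(\<integral>\<^sup>+x. X_density x * indicator A x - 4096 * indicator A x \<partial>lborel) =
      emeasure X_law A - 4096 * emeasure lborel A"
    unfolding X eq[symmetric]
  proof (rule nn_integral_diff)
    show "(\<integral>\<^sup>+x. 4096 * indicator A x \<partial>lborel) \<noteq> \<infinity>"
      using le fin unfolding eq by (auto simp: top_unique)
    show "AE x in lborel. 4096 * indicator A x \<le> X_density x * indicator A x"
      by (auto simp: A_def indicator_def)
  qed measurable
  also have "\<dots> = 0"
    using emeasure_X_law_le_lborel[OF A] by (simp add: diff_eq_0_ennreal XL.emeasure_eq_measure)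
  finally have "AE x in lborel. X_density x * indicator A x - 4096 * indicator A x = 0"
    by (subst (asm) nn_integral_0_iff_AE) auto
  then show ?thesis
  proof eventually_elim
    case (elim x)
    then show ?case
      by (cases "4096 < X_density x") (auto simp: A_def diff_eq_0_iff_ennreal)
  qed
qed

text \<open>This is where a finite bound on the density, however crude, is required: it excludes the
  value infinity, which \<open>enn2real\<close> would send to 0.\<close>

lemma ennreal_X_density_norm: "ennreal X_density_norm = esssup lborel X_density"
proof -
  have "esssup lborel X_density \<le> 4096"
    by (rule esssup_I) (use AE_X_density_le in auto)
  also have "\<dots> < \<top>" by simp
  finally show ?thesis by (simp add: X_density_norm_def)
qed

lemma X_density_norm_nonneg: "0 \<le> X_density_norm"
  by (simp add: X_density_norm_def)

lemma cdf_X_law_add_le: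
  assumes "0 \<le> s"
  shows "cdf X_law (z + s) \<le> cdf X_law z + X_density_norm * s"
proof -
  have "emeasure X_law {z<..z + s} = (\<integral>\<^sup>+x. X_density x * indicator {z<..z + s} x \<partial>lborel)"
    by (subst density_X_density[symmetric]) (simp add: emeasure_density)
  also have "\<dots> \<le> (\<integral>\<^sup>+x. ennreal X_density_norm * indicator {z<..z + s} x \<partial>lborel)"
    unfolding ennreal_X_density_norm
    by (intro nn_integral_mono_AE) (use esssup_AE[of X_density lborel] in \<open>auto elim!: eventually_mono intro: mult_right_mono\<close>)
  also have "\<dots> = ennreal (X_density_norm * s)"
    using assms X_density_norm_nonneg by (simp add: nn_integral_cmult_indicator ennreal_mult)
  finally have "measure X_law {z<..z + s} \<le> X_density_norm * s"
    using assms X_density_norm_nonneg by (simp add: XL.emeasure_eq_measure)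
  then show ?thesis using cdf_X_law_diff[of z "z + s"] assms by simp
qed

section \<open>The limit distribution function and its integral equation\<close>

lemma cdf_X_law_neg: "z < 0 \<Longrightarrow> cdf X_law z = 0"
proof -
  assume z: "z < 0"
  have "AE x in X_law. x \<notin> {..z}"
    using AE_X_law_unit_interval by eventually_elim (use z in auto)
  then show ?thesis by (simp add: cdf_def measure_eq_0_null_sets AE_iff_null_sets)
qed

lemma cdf_X_law_ge_1: "1 \<le> z \<Longrightarrow> cdf X_law z = 1"
proof -
  assume z: "1 \<le> z"
  have "AE x in X_law. x \<in> {..z}"
    using AE_X_law_unit_interval by eventually_elim (use z in auto)
  then show ?thesis by (simp add: cdf_def XL.prob_eq_1)
qed

lemma cdf_X_law_bounds: "0 \<le> cdf X_law z" "cdf X_law z \<le> 1"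
  by (simp_all add: XL.cdf_nonneg XL.cdf_bounded_prob)

lemma cdf_X_law_mono: "x \<le> y \<Longrightarrow> cdf X_law x \<le> cdf X_law y"
  by (rule XL.cdf_nondecreasing)

text \<open>Mass 1 sits on an interval of length 1. The bound makes the final estimate trivial for
  small n, where the comparison argument says nothing.\<close>

lemma X_density_norm_ge_1: "1 \<le> X_density_norm"
proof (rule field_le_epsilon)
  fix e :: real assume e: "0 < e"
  define d where "d = e / (1 + X_density_norm)"
  have d: "0 < d" "X_density_norm * d \<le> e"
    using e X_density_norm_nonneg by (auto simp: d_def field_simps)
  \<comment> \<open>The interval starts slightly left of 0, since the distribution function is known
    to vanish only at negative points.\<close>
  have "1 = cdf X_law (- d + (1 + d))" by (simp add: cdf_X_law_ge_1)
  also have "\<dots> \<le> cdf X_law (- d) + X_density_norm * (1 + d)"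
    by (rule cdf_X_law_add_le) (use d in simp)
  finally show "1 \<le> X_density_norm + e"
    using d by (simp add: cdf_X_law_neg distrib_left)
qed

text \<open>\<open>split_pre z u\<close> is the value below which \<open>X\<close> must lie for \<open>sqrt u X + sqrt u (1 - sqrt u) \<le> z\<close>.\<close>

definition split_pre :: "real \<Rightarrow> real \<Rightarrow> real" where
  "split_pre z u = z / sqrt u - 1 + sqrt u"

text \<open>Condition on U: for u > 0 the map is increasing in x, and \<open>split_pre z u\<close>
  solves it for the value z. The null set u = 0, where \<open>split_pre\<close> would divide by
  zero, is dropped; the half-open interval fits the half-open pieces into which it is cut
  next.\<close>

lemma cdf_X_law_eq_integral:
  shows "integrable lborel (\<lambda>u. indicator {0<..1} u * cdf X_law (split_pre z u))"
    and "cdf X_law z = (LINT u|lborel. indicator {0<..1} u * cdf X_law (split_pre z u))"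
proof -
  have [measurable]: "(\<lambda>u. split_pre z u) \<in> borel_measurable borel"
    unfolding split_pre_def by measurable
  have [measurable]: "cdf X_law \<in> borel_measurable borel"
    by (rule borel_measurable_mono) (auto simp: mono_def cdf_X_law_mono)
  show "integrable lborel (\<lambda>u. indicator {0<..1} u * cdf X_law (split_pre z u))"
    by (rule Bochner_Integration.integrable_bound[of _ "indicator {0<..1::real} :: real \<Rightarrow> real"])
      (auto simp: indicator_def cdf_X_law_bounds)
  have B: "{w :: real \<times> real. split_map (snd w) (fst w) \<in> {..z}} \<in> sets (borel \<Otimes>\<^sub>M borel)"
    by (rule sets_split_map) simp
  have "cdf X_law z = (LINT u|uniform01. measure X_law {x. split_map u x \<le> z})"
    unfolding cdf_def using measure_X_law_eq_pair[of "{..z}"] measure_pair_eq_snd(2)[OF B] by simp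
  also have "\<dots> = (LINT u|uniform01. cdf X_law (split_pre z u))"
  proof (rule integral_cong_AE)
    show "(\<lambda>u. measure X_law {x. split_map u x \<le> z}) \<in> borel_measurable uniform01"
      using measure_pair_eq_snd(1)[OF B] by (simp add: borel_measurable_integrable)
    show "(\<lambda>u. cdf X_law (split_pre z u)) \<in> borel_measurable uniform01" by measurable
    have "AE u in uniform01. u \<noteq> (0::real)"
      by (rule AE_uniform_measureI) (use AE_lborel_singleton[of 0] in \<open>auto elim!: eventually_mono\<close>)
    then show "AE u in uniform01. measure X_law {x. split_map u x \<le> z} = cdf X_law (split_pre z u)"
      using AE_uniform01
    proof eventually_elim
      case (elim u)
      then have "{x. split_map u x \<le> z} = {..split_pre z u}"
        by (auto simp: split_map_def split_pre_def field_simps)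
      then show ?case by (simp add: cdf_def)
    qed
  qed
  also have "\<dots> = (LINT u|lborel. indicator {0..1} u * cdf X_law (split_pre z u))"
    by (rule integral_uniform01) measurable
  also have "\<dots> = (LINT u|lborel. indicator {0<..1} u * cdf X_law (split_pre z u))"
    by (rule integral_cong_AE)
      (auto intro!: eventually_mono[OF AE_lborel_singleton[of 0]] simp: indicator_def)
  finally show "cdf X_law z = (LINT u|lborel. indicator {0<..1} u * cdf X_law (split_pre z u))" .
qed

lemma integral_steps:
  fixes c b :: "nat \<Rightarrow> real"
  assumes "\<And>k. k \<in> K \<Longrightarrow> c k \<le> c (Suc k)" "finite K"
  shows "integrable lborel (\<lambda>u. \<Sum>k\<in>K. b k * indicator {c k<..c (Suc k)} u)"
    and "(LINT u|lborel. (\<Sum>k\<in>K. b k * indicator {c k<..c (Suc k)} u)) = (\<Sum>k\<in>K. (c (Suc k) - c k) * b k)"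
proof -
  have i: "integrable lborel (\<lambda>u. b k * indicator {c k<..c (Suc k)} u)" for k
    by (cases "c k \<le> c (Suc k)")
      (auto intro!: Bochner_Integration.integrable_mult_right integrable_real_indicator)
  then show "integrable lborel (\<lambda>u. \<Sum>k\<in>K. b k * indicator {c k<..c (Suc k)} u)"
    by (rule Bochner_Integration.integrable_sum)
  have "(LINT u|lborel. b k * indicator {c k<..c (Suc k)} u) = (c (Suc k) - c k) * b k" if "k \<in> K" for k
    using assms(1)[OF that] by (simp)
  then show "(LINT u|lborel. (\<Sum>k\<in>K. b k * indicator {c k<..c (Suc k)} u)) = (\<Sum>k\<in>K. (c (Suc k) - c k) * b k)"
    using i by (subst Bochner_Integration.integral_sum) (auto intro: sum.cong)
qed

text \<open>The length of the piece \<open>{c k<..c (Suc k)}\<close> will be the probability that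
  the search goes on with size \<open>k\<close>, and \<open>b k\<close> will come from the induction
  hypothesis. The pieces have to cover the whole interval, and every point u is charged to one piece
  containing it.\<close>

lemma cdf_X_law_le_steps:
  fixes c b :: "nat \<Rightarrow> real"
  assumes mono: "\<And>k. k \<in> {m..<n} \<Longrightarrow> c k \<le> c (Suc k)" and ends: "c m = 0" "c n = 1" "m \<le> n"
    and le: "\<And>k u. k \<in> {m..<n} \<Longrightarrow> c k < u \<Longrightarrow> u \<le> c (Suc k) \<Longrightarrow> cdf X_law (split_pre z u) \<le> b k"
    and b: "\<And>k. k \<in> {m..<n} \<Longrightarrow> 0 \<le> b k"
  shows "cdf X_law z \<le> (\<Sum>k\<in>{m..<n}. (c (Suc k) - c k) * b k)"
proof -
  have "cdf X_law z \<le> (LINT u|lborel. (\<Sum>k\<in>{m..<n}. b k * indicator {c k<..c (Suc k)} u))"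
    unfolding cdf_X_law_eq_integral(2)[of z]
  proof (rule integral_mono)
    fix u :: real
    show "indicator {0<..1} u * cdf X_law (split_pre z u) \<le> (\<Sum>k\<in>{m..<n}. b k * indicator {c k<..c (Suc k)} u)"
    proof (cases "u \<in> {0<..1}")
      case True
      have "\<exists>k\<in>{m..<j}. c k < u \<and> u \<le> c (Suc k)" if "m \<le> j" "j \<le> n" "u \<le> c j" for j
        using that
      proof (induction j rule: dec_induct)
        case base
        then show ?case using True ends by auto
      next
        case (step j)
        show ?case
        proof (cases "u \<le> c j")
          case False
          then show ?thesis using step by (intro bexI[of _ j]) auto
        qed (use step in fastforce)
      qed
      from this[of n] True ends obtain k where k: "k \<in> {m..<n}" "c k < u" "u \<le> c (Suc k)" by auto
      have "indicator {0<..1} u * cdf X_law (split_pre z u) \<le> b k * indicator {c k<..c (Suc k)} u"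
        using True k le[OF k] by simp
      also have "\<dots> \<le> (\<Sum>k\<in>{m..<n}. b k * indicator {c k<..c (Suc k)} u)"
        by (rule member_le_sum) (use k b in auto)
      finally show ?thesis .
    qed (use b in \<open>auto intro!: sum_nonneg\<close>)
  next
    show "integrable lborel (\<lambda>u. indicator {0<..1} u * cdf X_law (split_pre z u))"
      by (rule cdf_X_law_eq_integral(1))
    show "integrable lborel (\<lambda>u. \<Sum>k\<in>{m..<n}. b k * indicator {c k<..c (Suc k)} u)"
      using mono by (intro integral_steps(1)) auto
  qed
  also have "\<dots> = (\<Sum>k\<in>{m..<n}. (c (Suc k) - c k) * b k)"
    using mono by (intro integral_steps(2)) auto
  finally show ?thesis .
qed

text \<open>In this direction the pieces must not overlap, but since the integrand is nonnegative
  they need not fill the interval; the values \<open>a k\<close> may have any sign.\<close>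

lemma steps_le_cdf_X_law:
  fixes c a :: "nat \<Rightarrow> real"
  assumes mono: "\<And>k. k \<in> {m..<n} \<Longrightarrow> c k \<le> c (Suc k)" and ends: "0 \<le> c m" "c n \<le> 1"
    and le: "\<And>k u. k \<in> {m..<n} \<Longrightarrow> c k < u \<Longrightarrow> u \<le> c (Suc k) \<Longrightarrow> a k \<le> cdf X_law (split_pre z u)"
  shows "(\<Sum>k\<in>{m..<n}. (c (Suc k) - c k) * a k) \<le> cdf X_law z"
proof -
  have incr: "c j \<le> c k" if "m \<le> j" "j \<le> k" "k \<le> n" for j k
    using that(2,1,3) by (induction k rule: dec_induct) (auto intro: order.trans[OF _ mono])
  have "(\<Sum>k\<in>{m..<n}. (c (Suc k) - c k) * a k) =
      (LINT u|lborel. (\<Sum>k\<in>{m..<n}. a k * indicator {c k<..c (Suc k)} u))"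
    using mono by (intro integral_steps(2)[symmetric]) auto
  also have "\<dots> \<le> cdf X_law z"
    unfolding cdf_X_law_eq_integral(2)[of z]
  proof (rule integral_mono)
    fix u :: real
    show "(\<Sum>k\<in>{m..<n}. a k * indicator {c k<..c (Suc k)} u) \<le> indicator {0<..1} u * cdf X_law (split_pre z u)"
    proof (cases "\<exists>k\<in>{m..<n}. c k < u \<and> u \<le> c (Suc k)")
      case True
      then obtain k where k: "k \<in> {m..<n}" "c k < u" "u \<le> c (Suc k)" by auto
      have "(\<Sum>i\<in>{m..<n}. a i * indicator {c i<..c (Suc i)} u) =
          (\<Sum>i\<in>{m..<n}. if i = k then a k else 0)"
      proof (rule sum.cong[OF refl])
        fix i assume i: "i \<in> {m..<n}"
        have "u \<notin> {c i<..c (Suc i)}" if "i \<noteq> k"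
        proof (cases "i < k")
          case True
          then show ?thesis using incr[of "Suc i" k] i k by auto
        next
          case False
          then show ?thesis using incr[of "Suc k" i] i k that by auto
        qed
        then show "a i * indicator {c i<..c (Suc i)} u = (if i = k then a k else 0)" using k by auto
      qed
      also have "\<dots> = a k" using k by simp
      also have "\<dots> \<le> cdf X_law (split_pre z u)" using le[OF k] .
      also have "\<dots> = indicator {0<..1} u * cdf X_law (split_pre z u)"
      proof -
        have "0 < u" "u \<le> 1" using incr[of m k] incr[of "Suc k" n] k ends by auto
        then show ?thesis by simp
      qed
      finally show ?thesis .
    next
      case False
      then have "(\<Sum>i\<in>{m..<n}. a i * indicator {c i<..c (Suc i)} u) = 0"
        by (intro sum.neutral) auto
      then show ?thesis by (simp add: cdf_X_law_bounds)
    qed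
  next
    show "integrable lborel (\<lambda>u. indicator {0<..1} u * cdf X_law (split_pre z u))"
      by (rule cdf_X_law_eq_integral(1))
    show "integrable lborel (\<lambda>u. \<Sum>k\<in>{m..<n}. a k * indicator {c k<..c (Suc k)} u)"
      using mono by (intro integral_steps(1)) auto
  qed
  finally show ?thesis .
qed

section \<open>Partitioning as a rearrangement of positions\<close>

text \<open>The value 1 in the first alternative is the stop at the end of the list that makes the
  function total. Scans count positions from 1, whereas \<open>p\<close> is a list index from 0, so
  the entries passed over have the indices from \<open>scan_down A a j\<close> to
  \<open>j - 2\<close>.\<close>

lemma scan_down_spec:
  assumes "2 \<le> j"
  shows "(scan_down A a j = 1 \<or> A ! (scan_down A a j - 1) \<le> a) \<and>
    (\<forall>p. scan_down A a j \<le> p \<longrightarrow> p < j - 1 \<longrightarrow> a < A ! p)"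
  using assms
proof (induction A a j rule: scan_down.induct)
  case (2 A a j)
  show ?case
  proof (cases "j \<le> 1 \<or> A ! (j - 1) \<le> a")
    case True
    then show ?thesis using 2 by auto
  next
    case False
    then have IH: "(scan_down A a j = 1 \<or> A ! (scan_down A a j - 1) \<le> a) \<and>
      (\<forall>p. scan_down A a j \<le> p \<longrightarrow> p < j - 1 \<longrightarrow> a < A ! p)"
      using 2 by auto
    have eq: "scan_down A a (Suc j) = scan_down A a j" using False by simp
    have "a < A ! p" if "scan_down A a j \<le> p" "p < j" for p
      using IH that False by (cases "p = j - 1") auto
    then show ?thesis using IH unfolding eq by simp
  qed
qed simp

lemma scan_up_spec:
  assumes "i < length A"
  shows "scan_up A a i \<le> length A \<and>
    (scan_up A a i = length A \<or> a \<le> A ! (scan_up A a i - 1)) \<and>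
    (\<forall>p. i \<le> p \<longrightarrow> p < scan_up A a i - 1 \<longrightarrow> A ! p < a)"
  using assms
proof (induction A a i rule: scan_up.induct)
  case (1 A a i)
  show ?case
  proof (cases "length A \<le> Suc i \<or> a \<le> A ! i")
    case True
    then have "scan_up A a i = Suc i" by (subst scan_up.simps) simp
    then show ?thesis using True 1 by auto
  next
    case False
    then have eq: "scan_up A a i = scan_up A a (Suc i)" by (subst scan_up.simps) simp
    show ?thesis unfolding eq using 1 False
      by (metis le_antisym not_less not_less_eq_eq nle_le)
  qed
qed

definition same_pattern :: "nat \<Rightarrow> nat list \<Rightarrow> nat \<Rightarrow> nat list \<Rightarrow> bool" where
  "same_pattern a xs b ys \<longleftrightarrow> length xs = length ys \<and>
     (\<forall>p<length ys. (xs ! p \<le> a \<longleftrightarrow> ys ! p \<le> b) \<and> (a \<le> xs ! p \<longleftrightarrow> b \<le> ys ! p))"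

lemma scan_down_cong:
  assumes "same_pattern a xs b ys" "j \<le> Suc (length ys)"
  shows "scan_down xs a j = scan_down ys b j"
  using assms(2)
proof (induction j)
  case (Suc j)
  have "xs ! (j - 1) \<le> a \<longleftrightarrow> ys ! (j - 1) \<le> b" if "\<not> j \<le> 1"
  proof -
    have "j - 1 < length ys" using Suc.prems that by linarith
    then show ?thesis using assms(1) by (auto simp: same_pattern_def)
  qed
  then show ?case using Suc by auto
qed simp

lemma scan_up_cong:
  assumes "same_pattern a xs b ys" "i < length ys"
  shows "scan_up xs a i = scan_up ys b i"
  using assms
proof (induction ys b i rule: scan_up.induct)
  case (1 ys b i)
  have len: "length xs = length ys" using 1 by (simp add: same_pattern_def)
  show ?case
  proof (cases "length ys \<le> Suc i")
    case True
    then show ?thesis using len by (simp add: scan_up.simps)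
  next
    case False
    then have "a \<le> xs ! i \<longleftrightarrow> b \<le> ys ! i" using 1 by (simp add: same_pattern_def)
    then show ?thesis using 1 False len by (simp add: scan_up.simps[of _ _ i])
  qed
qed

lemma exchange_eq_permute_list:
  assumes "1 \<le> i" "i \<le> length A" "1 \<le> j" "j \<le> length A"
  shows "exchange A i j = permute_list (Transposition.transpose (i - 1) (j - 1)) A"
  using assms
  by (intro nth_equalityI) (auto simp: exchange_def permute_list_def nth_list_update Transposition.transpose_def)

lemma same_pattern_permute_list:
  assumes "same_pattern a xs b ys" "\<pi> permutes {..<length ys}"
  shows "same_pattern a (permute_list \<pi> xs) b (permute_list \<pi> ys)"
  using assms permutes_in_image[OF assms(2)] by (auto simp: same_pattern_def permute_list_nth)

text \<open>
  The loop inspects the list only through comparisons with the pivot, so lists with the same pattern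
  undergo the same rearrangement.
\<close>

lemma ex_hoare_loop_permutation:
  assumes "2 \<le> j" "j \<le> Suc (length ys)" "i < length ys"
  shows "\<exists>\<pi> m c. \<pi> permutes {..<length ys} \<and>
    (\<forall>xs a. same_pattern a xs b ys \<longrightarrow> hoare_loop xs a i j = (permute_list \<pi> xs, m, c))"
  using assms
proof (induction ys b i j rule: hoare_loop.induct)
  case (1 ys b i j)
  define i' j' where "i' = scan_up ys b i" and "j' = scan_down ys b j"
  have scans: "scan_up xs a i = i'" "scan_down xs a j = j'" if "same_pattern a xs b ys" for xs a
    using scan_up_cong[OF that] scan_down_cong[OF that] 1 by (auto simp: i'_def j'_def)
  show ?case
  proof (cases "i' < j'")
    case False
    have "hoare_loop xs a i j = (permute_list id xs, j', 0)" if "same_pattern a xs b ys" for xs a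
      using False by (subst hoare_loop.simps) (simp add: scans[OF that] Let_def)
    then show ?thesis using permutes_id by blast
  next
    case True
    have ij: "1 \<le> i'" "i' < j'" "j' \<le> length ys" "i' < length ys"
      using True scan_up_greater[of i ys b] scan_down_less[of j ys b] 1 by (auto simp: i'_def j'_def)
    define \<tau> where "\<tau> = Transposition.transpose (i' - 1) (j' - 1)"
    have \<tau>: "\<tau> permutes {..<length ys}"
      unfolding \<tau>_def using ij by (intro permutes_swap_id) auto
    have ex: "exchange xs i' j' = permute_list \<tau> xs" if "length xs = length ys" for xs :: "nat list"
      unfolding \<tau>_def using ij that by (intro exchange_eq_permute_list) auto
    have "\<exists>\<pi> m c. \<pi> permutes {..<length (exchange ys i' j')} \<and>
      (\<forall>xs a. same_pattern a xs b (exchange ys i' j') \<longrightarrow> hoare_loop xs a i' j' = (permute_list \<pi> xs, m, c))"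
      by (rule "1.IH"[OF j'_def i'_def True]) (use ij in auto)
    then obtain \<pi> m c where \<pi>: "\<pi> permutes {..<length ys}"
      and rec: "\<And>xs a. same_pattern a xs b (permute_list \<tau> ys) \<Longrightarrow> hoare_loop xs a i' j' = (permute_list \<pi> xs, m, c)"
      by (auto simp: ex)
    have "hoare_loop xs a i j = (permute_list (\<tau> \<circ> \<pi>) xs, m, Suc c)" if sp: "same_pattern a xs b ys" for xs a
    proof -
      have len: "length xs = length ys" using sp by (simp add: same_pattern_def)
      have "hoare_loop (exchange xs i' j') a i' j' = (permute_list \<pi> (permute_list \<tau> xs), m, c)"
        using rec[OF same_pattern_permute_list[OF sp \<tau>]] by (simp add: ex len)
      then show ?thesis using True len \<pi>
        by (subst hoare_loop.simps) (simp add: scans[OF sp] Let_def permute_list_compose)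
    qed
    then show ?thesis using permutes_compose[OF \<pi> \<tau>] by blast
  qed
qed

definition smalls :: "nat \<Rightarrow> nat list \<Rightarrow> nat set" where
  "smalls a xs = {p. p < length xs \<and> xs ! p < a}"

lemma finite_smalls [simp]: "finite (smalls a xs)"
  by (simp add: smalls_def)

text \<open>
  Before the first exchange the pivot sits at index \<open>0\<close>; the first exchange moves it to the right
  of the part still to be scanned, which the hypotheses \<open>piv\<close> and \<open>piv0\<close> record.
\<close>

lemma hoare_loop_correct:
  assumes "2 \<le> j" "j \<le> Suc (length A)" "i < length A" "i < j"
    and "\<forall>p<i. A ! p < a" and "\<forall>p. j - 1 \<le> p \<longrightarrow> p < length A \<longrightarrow> a \<le> A ! p"
    and piv: "\<forall>p<j - 1. A ! p = a \<longrightarrow> p = 0 \<and> i = 0" and piv0: "i = 0 \<longrightarrow> A ! 0 = a"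
    and "smalls a A \<noteq> {}"
    and "hoare_loop A a i j = (B, m, c)"
  shows "m = card (smalls a A) \<and> c = card {p\<in>smalls a A. card (smalls a A) \<le> p} \<and>
    (\<forall>p<card (smalls a A). B ! p < a) \<and>
    (\<forall>p. card (smalls a A) \<le> p \<longrightarrow> p < length A \<longrightarrow> a \<le> B ! p)"
  using assms
proof (induction A a i j arbitrary: B m c rule: hoare_loop.induct)
  case (1 A a i j)
  note prems = "1.prems"
  define n where "n = length A"
  define s where "s = card (smalls a A)"
  define i' j' where "i' = scan_up A a i" and "j' = scan_down A a j"
  have j': "1 \<le> j'" "j' < j" "j' \<le> n"
    using scan_down_less[of j A a] scan_down_ge_1[of j A a] prems by (auto simp: j'_def n_def)
  have i': "i < i'" "i' \<le> n"
    using scan_up_greater[of i A a] scan_up_spec[of i A a] prems by (auto simp: i'_def n_def)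
  have sd: "j' = 1 \<or> A ! (j' - 1) \<le> a" and sd': "\<And>p. j' \<le> p \<Longrightarrow> p < j - 1 \<Longrightarrow> a < A ! p"
    using scan_down_spec[of j A a] prems by (auto simp: j'_def)
  have su: "i' = n \<or> a \<le> A ! (i' - 1)" and su': "\<And>p. i \<le> p \<Longrightarrow> p < i' - 1 \<Longrightarrow> A ! p < a"
    using scan_up_spec[of i A a] prems by (auto simp: i'_def n_def)
  have hi: "a \<le> A ! p" if "j' \<le> p" "p < n" for p
    using sd'[of p] that prems(6) by (cases "p < j - 1") (auto simp: n_def)
  have lo: "A ! p < a" if "p < i' - 1" for p
    using su'[of p] that prems(5) by (cases "p < i") auto
  show ?case
  proof (cases "i' < j'")
    case True
    have small: "A ! (j' - 1) < a"
    proof -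
      have "A ! (j' - 1) \<noteq> a"
      proof
        assume "A ! (j' - 1) = a"
        moreover have "j' - 1 < j - 1" using j' True i' by linarith
        ultimately have "j' - 1 = 0" using prems(7) by blast
        then show False using True i' by linarith
      qed
      then show ?thesis using sd True i' by auto
    qed
    have large: "a \<le> A ! (i' - 1)" using su True j' by auto
    define A' where "A' = exchange A i' j'"
    have lenA': "length A' = n" by (simp add: A'_def n_def)
    define u v where "u = i' - 1" and "v = j' - 1"
    have uv: "i' = Suc u" "j' = Suc v" "u < v" "v < n" "v < j - 1"
      using True i' j' by (auto simp: u_def v_def)
    have small_v: "A ! v < a" and large_u: "a \<le> A ! u" using small large by (simp_all add: uv)
    have nth: "A' ! p = (if p = u then A ! v else if p = v then A ! u else A ! p)" if "p < n" for p
      using that uv by (auto simp: A'_def exchange_def n_def nth_list_update)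
    have sm': "smalls a A' = insert u (smalls a A - {v})"
    proof (rule set_eqI)
      fix p show "p \<in> smalls a A' \<longleftrightarrow> p \<in> insert u (smalls a A - {v})"
        using nth[of p] small_v large_u uv
        by (cases "p = u"; cases "p = v") (auto simp: smalls_def lenA' n_def[symmetric])
    qed
    have in_s: "v \<in> smalls a A" "u \<notin> smalls a A"
      using small_v large_u uv by (auto simp: smalls_def n_def)
    have card': "card (smalls a A') = s"
      unfolding sm' s_def using in_s card_Suc_Diff1[of "smalls a A" v] by simp
    have "insert v {..<u} \<subseteq> smalls a A"
      using lo small_v uv by (auto simp: smalls_def n_def)
    from card_mono[OF _ this] have "i' \<le> s" using uv by (simp add: s_def)
    have "p \<in> {..<Suc v} - {u}" if "p \<in> smalls a A" for p
      using hi[of p] in_s that uv by (cases "p < Suc v") (auto simp: smalls_def n_def)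
    then have "smalls a A \<subseteq> {..<Suc v} - {u}" by blast
    from card_mono[OF _ this] have "s \<le> v" using uv by (simp add: s_def)
    \<comment> \<open>Since u < s <= v, the exchange takes exactly one small entry out of the
      positions from \<open>s\<close> on. The exchanges are therefore counted by the small entries
      that initially lie there.\<close>
    have "{p\<in>smalls a A. s \<le> p} = insert v {p\<in>smalls a A'. s \<le> p}"
      using in_s \<open>i' \<le> s\<close> \<open>s \<le> v\<close> uv unfolding sm' by auto
    moreover have "v \<notin> smalls a A'" using uv unfolding sm' by auto
    ultimately have cnt: "card {p\<in>smalls a A. s \<le> p} = Suc (card {p\<in>smalls a A'. s \<le> p})" by simp
    obtain B' m' c' where rec: "hoare_loop A' a i' j' = (B', m', c')" by (metis prod_cases3)
    have res: "B = B'" "m = m'" "c = Suc c'"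
      using prems(10) True rec by (subst (asm) hoare_loop.simps; simp add: Let_def i'_def j'_def A'_def)+
    have "m' = card (smalls a A') \<and> c' = card {p\<in>smalls a A'. card (smalls a A') \<le> p} \<and>
      (\<forall>p<card (smalls a A'). B' ! p < a) \<and>
      (\<forall>p. card (smalls a A') \<le> p \<longrightarrow> p < length A' \<longrightarrow> a \<le> B' ! p)"
      unfolding A'_def
    proof (rule "1.IH"[OF j'_def i'_def True])
      show "2 \<le> j'" using True i' by linarith
      show "j' \<le> Suc (length (exchange A i' j'))" "i' < length (exchange A i' j')" "i' < j'"
        using True j' by (auto simp: n_def)
      show "\<forall>p<i'. exchange A i' j' ! p < a"
        unfolding A'_def[symmetric] using nth small_v lo uv by (auto simp: less_Suc_eq)
      show "\<forall>p. j' - 1 \<le> p \<longrightarrow> p < length (exchange A i' j') \<longrightarrow> a \<le> exchange A i' j' ! p"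
        unfolding A'_def[symmetric] lenA' using nth large_u hi uv by (auto simp: Suc_le_eq)
      show "\<forall>p<j' - 1. exchange A i' j' ! p = a \<longrightarrow> p = 0 \<and> i' = 0"
      proof (intro allI impI)
        fix p assume p: "p < j' - 1" "exchange A i' j' ! p = a"
        then have ne: "p \<noteq> u" "A ! p = a" "p < j - 1"
          using nth[of p] small_v uv unfolding A'_def[symmetric] by (auto split: if_splits)
        then have "p = 0" "i = 0" using prems(7) by auto
        moreover from this have "A ! 0 = a" using prems(8) by blast
        ultimately have "u = 0" using su'[of 0] uv by (cases u) auto
        then show "p = 0 \<and> i' = 0" using ne \<open>p = 0\<close> by simp
      qed
      show "i' = 0 \<longrightarrow> exchange A i' j' ! 0 = a" using i' by simp
      show "smalls a (exchange A i' j') \<noteq> {}" using sm' by (simp add: A'_def)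
      show "hoare_loop (exchange A i' j') a i' j' = (B', m', c')" using rec by (simp add: A'_def)
    qed
    then show ?thesis using res cnt card' lenA' by (auto simp: s_def n_def)
  next
    case False
    have res: "B = A" "m = j'" "c = 0"
      using prems(10) False by (subst (asm) hoare_loop.simps; simp add: Let_def i'_def j'_def)+
    \<comment> \<open>Some small entry lies left of \<open>j'\<close>. If the downward scan ran to
      the end of the list, so that \<open>j' = 1\<close>, this must be the entry at index 0.\<close>
    obtain p0 where p0: "p0 < n" "A ! p0 < a" using prems(9) by (auto simp: smalls_def n_def)
    have "p0 < j'" using hi[of p0] p0 by (cases "p0 < j'") auto
    have all: "A ! p < a" if "p < j'" for p
    proof (cases "p < i' - 1")
      case True
      then show ?thesis by (rule lo)
    next
      case not: False
      then have p: "p = j' - 1" using that False by linarith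
      show ?thesis
      proof (cases "j' = 1")
        case True
        then show ?thesis using p \<open>p0 < j'\<close> p0 by auto
      next
        case False
        then have "p < j - 1" "p \<noteq> 0" using p j' by linarith+
        then have "A ! p \<noteq> a" using prems(7) by blast
        then show ?thesis using sd False p by auto
      qed
    qed
    have "smalls a A = {..<j'}"
      using all hi j' by (auto simp: smalls_def n_def not_le[symmetric] intro: order.strict_trans2)
    then show ?thesis using res all hi by (auto simp: n_def)
  qed
qed

lemma hoare_partition_correct:
  assumes "2 \<le> length A" "\<forall>p. 0 < p \<longrightarrow> p < length A \<longrightarrow> A ! p \<noteq> hd A" "smalls (hd A) A = S" "S \<noteq> {}"
    and "hoare_partition A = (B, m, c)"
  shows "m = card S \<and> c = card (S \<inter> {card S..<length A}) \<and>
    (\<forall>p<card S. B ! p < hd A) \<and> (\<forall>p. card S \<le> p \<longrightarrow> p < length A \<longrightarrow> hd A \<le> B ! p)"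
proof -
  have "{p\<in>S. card S \<le> p} = S \<inter> {card S..<length A}"
    using assms(3) by (auto simp: smalls_def)
  moreover have "A ! 0 = hd A" using assms(1) by (cases A) auto
  moreover have "m = card (smalls (hd A) A) \<and>
    c = card {p\<in>smalls (hd A) A. card (smalls (hd A) A) \<le> p} \<and>
    (\<forall>p<card (smalls (hd A) A). B ! p < hd A) \<and>
    (\<forall>p. card (smalls (hd A) A) \<le> p \<longrightarrow> p < length A \<longrightarrow> hd A \<le> B ! p)"
  proof (rule hoare_loop_correct[of "Suc (length A)"])
    show "\<forall>p<Suc (length A) - 1. A ! p = hd A \<longrightarrow> p = 0 \<and> (0::nat) = 0" using assms(2) by auto
    show "hoare_loop A (hd A) 0 (Suc (length A)) = (B, m, c)"
      using assms(5) by (simp add: hoare_partition_def)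
  qed (use assms \<open>A ! 0 = hd A\<close> in auto)
  ultimately show ?thesis using assms(3) by simp
qed

text \<open>A minimal pivot is exceptional: the downward scan runs down to the pivot itself, so the
  left sublist has size 1, although no entry is small.\<close>

lemma hoare_partition_min:
  assumes "2 \<le> length A" "\<forall>p. 0 < p \<longrightarrow> p < length A \<longrightarrow> hd A < A ! p"
  shows "hoare_partition A = (A, 1, 0)"
proof -
  have 0: "A ! 0 = hd A" using assms(1) by (cases A) auto
  define j where "j = scan_down A (hd A) (Suc (length A))"
  have "j = 1"
  proof (rule ccontr)
    assume *: "j \<noteq> 1"
    have j: "1 \<le> j" "j < Suc (length A)"
      using scan_down_ge_1[of "Suc (length A)" A "hd A"] scan_down_less[of "Suc (length A)" A "hd A"] assms(1)
      unfolding j_def by linarith+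
    moreover have "A ! (j - 1) \<le> hd A"
      using scan_down_spec[of "Suc (length A)" A "hd A"] assms(1) * unfolding j_def by linarith
    moreover have "0 < j - 1" "j - 1 < length A" using * j by linarith+
    ultimately show False using assms(2) by (meson leD)
  qed
  moreover have "1 \<le> scan_up A (hd A) 0" using scan_up_greater[of 0 A "hd A"] by simp
  ultimately show ?thesis
    unfolding hoare_partition_def
    by (subst hoare_loop.simps) (simp add: Let_def j_def del: scan_down.simps)
qed

text \<open>One list with entries 0, 1, 2 for small, pivot and large represents all lists with small
  positions \<open>S\<close>. The run on it provides the rearrangement \<open>\<pi>\<close>, and
  correctness of the loop on it identifies the sizes and the number of exchanges.\<close>

lemma ex_partition_permutation:
  assumes S: "S \<subseteq> {1..<n}" "S \<noteq> {}"
  shows "\<exists>\<pi>. \<pi> permutes {..<n} \<and> \<pi> ` {..<card S} = S \<and>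
    (\<forall>xs. length xs = n \<and> distinct xs \<and> smalls (hd xs) xs = S \<longrightarrow>
       hoare_partition xs = (permute_list \<pi> xs, card S, card (S \<inter> {card S..<n})))"
proof -
  have n: "2 \<le> n" using S by (cases "n \<le> 1") auto
  define ys where "ys = map (\<lambda>p. if p = 0 then 1 else if p \<in> S then 0 else 2 :: nat) [0..<n]"
  have len: "length ys = n" by (simp add: ys_def)
  have nth: "ys ! p = (if p = 0 then 1 else if p \<in> S then 0 else 2)" if "p < n" for p
    using that by (simp add: ys_def)
  have hd: "hd ys = 1" using n nth[of 0] len by (cases ys) auto
  have sm: "smalls 1 ys = S" 
  proof (rule set_eqI)
    fix p show "p \<in> smalls 1 ys \<longleftrightarrow> p \<in> S"
      using S nth[of p] by (cases "p < n") (auto simp: smalls_def len split: if_splits)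
  qed
  obtain \<pi> m c where \<pi>: "\<pi> permutes {..<n}"
    and run: "\<And>xs a. same_pattern a xs 1 ys \<Longrightarrow> hoare_loop xs a 0 (Suc n) = (permute_list \<pi> xs, m, c)"
    using ex_hoare_loop_permutation[of "Suc n" ys 0 1] n len by auto
  have "hoare_partition ys = (permute_list \<pi> ys, m, c)"
    using run[of 1 ys] by (simp add: hoare_partition_def hd len same_pattern_def)
  then have mc: "m = card S" "c = card (S \<inter> {card S..<n})" and B: "\<forall>p<card S. permute_list \<pi> ys ! p < 1"
    using hoare_partition_correct[of ys S "permute_list \<pi> ys" m c] n nth sm S by (auto simp: hd len)
  have "S \<subseteq> {..<n}" using S by auto
  then have cS: "card S \<le> n" using card_mono[of "{..<n}" S] by simp
  have "\<pi> ` {..<card S} \<subseteq> S"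
  proof
    fix q assume "q \<in> \<pi> ` {..<card S}"
    then obtain p where p: "p < card S" "q = \<pi> p" by auto
    then have "ys ! q < 1" using B cS \<pi> by (auto simp: permute_list_nth len)
    moreover have "q < n" using permutes_in_image[OF \<pi>, of p] p cS by auto
    ultimately show "q \<in> S" using nth[of q] by (auto split: if_splits)
  qed
  moreover have "card (\<pi> ` {..<card S}) = card S"
    using permutes_inj[OF \<pi>] by (simp add: card_image inj_on_subset)
  ultimately have "\<pi> ` {..<card S} = S"
    using S by (intro card_subset_eq) (auto dest: finite_subset)
  moreover have "hoare_partition xs = (permute_list \<pi> xs, card S, card (S \<inter> {card S..<n}))"
    if xs: "length xs = n" "distinct xs" "smalls (hd xs) xs = S" for xs
  proof -
    have "same_pattern (hd xs) xs 1 ys"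
      unfolding same_pattern_def
    proof (intro conjI allI impI)
      fix p assume p: "p < length ys"
      have eq: "xs ! p = hd xs \<longleftrightarrow> p = 0"
      proof -
        have "hd xs = xs ! 0" using xs n by (cases xs) auto
        then show ?thesis using xs p n nth_eq_iff_index_eq[of xs p 0] by (auto simp: len)
      qed
      have lt: "xs ! p < hd xs \<longleftrightarrow> p \<in> S" using xs p by (auto simp: smalls_def len)
      have "0 \<notin> S" using S by auto
      then show "xs ! p \<le> hd xs \<longleftrightarrow> ys ! p \<le> 1" "hd xs \<le> xs ! p \<longleftrightarrow> 1 \<le> ys ! p"
        using nth[of p] p eq lt by (auto simp: len)
    qed (simp add: xs len)
    then show ?thesis using run[of "hd xs" xs] mc xs by (simp add: hoare_partition_def)
  qed
  ultimately show ?thesis using \<pi> by blast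
qed

text \<open>
  \<open>pivot_lists A a S\<close> collects the arrangements of \<open>A\<close> with pivot \<open>a\<close> whose elements below the
  pivot occupy the positions \<open>S\<close>. After partitioning, the pivot always lands at the same index of
  the right sublist, and it is the minimum there. This is why the arrangements \<open>min_at A i\<close>
  with prescribed position of the minimum are the right states for the recursion.
\<close>

definition pivot_lists :: "nat set \<Rightarrow> nat \<Rightarrow> nat set \<Rightarrow> nat list set" where
  "pivot_lists A a S = {xs\<in>permutations_of_set A. hd xs = a \<and> smalls a xs = S}"

definition min_at :: "nat set \<Rightarrow> nat \<Rightarrow> nat list set" where
  "min_at A i = {xs\<in>permutations_of_set A. xs ! i = Min A}"

lemma finite_pivot_lists [simp]: "finite (pivot_lists A a S)"
  by (simp add: pivot_lists_def)

lemma finite_min_at [simp]: "finite (min_at A i)"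
  by (simp add: min_at_def)

text \<open>All lists with small positions \<open>S\<close> undergo the same rearrangement, which
  can be undone; so the left and the right sublist vary independently. The pivot moves from index 0
  to \<open>inv \<pi> 0\<close>, which is not below \<open>s\<close>, and this is the only
  constraint on the right sublist.\<close>

lemma bij_betw_partition_sublists:
  assumes A: "finite A" "a \<in> A" and n: "n = card A" and \<pi>: "\<pi> permutes {..<n}"
    and S: "\<pi> ` {..<s} = S" "S \<subseteq> {1..<n}" and s: "s = card {x\<in>A. x < a}"
  shows "bij_betw (\<lambda>xs. (take s (permute_list \<pi> xs), drop s (permute_list \<pi> xs)))
    (pivot_lists A a S)
    (permutations_of_set {x\<in>A. x < a} \<times> {r\<in>permutations_of_set {x\<in>A. a \<le> x}. r ! (inv \<pi> 0 - s) = a})"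
    (is "bij_betw ?f ?X (permutations_of_set ?L \<times> {r\<in>permutations_of_set ?R. _})")
proof (rule bij_betw_byWitness[where f' = "\<lambda>(l, r). permute_list (inv \<pi>) (l @ r)"])
  have LR: "?L \<union> ?R = A" "?L \<inter> ?R = {}" "finite ?L" "finite ?R" using A by auto
  have sn: "s + card ?R = n" unfolding s n using card_Un_disjoint[OF LR(3,4,2)] LR(1) by simp
  have "a \<in> ?R" using A by auto
  then have "card ?R > 0" using LR by (auto simp: card_gt_0_iff)
  then have s_lt: "s < n" using sn by linarith
  have inv: "inv \<pi> permutes {..<n}" by (rule permutes_inv[OF \<pi>])
  have comp: "\<pi> \<circ> inv \<pi> = id" "inv \<pi> \<circ> \<pi> = id"
    using \<pi> by (simp_all add: permutes_inv_o)
  have pi0: "inv \<pi> 0 < n" using permutes_in_image[OF inv, of 0] s_lt by simp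
  have in_S: "p \<in> S \<longleftrightarrow> inv \<pi> p < s" for p
    using S(1) permutes_inverses[OF \<pi>] by (metis image_iff lessThan_iff)
  have pi0s: "s \<le> inv \<pi> 0" using in_S[of 0] S by (auto simp: not_less[symmetric])
  have len: "length xs = n" if "xs \<in> permutations_of_set A" for xs
    using length_finite_permutations_of_set[OF that] n by simp
  show "\<forall>xs\<in>?X. (case ?f xs of (l, r) \<Rightarrow> permute_list (inv \<pi>) (l @ r)) = xs"
  proof
    fix xs assume "xs \<in> ?X"
    then have l: "length xs = n" using len by (auto simp: pivot_lists_def)
    have "permute_list (inv \<pi>) (permute_list \<pi> xs) = permute_list (\<pi> \<circ> inv \<pi>) xs"
      using inv l by (simp add: permute_list_compose)
    then show "(case ?f xs of (l, r) \<Rightarrow> permute_list (inv \<pi>) (l @ r)) = xs" by (simp add: comp)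
  qed
  show "\<forall>z\<in>permutations_of_set ?L \<times> {r\<in>permutations_of_set ?R. r ! (inv \<pi> 0 - s) = a}.
      ?f (case z of (l, r) \<Rightarrow> permute_list (inv \<pi>) (l @ r)) = z"
  proof
    fix z assume "z \<in> permutations_of_set ?L \<times> {r\<in>permutations_of_set ?R. r ! (inv \<pi> 0 - s) = a}"
    then obtain l r where z: "z = (l, r)" and "l \<in> permutations_of_set ?L" "r \<in> permutations_of_set ?R" by auto
    then have lr: "length l = s" "length r = card ?R"
      using length_finite_permutations_of_set s by auto
    then have "permute_list \<pi> (permute_list (inv \<pi>) (l @ r)) = permute_list (inv \<pi> \<circ> \<pi>) (l @ r)"
      using \<pi> sn by (simp add: permute_list_compose)
    then show "?f (case z of (l, r) \<Rightarrow> permute_list (inv \<pi>) (l @ r)) = z"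
      by (simp add: comp lr z)
  qed
  show "?f ` ?X \<subseteq> permutations_of_set ?L \<times> {r\<in>permutations_of_set ?R. r ! (inv \<pi> 0 - s) = a}"
  proof (rule image_subsetI)
    fix xs assume "xs \<in> ?X"
    then have xs: "set xs = A" "distinct xs" "hd xs = a" "smalls a xs = S" "length xs = n"
      using len permutations_of_setD by (auto simp: pivot_lists_def)
    define B where "B = permute_list \<pi> xs"
    have B: "length B = n" "distinct B" "set B = A" using xs \<pi> by (auto simp: B_def)
    have nthB: "B ! p = xs ! \<pi> p" if "p < n" for p
      using that \<pi> xs by (simp add: B_def permute_list_nth)
    have "set (take s B) = (\<lambda>p. B ! p) ` {..<s}"
      using s_lt B by (auto simp: set_conv_nth image_iff) (metis nth_take)+
    also have "\<dots> = (\<lambda>p. xs ! p) ` S"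
      unfolding S(1)[symmetric] image_image using nthB s_lt by (intro image_cong) auto
    also have "\<dots> = ?L" unfolding xs(4)[symmetric] xs(1)[symmetric]
      by (auto simp: smalls_def set_conv_nth)
    finally have l: "set (take s B) = ?L" .
    have "set (take s B) \<union> set (drop s B) = A" using B by (metis append_take_drop_id set_append)
    moreover have "set (take s B) \<inter> set (drop s B) = {}" using B by (simp add: set_take_disj_set_drop_if_distinct)
    ultimately have r: "set (drop s B) = ?R" using l LR by blast
    have "drop s B ! (inv \<pi> 0 - s) = a"
    proof -
      have "drop s B ! (inv \<pi> 0 - s) = B ! inv \<pi> 0" using B pi0s pi0 by simp
      also have "\<dots> = xs ! 0" using nthB[OF pi0] permutes_inverses[OF \<pi>] by simp
      also have "\<dots> = a" using xs s_lt by (cases xs) auto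
      finally show ?thesis .
    qed
    then show "?f xs \<in> permutations_of_set ?L \<times> {r\<in>permutations_of_set ?R. r ! (inv \<pi> 0 - s) = a}"
      using l r B by (auto simp: B_def[symmetric] intro!: permutations_of_setI)
  qed
  show "(\<lambda>(l, r). permute_list (inv \<pi>) (l @ r)) ` (permutations_of_set ?L \<times> {r\<in>permutations_of_set ?R. r ! (inv \<pi> 0 - s) = a}) \<subseteq> ?X"
  proof (rule image_subsetI)
    fix z assume "z \<in> permutations_of_set ?L \<times> {r\<in>permutations_of_set ?R. r ! (inv \<pi> 0 - s) = a}"
    then obtain l r where z: "z = (l, r)" and l: "l \<in> permutations_of_set ?L"
      and r: "r \<in> permutations_of_set ?R" and a: "r ! (inv \<pi> 0 - s) = a" by auto
    define ys where "ys = l @ r"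
    have lr: "length l = s" "length r = card ?R"
      using l r length_finite_permutations_of_set s by auto
    have ys: "length ys = n" "distinct ys" "set ys = A"
      using l r lr sn LR permutations_of_setD[OF l] permutations_of_setD[OF r] by (auto simp: ys_def)
    define xs where "xs = permute_list (inv \<pi>) ys"
    have xs: "length xs = n" "distinct xs" "set xs = A" using ys inv by (auto simp: xs_def)
    have nth: "xs ! p = ys ! inv \<pi> p" if "p < n" for p
      using that inv ys by (simp add: xs_def permute_list_nth)
    have "hd xs = xs ! 0" using xs s_lt by (cases xs) auto
    also have "\<dots> = ys ! inv \<pi> 0" using nth s_lt by simp
    also have "\<dots> = a" using a pi0s lr by (simp add: ys_def nth_append)
    finally have hd: "hd xs = a" .
    have "smalls a xs = S"
    proof (rule set_eqI)
      fix p
      show "p \<in> smalls a xs \<longleftrightarrow> p \<in> S"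
      proof (cases "p < n")
        case True
        then have q: "inv \<pi> p < n" using permutes_in_image[OF inv, of p] by simp
        have "ys ! inv \<pi> p < a \<longleftrightarrow> inv \<pi> p < s"
        proof (cases "inv \<pi> p < s")
          case True
          then have "ys ! inv \<pi> p \<in> set l" using lr by (simp add: ys_def nth_append)
          then show ?thesis using True permutations_of_setD[OF l] by auto
        next
          case False
          then have "ys ! inv \<pi> p \<in> set r" using lr q sn by (simp add: ys_def nth_append)
          then show ?thesis using False permutations_of_setD[OF r] by auto
        qed
        then show ?thesis using True nth in_S xs by (simp add: smalls_def)
      next
        case False
        then show ?thesis using S xs by (auto simp: smalls_def)
      qed
    qed
    then show "(case z of (l, r) \<Rightarrow> permute_list (inv \<pi>) (l @ r)) \<in> ?X"
      using xs hd z by (auto simp: pivot_lists_def ys_def[symmetric] xs_def[symmetric])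
  qed
qed

text \<open>An entry at a position i in \<open>S\<close> lands at an index of the left sublist that
  depends on \<open>S\<close> and i only. Prescribing the position of the minimum of
  \<open>A\<close> thus prescribes it in the left sublist, just as the pivot does in the right one:
  the classes \<open>min_at\<close> reproduce themselves.\<close>

lemma ex_sum_pivot_lists:
  assumes A: "finite A" "a \<in> A" and S: "S \<subseteq> {1..<card A}" "S \<noteq> {}" "card S = card {x\<in>A. x < a}"
  shows "\<exists>\<pi> k. k < card A - card S \<and> (\<forall>i\<in>S. \<pi> i < card S) \<and>
    (\<forall>f :: nat list \<Rightarrow> nat list \<Rightarrow> real.
      (\<Sum>xs\<in>pivot_lists A a S. f (take (card S) (fst (hoare_partition xs))) (drop (card S) (fst (hoare_partition xs)))) =
        (\<Sum>l\<in>permutations_of_set {x\<in>A. x < a}. \<Sum>r\<in>min_at {x\<in>A. a \<le> x} k. f l r)) \<and>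
    (\<forall>i\<in>S. \<forall>f :: nat list \<Rightarrow> nat list \<Rightarrow> real.
      (\<Sum>xs\<in>{xs\<in>pivot_lists A a S. xs ! i = Min A}. f (take (card S) (fst (hoare_partition xs))) (drop (card S) (fst (hoare_partition xs)))) =
        (\<Sum>l\<in>min_at {x\<in>A. x < a} (\<pi> i). \<Sum>r\<in>min_at {x\<in>A. a \<le> x} k. f l r))"
proof -
  define n s where "n = card A" and "s = card S"
  obtain \<pi> where \<pi>: "\<pi> permutes {..<n}" "\<pi> ` {..<s} = S"
    and part: "\<And>xs. length xs = n \<Longrightarrow> distinct xs \<Longrightarrow> smalls (hd xs) xs = S \<Longrightarrow>
       hoare_partition xs = (permute_list \<pi> xs, s, card (S \<inter> {s..<n}))"
    using ex_partition_permutation[OF S(1,2)] unfolding n_def s_def by blast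
  define k where "k = inv \<pi> 0 - s"
  have hp: "hoare_partition xs = (permute_list \<pi> xs, s, card (S \<inter> {s..<n}))" if "xs \<in> pivot_lists A a S" for xs
    using that length_finite_permutations_of_set[of xs A] permutations_of_setD[of xs A]
    by (intro part) (auto simp: pivot_lists_def n_def)
  have minR: "Min {x\<in>A. a \<le> x} = a" using A by (intro Min_eqI) auto
  have minL: "Min {x\<in>A. x < a} = Min A"
  proof (intro Min_eqI)
    have "{x\<in>A. x < a} \<noteq> {}" using S A by (metis card.empty card_eq_0_iff finite_subset finite_atLeastLessThan)
    then obtain x where "x \<in> A" "x < a" by auto
    then have "Min A < a" using le_less_trans[OF Min_le] A by blast
    moreover have "Min A \<in> A" using A by (intro Min_in) auto
    ultimately show "Min A \<in> {x\<in>A. x < a}" by simp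
  qed (use A in auto)
  let ?f = "\<lambda>xs. (take s (permute_list \<pi> xs), drop s (permute_list \<pi> xs))"
  let ?R = "min_at {x\<in>A. a \<le> x} k"
  have bij: "bij_betw ?f (pivot_lists A a S) (permutations_of_set {x\<in>A. x < a} \<times> ?R)"
    using bij_betw_partition_sublists[OF A n_def \<pi>] S unfolding n_def s_def min_at_def minR k_def by simp
  have inv: "inv \<pi> permutes {..<n}" by (rule permutes_inv[OF \<pi>(1)])
  have "inv \<pi> 0 < n" using permutes_in_image[OF inv, of 0] S by (cases n) (auto simp: n_def)
  moreover have "s < n"
  proof -
    have "card S \<le> card {1..<n}" using S by (intro card_mono) (auto simp: n_def)
    moreover have "0 < n" using S by (cases n) (auto simp: n_def)
    ultimately show ?thesis by (simp add: s_def)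
  qed
  ultimately have k: "k < n - s" by (simp add: k_def)
  have inS: "inv \<pi> i < s" if "i \<in> S" for i
    using that \<pi>(2) permutes_inverses[OF \<pi>(1)] by (auto simp: image_iff)
  have total: "(\<Sum>xs\<in>pivot_lists A a S. f (take s (fst (hoare_partition xs))) (drop s (fst (hoare_partition xs)))) =
        (\<Sum>l\<in>permutations_of_set {x\<in>A. x < a}. \<Sum>r\<in>?R. f l r)" for f :: "nat list \<Rightarrow> nat list \<Rightarrow> real"
  proof -
    have "(\<Sum>xs\<in>pivot_lists A a S. f (take s (fst (hoare_partition xs))) (drop s (fst (hoare_partition xs)))) =
        (\<Sum>xs\<in>pivot_lists A a S. case ?f xs of (l, r) \<Rightarrow> f l r)"
      by (intro sum.cong) (auto simp: hp)
    also have "\<dots> = (\<Sum>(l, r)\<in>permutations_of_set {x\<in>A. x < a} \<times> ?R. f l r)"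
      by (rule sum.reindex_bij_betw[OF bij])
    finally show ?thesis by (simp add: sum.cartesian_product)
  qed
  have part_min: "(\<Sum>xs\<in>{xs\<in>pivot_lists A a S. xs ! i = Min A}. f (take s (fst (hoare_partition xs))) (drop s (fst (hoare_partition xs)))) =
        (\<Sum>l\<in>min_at {x\<in>A. x < a} (inv \<pi> i). \<Sum>r\<in>?R. f l r)" if i: "i \<in> S" for i and f :: "nat list \<Rightarrow> nat list \<Rightarrow> real"
  proof -
    have "(\<Sum>xs\<in>{xs\<in>pivot_lists A a S. xs ! i = Min A}. f (take s (fst (hoare_partition xs))) (drop s (fst (hoare_partition xs)))) =
      (\<Sum>xs\<in>pivot_lists A a S. if xs ! i = Min A then f (take s (fst (hoare_partition xs))) (drop s (fst (hoare_partition xs))) else 0)"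
      by (rule sum.inter_filter) simp
    also have "\<dots> = (\<Sum>xs\<in>pivot_lists A a S. (\<lambda>l r. if l ! inv \<pi> i = Min A then f l r else 0)
        (take s (fst (hoare_partition xs))) (drop s (fst (hoare_partition xs))))"
    proof (rule sum.cong[OF refl])
      fix xs assume xs: "xs \<in> pivot_lists A a S"
      have len: "length xs = n"
        using xs length_finite_permutations_of_set[of xs A] by (auto simp: pivot_lists_def n_def)
      have "inv \<pi> i < n" using inS[OF i] \<open>s < n\<close> by simp
      then have "take s (permute_list \<pi> xs) ! inv \<pi> i = xs ! i"
        using inS[OF i] \<pi>(1) len permutes_inverses[OF \<pi>(1)] by (simp add: permute_list_nth)
      then show "(if xs ! i = Min A then f (take s (fst (hoare_partition xs))) (drop s (fst (hoare_partition xs))) else 0) =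
        (\<lambda>l r. if l ! inv \<pi> i = Min A then f l r else 0)
        (take s (fst (hoare_partition xs))) (drop s (fst (hoare_partition xs)))"
        by (simp add: hp[OF xs])
    qed
    also have "\<dots> = (\<Sum>l\<in>permutations_of_set {x\<in>A. x < a}. \<Sum>r\<in>?R. if l ! inv \<pi> i = Min A then f l r else 0)"
      by (rule total)
    also have "\<dots> = (\<Sum>l\<in>permutations_of_set {x\<in>A. x < a}. if l ! inv \<pi> i = Min A then \<Sum>r\<in>?R. f l r else 0)"
      by (intro sum.cong) auto
    also have "\<dots> = (\<Sum>l\<in>min_at {x\<in>A. x < a} (inv \<pi> i). \<Sum>r\<in>?R. f l r)"
      unfolding min_at_def minL by (rule sum.inter_filter[symmetric]) simp
    finally show ?thesis .
  qed
  show ?thesis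
    unfolding n_def[symmetric] s_def[symmetric]
  proof (intro exI[of _ "inv \<pi>"] exI[of _ k] conjI ballI allI)
    show "k < n - s" by (rule k)
  next
    fix i assume "i \<in> S"
    then show "inv \<pi> i < s" by (rule inS)
  qed (rule total, rule part_min)
qed

section \<open>Sums over lists, split by the position of the minimum, by the pivot and by the set of
  small positions\<close>

lemma card_min_at:
  assumes "finite A" "i < card A"
  shows "card (min_at A i) = fact (card A - 1)"
proof -
  have ne: "A \<noteq> {}" using assms by auto
  then have m: "Min A \<in> A" using assms by simp
  have A: "A = insert (Min A) (A - {Min A})" using m by auto
  let ?f = "\<lambda>ys. take i ys @ Min A # drop i ys"
  have "bij_betw ?f (permutations_of_set (A - {Min A})) (min_at A i)"
  proof (rule bij_betw_byWitness[where f' = "\<lambda>xs. take i xs @ drop (Suc i) xs"])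
    have len: "length ys = card A - 1" if "ys \<in> permutations_of_set (A - {Min A})" for ys
      using length_finite_permutations_of_set[OF that] m assms by simp
    show "\<forall>ys\<in>permutations_of_set (A - {Min A}). take i (?f ys) @ drop (Suc i) (?f ys) = ys"
      using len assms by auto
    have len': "length xs = card A" if "xs \<in> min_at A i" for xs
      using that length_finite_permutations_of_set[of xs A] by (simp add: min_at_def)
    show "\<forall>xs\<in>min_at A i. ?f (take i xs @ drop (Suc i) xs) = xs"
    proof
      fix xs assume xs: "xs \<in> min_at A i"
      then show "?f (take i xs @ drop (Suc i) xs) = xs"
        using len'[OF xs] assms id_take_nth_drop[of i xs] by (simp add: min_at_def)
    qed
    show "?f ` permutations_of_set (A - {Min A}) \<subseteq> min_at A i"
    proof clarify
      fix ys assume ys: "ys \<in> permutations_of_set (A - {Min A})"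
      have "mset (?f ys) = mset (Min A # ys)"
        by (metis (no_types, lifting) append_take_drop_id mset.simps(2) mset_append union_mset_add_mset_right)
      then have "set (?f ys) = A" "distinct (?f ys)"
        using permutations_of_setD[OF ys] A by (metis list.simps(15) mset_eq_setD, metis DiffD2 distinct.simps(2) insertI1 mset_eq_imp_distinct_iff)
      then show "?f ys \<in> min_at A i" using len[OF ys] assms by (auto simp: min_at_def nth_append)
    qed
    show "(\<lambda>xs. take i xs @ drop (Suc i) xs) ` min_at A i \<subseteq> permutations_of_set (A - {Min A})"
    proof clarify
      fix xs assume xs: "xs \<in> min_at A i"
      have eq: "xs = take i xs @ Min A # drop (Suc i) xs"
        using xs len'[OF xs] assms id_take_nth_drop[of i xs] by (simp add: min_at_def)
      have "set xs = A" "distinct xs" using xs permutations_of_setD by (auto simp: min_at_def)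
      then have "set (take i xs @ Min A # drop (Suc i) xs) = A" "distinct (take i xs @ Min A # drop (Suc i) xs)"
        using eq by simp_all
      then show "take i xs @ drop (Suc i) xs \<in> permutations_of_set (A - {Min A})"
        by (intro permutations_of_setI) auto
    qed
  qed
  then show ?thesis using bij_betw_same_card m assms by fastforce
qed

lemma sum_permutations_of_set_eq_sum_min_at:
  fixes f :: "nat list \<Rightarrow> real"
  assumes "finite A" "A \<noteq> {}"
  shows "(\<Sum>xs\<in>permutations_of_set A. f xs) = (\<Sum>i<card A. \<Sum>xs\<in>min_at A i. f xs)"
proof -
  define pos where "pos xs = (THE i. i < length xs \<and> xs ! i = Min A)" for xs
  have pos: "pos xs = i \<longleftrightarrow> xs ! i = Min A" if xs: "xs \<in> permutations_of_set A" "i < card A" for xs i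
  proof -
    have l: "length xs = card A" "distinct xs" "set xs = A"
      using xs length_finite_permutations_of_set permutations_of_setD by auto
    have "\<exists>!i. i < length xs \<and> xs ! i = Min A"
      using l assms by (intro ex_ex1I) (metis Min_in in_set_conv_nth, metis nth_eq_iff_index_eq)
    from theI'[OF this] have *: "pos xs < length xs" "xs ! pos xs = Min A" by (auto simp: pos_def)
    then show ?thesis using l xs by (metis nth_eq_iff_index_eq)
  qed
  have range: "pos xs < card A" if "xs \<in> permutations_of_set A" for xs
  proof -
    have l: "length xs = card A" "set xs = A"
      using that length_finite_permutations_of_set permutations_of_setD by auto
    then obtain i where "i < card A" "xs ! i = Min A" using assms by (metis Min_in in_set_conv_nth)
    then show ?thesis using pos[OF that] by blast
  qed
  have "(\<Sum>xs\<in>permutations_of_set A. f xs) = (\<Sum>i<card A. \<Sum>xs\<in>{xs\<in>permutations_of_set A. pos xs = i}. f xs)"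
    by (rule sum.group[symmetric]) (use range in auto)
  also have "\<dots> = (\<Sum>i<card A. \<Sum>xs\<in>min_at A i. f xs)"
  proof (intro sum.cong refl)
    fix i assume "i \<in> {..<card A}"
    then show "{xs\<in>permutations_of_set A. pos xs = i} = min_at A i"
      using pos by (auto simp: min_at_def)
  qed
  finally show ?thesis .
qed

definition patterns :: "nat set \<Rightarrow> nat \<Rightarrow> nat set set" where
  "patterns A a = {S. S \<subseteq> {1..<card A} \<and> card S = card {x\<in>A. x < a}}"

lemma finite_patterns [simp]: "finite (patterns A a)"
  by (rule finite_subset[of _ "Pow {1..<card A}"]) (auto simp: patterns_def)

lemma pattern_of_permutation:
  assumes "finite A" "A \<noteq> {}" "xs \<in> permutations_of_set A"
  shows "hd xs \<in> A" "smalls (hd xs) xs \<in> patterns A (hd xs)"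
proof -
  have xs: "length xs = card A" "distinct xs" "set xs = A"
    using assms length_finite_permutations_of_set[of xs A] permutations_of_setD[of xs A] by auto
  then have ne: "xs \<noteq> []" using assms by auto
  then show "hd xs \<in> A" using xs by auto
  have 0: "xs ! 0 = hd xs" using ne by (simp add: hd_conv_nth)
  have "{x\<in>A. x < hd xs} = (\<lambda>p. xs ! p) ` smalls (hd xs) xs"
    unfolding xs(3)[symmetric] by (auto simp: smalls_def set_conv_nth)
  moreover have "inj_on (\<lambda>p. xs ! p) (smalls (hd xs) xs)"
    using xs by (intro inj_onI) (auto simp: smalls_def nth_eq_iff_index_eq)
  ultimately have "card (smalls (hd xs) xs) = card {x\<in>A. x < hd xs}" by (simp add: card_image)
  moreover have "smalls (hd xs) xs \<subseteq> {1..<card A}"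
  proof
    fix p assume "p \<in> smalls (hd xs) xs"
    then show "p \<in> {1..<card A}" using 0 xs by (cases p) (auto simp: smalls_def)
  qed
  ultimately show "smalls (hd xs) xs \<in> patterns A (hd xs)" by (simp add: patterns_def)
qed

lemma sum_permutations_of_set_by_pivot:
  fixes f :: "nat list \<Rightarrow> real"
  assumes "finite A" "A \<noteq> {}"
  shows "(\<Sum>xs\<in>permutations_of_set A. f xs) = (\<Sum>a\<in>A. \<Sum>S\<in>patterns A a. \<Sum>xs\<in>pivot_lists A a S. f xs)"
proof -
  have "(\<Sum>xs\<in>permutations_of_set A. f xs) = (\<Sum>a\<in>A. \<Sum>xs\<in>{xs\<in>permutations_of_set A. hd xs = a}. f xs)"
    by (rule sum.group[symmetric]) (use assms pattern_of_permutation in auto)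
  also have "\<dots> = (\<Sum>a\<in>A. \<Sum>S\<in>patterns A a. \<Sum>xs\<in>{xs\<in>{xs\<in>permutations_of_set A. hd xs = a}. smalls a xs = S}. f xs)"
    by (intro sum.cong refl sum.group[symmetric]) (use assms pattern_of_permutation in auto)
  also have "\<dots> = (\<Sum>a\<in>A. \<Sum>S\<in>patterns A a. \<Sum>xs\<in>pivot_lists A a S. f xs)"
    by (intro sum.cong refl) (auto simp: pivot_lists_def)
  finally show ?thesis .
qed

text \<open>If the minimum is not in front, the pivot is larger than it, so that \<open>i\<close> is
  a small position and no case with empty \<open>S\<close> arises.\<close>

lemma sum_min_at_by_pivot:
  fixes f :: "nat list \<Rightarrow> real"
  assumes A: "finite A" and i: "0 < i" "i < card A"
  shows "(\<Sum>xs\<in>min_at A i. f xs) =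
    (\<Sum>a\<in>A - {Min A}. \<Sum>S\<in>{S\<in>patterns A a. i \<in> S}. \<Sum>xs\<in>{xs\<in>pivot_lists A a S. xs ! i = Min A}. f xs)"
proof -
  have ne: "A \<noteq> {}" using i by auto
  have hd: "hd xs \<in> A - {Min A}" "i \<in> smalls (hd xs) xs" if xs: "xs \<in> min_at A i" for xs
  proof -
    have l: "length xs = card A" "distinct xs" "set xs = A" "xs ! i = Min A" "xs \<in> permutations_of_set A"
      using xs length_finite_permutations_of_set[of xs A] permutations_of_setD[of xs A] by (auto simp: min_at_def)
    have h: "hd xs = xs ! 0" using l i by (cases xs) auto
    have "hd xs \<in> A" using pattern_of_permutation[OF A ne l(5)] by simp
    moreover have "hd xs \<noteq> Min A" using l h i nth_eq_iff_index_eq[of xs 0 i] by auto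
    ultimately show "hd xs \<in> A - {Min A}" by simp
    then have "Min A < hd xs" using Min_le[OF A, of "hd xs"] by auto
    then show "i \<in> smalls (hd xs) xs" using l i by (simp add: smalls_def)
  qed
  have "(\<Sum>xs\<in>min_at A i. f xs) = (\<Sum>a\<in>A - {Min A}. \<Sum>xs\<in>{xs\<in>min_at A i. hd xs = a}. f xs)"
    by (rule sum.group[symmetric]) (use A hd in auto)
  also have "\<dots> = (\<Sum>a\<in>A - {Min A}. \<Sum>S\<in>{S\<in>patterns A a. i \<in> S}. \<Sum>xs\<in>{xs\<in>{xs\<in>min_at A i. hd xs = a}. smalls a xs = S}. f xs)"
  proof (intro sum.cong refl sum.group[symmetric])
    fix a assume "a \<in> A - {Min A}"
    show "smalls a ` {xs\<in>min_at A i. hd xs = a} \<subseteq> {S\<in>patterns A a. i \<in> S}"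
      using pattern_of_permutation[OF A ne] hd by (auto simp: min_at_def)
  qed auto
  also have "\<dots> = (\<Sum>a\<in>A - {Min A}. \<Sum>S\<in>{S\<in>patterns A a. i \<in> S}. \<Sum>xs\<in>{xs\<in>pivot_lists A a S. xs ! i = Min A}. f xs)"
    by (intro sum.cong refl) (auto simp: pivot_lists_def min_at_def)
  finally show ?thesis .
qed

lemma sum_permutations_of_set_hd_Min:
  fixes f :: "nat list \<Rightarrow> real"
  assumes A: "finite A" "A \<noteq> {}"
  shows "(\<Sum>xs\<in>min_at A 0. f xs) = (\<Sum>ys\<in>permutations_of_set (A - {Min A}). f (Min A # ys))"
proof -
  have m: "Min A \<in> A" using A by simp
  have "min_at A 0 = (\<lambda>ys. Min A # ys) ` permutations_of_set (A - {Min A})"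
  proof (intro set_eqI iffI)
    fix xs assume "xs \<in> min_at A 0"
    then have "xs \<in> permutations_of_set A" "xs ! 0 = Min A" by (auto simp: min_at_def)
    then show "xs \<in> (\<lambda>ys. Min A # ys) ` permutations_of_set (A - {Min A})"
      using A permutations_of_setD[of xs A]
      by (cases xs) (auto intro!: image_eqI permutations_of_setI)
  next
    fix xs assume "xs \<in> (\<lambda>ys. Min A # ys) ` permutations_of_set (A - {Min A})"
    then show "xs \<in> min_at A 0"
    proof clarify
      fix ys assume "ys \<in> permutations_of_set (A - {Min A})"
      from permutations_of_setD[OF this] have "set (Min A # ys) = A" "distinct (Min A # ys)"
        using m by (simp_all add: insert_absorb)
      then have "Min A # ys \<in> permutations_of_set A" by (rule permutations_of_setI)
      then show "Min A # ys \<in> min_at A 0" by (simp only: min_at_def mem_Collect_eq nth_Cons_0 simp_thms)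
    qed
  qed
  then show ?thesis by (simp add: sum.reindex inj_on_def)
qed

section \<open>Averages over input lists\<close>

lemma card_pattern:
  assumes "S \<subseteq> {1..<n}"
  shows "card S \<le> n - 1" "finite S"
  using card_mono[OF _ assms] assms by (auto intro: finite_subset)

definition exchanges :: "nat \<Rightarrow> nat set \<Rightarrow> nat" where
  "exchanges n S = card (S \<inter> {card S..<n})"

lemma exchanges_le:
  assumes "S \<subseteq> {1..<n}"
  shows "exchanges n S \<le> card S" "exchanges n S \<le> n - card S"
proof -
  show "exchanges n S \<le> card S"
    unfolding exchanges_def using card_pattern[OF assms] by (intro card_mono) auto
  have "exchanges n S \<le> card {card S..<n}"
    unfolding exchanges_def by (intro card_mono) auto
  then show "exchanges n S \<le> n - card S" by simp
qed

lemma pivot_lists_permutation: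
  assumes "xs \<in> pivot_lists A a S"
  shows "length xs = card A" "distinct xs" "set xs = A" "hd xs = a" "smalls a xs = S"
  using assms length_finite_permutations_of_set[of xs A] permutations_of_setD[of xs A]
  by (auto simp: pivot_lists_def)

lemma quickselect_partition:
  assumes "length xs = n" "distinct xs" "smalls (hd xs) xs = S" "S \<subseteq> {1..<n}" "S \<noteq> {}"
  obtains B where "hoare_partition xs = (B, card S, exchanges n S)" "length B = n" "distinct B"
    and "\<And>r. quickselect_exchanges xs r = exchanges n S +
      (if r \<le> card S then quickselect_exchanges (take (card S) B) r else quickselect_exchanges (drop (card S) B) (r - card S))"
proof -
  obtain \<pi> where \<pi>: "\<pi> permutes {..<n}"
    and part: "hoare_partition xs = (permute_list \<pi> xs, card S, card (S \<inter> {card S..<n}))"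
    using ex_partition_permutation[OF assms(4,5)] assms by blast
  have n: "\<not> n \<le> 1" using assms(4,5) by auto
  show thesis
  proof
    show "hoare_partition xs = (permute_list \<pi> xs, card S, exchanges n S)"
      using part by (simp add: exchanges_def)
    show "length (permute_list \<pi> xs) = n" "distinct (permute_list \<pi> xs)"
      using assms \<pi> by auto
    show "quickselect_exchanges xs r = exchanges n S +
      (if r \<le> card S then quickselect_exchanges (take (card S) (permute_list \<pi> xs)) r
       else quickselect_exchanges (drop (card S) (permute_list \<pi> xs)) (r - card S))" for r
      using n assms(1) part by (subst quickselect_exchanges.simps) (auto simp: exchanges_def)
  qed
qed

lemma quickselect_min_pivot:
  assumes "ys \<noteq> []" "\<forall>y\<in>set ys. a < y"
  shows "quickselect_exchanges (a # ys) r = (if r \<le> 1 then 0 else quickselect_exchanges ys (r - 1))"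
proof -
  have "hoare_partition (a # ys) = (a # ys, 1, 0)"
  proof (rule hoare_partition_min)
    show "2 \<le> length (a # ys)" using assms by (cases ys) auto
    show "\<forall>p. 0 < p \<longrightarrow> p < length (a # ys) \<longrightarrow> hd (a # ys) < (a # ys) ! p"
    proof (intro allI impI)
      fix p assume "0 < p" "p < length (a # ys)"
      then show "hd (a # ys) < (a # ys) ! p" using assms by (cases p) auto
    qed
  qed
  then show ?thesis using assms
    by (subst quickselect_exchanges.simps) (simp add: quickselect_exchanges.simps[of "[a]"] not_le[symmetric])
qed

text \<open>A partition makes at most min (s, n - s) exchanges, where s is the left size. This is no
  more than the size of the discarded sublist, so the induction closes.\<close>

lemma quickselect_exchanges_le_length:
  "distinct (xs :: nat list) \<Longrightarrow> quickselect_exchanges xs r \<le> length xs"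
proof (induction "length xs" arbitrary: xs r rule: less_induct)
  case less
  show ?case
  proof (cases "length xs \<le> 1")
    case True
    then show ?thesis by (simp add: quickselect_exchanges.simps)
  next
    case False
    define S where "S = smalls (hd xs) xs"
    have S: "S \<subseteq> {1..<length xs}"
    proof -
      have "xs \<in> permutations_of_set (set xs)" using less.prems by (intro permutations_of_setI) auto
      moreover have "set xs \<noteq> {}" using False by (cases xs) auto
      ultimately have "S \<in> patterns (set xs) (hd xs)"
        unfolding S_def by (intro pattern_of_permutation) auto
      then show ?thesis using distinct_card[OF less.prems] by (simp add: patterns_def)
    qed
    show ?thesis
    proof (cases "S = {}")
      case True
      obtain a ys where xs: "xs = a # ys" "ys \<noteq> []" using False by (cases xs) auto
      have "a < y" if "y \<in> set ys" for y
      proof -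
        obtain p where "p < length ys" "ys ! p = y" using \<open>y \<in> set ys\<close> by (auto simp: in_set_conv_nth)
        then have "\<not> y < a" using True xs by (auto simp: S_def smalls_def dest: spec[of _ "Suc p"])
        moreover have "y \<noteq> a" using less.prems xs that by auto
        ultimately show ?thesis by simp
      qed
      then show ?thesis
        using quickselect_min_pivot[of ys a r] less.hyps[of ys "r - 1"] less.prems xs by auto
    next
      case False
      show ?thesis
      proof (rule quickselect_partition[OF refl less.prems S_def[symmetric] S False])
        fix B :: "nat list" assume B: "length B = length xs" "distinct B"
          and q: "\<And>r. quickselect_exchanges xs r = exchanges (length xs) S +
          (if r \<le> card S then quickselect_exchanges (take (card S) B) r else quickselect_exchanges (drop (card S) B) (r - card S))"
      have s: "card S < length xs" "0 < card S"
        using card_pattern[OF S] False S by (fastforce simp: card_gt_0_iff)+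
      have "quickselect_exchanges (take (card S) B) r \<le> card S"
        using less.hyps[of "take (card S) B" r] B s by auto
      moreover have "quickselect_exchanges (drop (card S) B) (r - card S) \<le> length xs - card S"
        using less.hyps[of "drop (card S) B" "r - card S"] B s by auto
      ultimately show ?thesis using q[of r] exchanges_le[OF S] s by auto
      qed
    qed
  qed
qed

text \<open>Ranks are counted instead of averaged, so that the counts of the two sublists simply
  add. With \<open>b = 1\<close> the rank of the minimum is left out; a list with known place of its
  minimum then obeys the same bounds as a random list with one element fewer.\<close>

definition cheap_ranks :: "nat \<Rightarrow> nat list \<Rightarrow> real \<Rightarrow> real" where
  "cheap_ranks b xs y = (\<Sum>r\<in>{Suc b..length xs}. of_bool (real (quickselect_exchanges xs r) \<le> y))"

lemma cheap_ranks_nonneg: "0 \<le> cheap_ranks b xs y"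
  by (simp add: cheap_ranks_def sum_nonneg)

lemma cheap_ranks_le: "cheap_ranks b xs y \<le> length xs - b"
proof -
  have "cheap_ranks b xs y \<le> (\<Sum>r\<in>{Suc b..length xs}. 1)"
    unfolding cheap_ranks_def by (intro sum_mono) auto
  then show ?thesis by simp
qed

lemma cheap_ranks_neg: "y < 0 \<Longrightarrow> cheap_ranks b xs y = 0"
  unfolding cheap_ranks_def by (intro sum.neutral) auto

lemma cheap_ranks_full:
  fixes y :: real
  assumes "distinct xs" "length xs \<le> y"
  shows "cheap_ranks b xs y = length xs - b"
proof -
  have "real (quickselect_exchanges xs r) \<le> y" for r
    using quickselect_exchanges_le_length[OF assms(1), of r] assms(2) by linarith
  then have "cheap_ranks b xs y = (\<Sum>r\<in>{Suc b..length xs}. 1)"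
    unfolding cheap_ranks_def by (intro sum.cong) auto
  then show ?thesis by simp
qed

lemma cheap_ranks_0_split:
  assumes "xs \<noteq> []"
  shows "cheap_ranks 0 xs y = of_bool (real (quickselect_exchanges xs 1) \<le> y) + cheap_ranks 1 xs y"
  unfolding cheap_ranks_def using assms
  by (subst sum.atLeast_Suc_atMost) (auto simp: Suc_le_eq)

lemma cheap_ranks_0_le: "cheap_ranks 0 xs y \<le> 1 + cheap_ranks 1 xs y"
proof (cases "xs = []")
  case False
  then show ?thesis by (simp add: cheap_ranks_0_split)
qed (simp add: cheap_ranks_def)

lemma cheap_ranks_min_pivot:
  assumes "ys \<noteq> []" "\<forall>y\<in>set ys. a < y"
  shows "cheap_ranks 1 (a # ys) y = cheap_ranks 0 ys y"
    and "cheap_ranks 0 (a # ys) y = of_bool (0 \<le> y) + cheap_ranks 0 ys y"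
proof -
  have "cheap_ranks 1 (a # ys) y = (\<Sum>r\<in>{Suc (Suc 0)..Suc (length ys)}. of_bool (real (quickselect_exchanges (a # ys) r) \<le> y))"
    by (simp only: cheap_ranks_def One_nat_def list.size add_Suc_right add_0_right)
  also have "\<dots> = (\<Sum>r\<in>{Suc 0..length ys}. of_bool (real (quickselect_exchanges (a # ys) (Suc r)) \<le> y))"
    by (rule sum.shift_bounds_cl_Suc_ivl)
  also have "\<dots> = cheap_ranks 0 ys y"
    unfolding cheap_ranks_def by (intro sum.cong) (auto simp: quickselect_min_pivot[OF assms])
  finally show eq: "cheap_ranks 1 (a # ys) y = cheap_ranks 0 ys y" .
  have "cheap_ranks 0 (a # ys) y = of_bool (0 \<le> y) + cheap_ranks 1 (a # ys) y"
    by (simp add: cheap_ranks_0_split quickselect_min_pivot[OF assms])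
  then show "cheap_ranks 0 (a # ys) y = of_bool (0 \<le> y) + cheap_ranks 0 ys y" using eq by simp
qed

lemma cheap_ranks_partition:
  assumes xs: "xs \<in> pivot_lists A a S" and S: "S \<subseteq> {1..<card A}" "S \<noteq> {}" and b: "b \<le> card S"
  shows "cheap_ranks b xs y =
    cheap_ranks b (take (card S) (fst (hoare_partition xs))) (y - exchanges (card A) S) +
    cheap_ranks 0 (drop (card S) (fst (hoare_partition xs))) (y - exchanges (card A) S)"
proof -
  define n s T where "n = card A" and "s = card S" and "T = exchanges (card A) S"
  obtain B where B: "hoare_partition xs = (B, s, T)" "length B = n"
    and q: "\<And>r. quickselect_exchanges xs r = T +
      (if r \<le> s then quickselect_exchanges (take s B) r else quickselect_exchanges (drop s B) (r - s))"
    using quickselect_partition[of xs "card A" S] pivot_lists_permutation[OF xs] S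
    unfolding n_def s_def T_def by metis
  have s: "s \<le> n" using card_pattern[OF S(1)] by (simp add: n_def s_def)
  have len: "length xs = n" using pivot_lists_permutation[OF xs] by (simp add: n_def)
  have "{Suc b..n} = {Suc b..s} \<union> {Suc s..n}" using s b by (auto simp: s_def)
  then have "cheap_ranks b xs y = (\<Sum>r\<in>{Suc b..s}. of_bool (real (quickselect_exchanges xs r) \<le> y)) +
      (\<Sum>r\<in>{Suc s..n}. of_bool (real (quickselect_exchanges xs r) \<le> y))"
    unfolding cheap_ranks_def len by (subst sum.union_disjoint[symmetric]) auto
  also have "(\<Sum>r\<in>{Suc b..s}. of_bool (real (quickselect_exchanges xs r) \<le> y)) = cheap_ranks b (take s B) (y - T)"
    unfolding cheap_ranks_def using s B by (intro sum.cong) (auto simp: q)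
  also have "(\<Sum>r\<in>{Suc s..n}. of_bool (real (quickselect_exchanges xs r) \<le> y)) = cheap_ranks 0 (drop s B) (y - T)"
  proof -
    have "(\<Sum>r\<in>{Suc s..n}. of_bool (real (quickselect_exchanges xs r) \<le> y)) =
        (\<Sum>r\<in>{Suc 0 + s..(n - s) + s}. of_bool (real (quickselect_exchanges xs r) \<le> y))"
      using s by simp
    also have "\<dots> = (\<Sum>r\<in>{Suc 0..n - s}. of_bool (real (quickselect_exchanges xs (r + s)) \<le> y))"
      by (rule sum.shift_bounds_cl_nat_ivl)
    also have "\<dots> = cheap_ranks 0 (drop s B) (y - T)"
      unfolding cheap_ranks_def using B by (intro sum.cong) (auto simp: q)
    finally show ?thesis .
  qed
  finally show ?thesis using B by (simp add: s_def T_def)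
qed

section \<open>Mean numbers of cheap ranks and their recursions\<close>

definition mean_all :: "nat set \<Rightarrow> real \<Rightarrow> real" where
  "mean_all A y = (\<Sum>xs\<in>permutations_of_set A. cheap_ranks 0 xs y) / fact (card A)"

text \<open>The divisor is the number of lists in \<open>min_at A i\<close>. There is no division by
  the number of ranks, so that a sublist enters the recursions with its size as weight.\<close>

definition mean_at :: "nat \<Rightarrow> nat set \<Rightarrow> nat \<Rightarrow> real \<Rightarrow> real" where
  "mean_at b A i y = (\<Sum>xs\<in>min_at A i. cheap_ranks b xs y) / fact (card A - 1)"

lemma mean_at_0_le:
  assumes "finite A" "i < card A"
  shows "mean_at 0 A i y \<le> 1 + mean_at 1 A i y"
proof -
  have "(\<Sum>xs\<in>min_at A i. cheap_ranks 0 xs y) \<le> (\<Sum>xs\<in>min_at A i. 1 + cheap_ranks 1 xs y)"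
    by (intro sum_mono cheap_ranks_0_le)
  then show ?thesis
    unfolding mean_at_def using card_min_at[OF assms] by (simp add: sum.distrib field_simps)
qed

text \<open>The sum over lists becomes a double sum over left and right sublists, and the count is a
  sum of one term for each side; the factorials are the numbers of lists on the sides. The indices
  \<open>j\<close> and \<open>k\<close> are chosen before \<open>y\<close>, as they depend only on
  the positions.\<close>

lemma sum_cheap_ranks_pivot_lists:
  assumes A: "finite A" "a \<in> A" and S: "S \<in> patterns A a" "S \<noteq> {}"
  shows "\<exists>k<card A - card S. \<forall>y. (\<Sum>xs\<in>pivot_lists A a S. cheap_ranks 0 xs y) =
    fact (card S) * fact (card A - card S - 1) *
      (mean_all {x\<in>A. x < a} (y - exchanges (card A) S) + mean_at 0 {x\<in>A. a \<le> x} k (y - exchanges (card A) S))"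
    and "\<forall>i\<in>S. \<exists>j<card S. \<exists>k<card A - card S. \<forall>b y. b \<le> 1 \<longrightarrow>
    (\<Sum>xs\<in>{xs\<in>pivot_lists A a S. xs ! i = Min A}. cheap_ranks b xs y) =
    fact (card S - 1) * fact (card A - card S - 1) *
      (mean_at b {x\<in>A. x < a} j (y - exchanges (card A) S) + mean_at 0 {x\<in>A. a \<le> x} k (y - exchanges (card A) S))"
proof -
  define n s where "n = card A" and "s = card S"
  define T where "T = real (exchanges n S)"
  define L R where "L = {x\<in>A. x < a}" and "R = {x\<in>A. a \<le> x}"
  have S': "S \<subseteq> {1..<card A}" "card S = card {x\<in>A. x < a}" using S by (auto simp: patterns_def)
  have fin: "finite L" "finite R" using A by (auto simp: L_def R_def)
  have cL: "card L = s" using S' by (simp add: L_def s_def)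
  have "A = L \<union> R" "L \<inter> R = {}" by (auto simp: L_def R_def)
  then have cR: "card R = n - s" using card_Un_disjoint[OF fin] cL by (simp add: n_def)
  have s: "0 < s" using S card_pattern[OF S'(1)] by (simp add: s_def card_gt_0_iff)
  obtain \<pi> :: "nat \<Rightarrow> nat" and k where k: "k < n - s" and \<pi>': "\<forall>i\<in>S. \<pi> i < s"
    and tot': "\<forall>f :: nat list \<Rightarrow> nat list \<Rightarrow> real. (\<Sum>xs\<in>pivot_lists A a S. f (take s (fst (hoare_partition xs))) (drop s (fst (hoare_partition xs)))) =
        (\<Sum>l\<in>permutations_of_set L. \<Sum>r\<in>min_at R k. f l r)"
    and par': "\<forall>i\<in>S. \<forall>f :: nat list \<Rightarrow> nat list \<Rightarrow> real.
      (\<Sum>xs\<in>{xs\<in>pivot_lists A a S. xs ! i = Min A}. f (take s (fst (hoare_partition xs))) (drop s (fst (hoare_partition xs)))) =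
        (\<Sum>l\<in>min_at L (\<pi> i). \<Sum>r\<in>min_at R k. f l r)"
    using ex_sum_pivot_lists[OF A S'(1) S(2) S'(2)] unfolding n_def[symmetric] s_def[symmetric] L_def[symmetric] R_def[symmetric]
    by (elim exE conjE) (rule that)
  note \<pi> = \<pi>'[rule_format] and tot = tot'[rule_format] and par = par'[rule_format]
  have split: "cheap_ranks b xs y = cheap_ranks b (take s (fst (hoare_partition xs))) (y - T) +
      cheap_ranks 0 (drop s (fst (hoare_partition xs))) (y - T)"
    if "xs \<in> pivot_lists A a S" "b \<le> 1" for xs b y
    using cheap_ranks_partition[OF that(1) S'(1) S(2), of b y] that s by (simp add: s_def T_def n_def)
  have cmR: "real (card (min_at R k)) = fact (n - s - 1)"
    using card_min_at[OF fin(2), of k] k cR by simp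
  have prod: "(\<Sum>l\<in>X. \<Sum>r\<in>min_at R k. g l + h r) = fact (n - s - 1) * sum g X + real (card X) * sum h (min_at R k)"
    for X :: "nat list set" and g h :: "nat list \<Rightarrow> real"
    by (simp add: sum.distrib cmR sum_distrib_left)
  have "(\<Sum>xs\<in>pivot_lists A a S. cheap_ranks 0 xs y) =
    fact s * fact (n - s - 1) * (mean_all L (y - T) + mean_at 0 R k (y - T))" for y
  proof -
    have "(\<Sum>xs\<in>pivot_lists A a S. cheap_ranks 0 xs y) =
      (\<Sum>xs\<in>pivot_lists A a S. (\<lambda>l r. cheap_ranks 0 l (y - T) + cheap_ranks 0 r (y - T))
        (take s (fst (hoare_partition xs))) (drop s (fst (hoare_partition xs))))"
      by (intro sum.cong refl) (simp add: split)
    also have "\<dots> = fact (n - s - 1) * (\<Sum>l\<in>permutations_of_set L. cheap_ranks 0 l (y - T)) +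
        fact s * (\<Sum>r\<in>min_at R k. cheap_ranks 0 r (y - T))"
      unfolding tot[of "\<lambda>l r. cheap_ranks 0 l (y - T) + cheap_ranks 0 r (y - T)"] prod using fin cL by simp
    finally show ?thesis
      by (simp add: mean_all_def mean_at_def cL cR field_simps)
  qed
  then show "\<exists>k<card A - card S. \<forall>y. (\<Sum>xs\<in>pivot_lists A a S. cheap_ranks 0 xs y) =
    fact (card S) * fact (card A - card S - 1) *
      (mean_all {x\<in>A. x < a} (y - exchanges (card A) S) + mean_at 0 {x\<in>A. a \<le> x} k (y - exchanges (card A) S))"
    using k unfolding n_def s_def L_def R_def T_def by blast
  have "(\<Sum>xs\<in>{xs\<in>pivot_lists A a S. xs ! i = Min A}. cheap_ranks b xs y) =
    fact (s - 1) * fact (n - s - 1) * (mean_at b L (\<pi> i) (y - T) + mean_at 0 R k (y - T))"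
    if i: "i \<in> S" and b: "b \<le> 1" for i b y
  proof -
    have "(\<Sum>xs\<in>{xs\<in>pivot_lists A a S. xs ! i = Min A}. cheap_ranks b xs y) =
      (\<Sum>xs\<in>{xs\<in>pivot_lists A a S. xs ! i = Min A}. (\<lambda>l r. cheap_ranks b l (y - T) + cheap_ranks 0 r (y - T))
        (take s (fst (hoare_partition xs))) (drop s (fst (hoare_partition xs))))"
      by (intro sum.cong refl) (use split b in auto)
    also have "\<dots> = fact (n - s - 1) * (\<Sum>l\<in>min_at L (\<pi> i). cheap_ranks b l (y - T)) +
        fact (s - 1) * (\<Sum>r\<in>min_at R k. cheap_ranks 0 r (y - T))"
      unfolding par[OF i, of "\<lambda>l r. cheap_ranks b l (y - T) + cheap_ranks 0 r (y - T)"] prod using card_min_at[OF fin(1), of "\<pi> i"] \<pi>[OF i] cL by simp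
    finally show ?thesis
      by (simp add: mean_at_def cL cR field_simps)
  qed
  then show "\<forall>i\<in>S. \<exists>j<card S. \<exists>k<card A - card S. \<forall>b y. b \<le> 1 \<longrightarrow>
    (\<Sum>xs\<in>{xs\<in>pivot_lists A a S. xs ! i = Min A}. cheap_ranks b xs y) =
    fact (card S - 1) * fact (card A - card S - 1) *
      (mean_at b {x\<in>A. x < a} j (y - exchanges (card A) S) + mean_at 0 {x\<in>A. a \<le> x} k (y - exchanges (card A) S))"
    using k \<pi> unfolding n_def s_def L_def R_def T_def by blast
qed

text \<open>A minimal pivot is split off without any exchange, and what remains is a uniformly
  random list. Its own rank costs 0, hence the term \<open>of_bool (0 \<le> y)\<close>.\<close>

lemma mean_at_Min_first:
  assumes "finite A" "2 \<le> card A"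
  shows "mean_at 1 A 0 y = mean_all (A - {Min A}) y"
    and "mean_at 0 A 0 y = of_bool (0 \<le> y) + mean_all (A - {Min A}) y"
proof -
  have ne: "A \<noteq> {}" and m: "Min A \<in> A" using assms by (auto intro!: Min_in)
  have c: "card (A - {Min A}) = card A - 1" using m assms by simp
  have ys: "ys \<noteq> []" "\<forall>y\<in>set ys. Min A < y" if "ys \<in> permutations_of_set (A - {Min A})" for ys
  proof -
    have "length ys = card A - 1" using length_finite_permutations_of_set[OF that] c by simp
    then show "ys \<noteq> []" using assms by auto
    show "\<forall>y\<in>set ys. Min A < y"
    proof
      fix y assume "y \<in> set ys"
      then have "y \<in> A" "y \<noteq> Min A" using permutations_of_setD(1)[OF that] by blast+
      then show "Min A < y" using Min_le[OF assms(1)] by (metis le_neq_implies_less)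
    qed
  qed
  have cr: "cheap_ranks 1 (Min A # ys) y = cheap_ranks 0 ys y"
      "cheap_ranks 0 (Min A # ys) y = of_bool (0 \<le> y) + cheap_ranks 0 ys y"
    if "ys \<in> permutations_of_set (A - {Min A})" for ys
    using cheap_ranks_min_pivot[OF ys[OF that]] by auto
  show "mean_at 1 A 0 y = mean_all (A - {Min A}) y"
    unfolding mean_at_def mean_all_def sum_permutations_of_set_hd_Min[OF assms(1) ne] c
    by (simp only: cr cong: sum.cong)
  have "(\<Sum>ys\<in>permutations_of_set (A - {Min A}). cheap_ranks 0 (Min A # ys) y) =
      fact (card A - 1) * of_bool (0 \<le> y) + (\<Sum>ys\<in>permutations_of_set (A - {Min A}). cheap_ranks 0 ys y)"
  proof -
    have "(\<Sum>ys\<in>permutations_of_set (A - {Min A}). cheap_ranks 0 (Min A # ys) y) =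
        (\<Sum>ys\<in>permutations_of_set (A - {Min A}). of_bool (0 \<le> y) + cheap_ranks 0 ys y)"
      by (simp only: cr cong: sum.cong)
    then show ?thesis using assms c by (simp add: sum.distrib)
  qed
  then show "mean_at 0 A 0 y = of_bool (0 \<le> y) + mean_all (A - {Min A}) y"
    unfolding mean_at_def mean_all_def sum_permutations_of_set_hd_Min[OF assms(1) ne] c
    by (simp add: add_divide_distrib)
qed

lemma mean_all_eq_mean_at:
  assumes "finite A" "A \<noteq> {}"
  shows "mean_all A y = (\<Sum>i<card A. mean_at 0 A i y) / card A"
proof -
  obtain n where n: "card A = Suc n" using assms by (metis card_0_eq not0_implies_Suc)
  show ?thesis
    unfolding mean_all_def mean_at_def sum_permutations_of_set_eq_sum_min_at[OF assms] n
    by (simp add: sum_divide_distrib[symmetric] field_simps)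
qed

lemma sum_over_rank_of_pivot:
  fixes g :: "nat \<Rightarrow> real" and A :: "nat set"
  assumes "finite A"
  shows "(\<Sum>a\<in>A. g (card {x\<in>A. x < a})) = (\<Sum>s<card A. g s)"
proof (rule sum.reindex_bij_betw)
  have inj: "inj_on (\<lambda>a. card {x\<in>A. x < a}) A"
  proof -
    have "card {x\<in>A. x < a} < card {x\<in>A. x < b}" if "a < b" "a \<in> A" for a b
    proof (rule psubset_card_mono)
      show "finite {x\<in>A. x < b}" using assms by simp
      have "a \<in> {x\<in>A. x < b}" "a \<notin> {x\<in>A. x < a}" using that by auto
      moreover have "{x\<in>A. x < a} \<subseteq> {x\<in>A. x < b}" using that by auto
      ultimately show "{x\<in>A. x < a} \<subset> {x\<in>A. x < b}" by blast
    qed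
    note less = this
    show ?thesis
    proof (rule inj_onI)
      fix a b assume "a \<in> A" "b \<in> A" "card {x\<in>A. x < a} = card {x\<in>A. x < b}"
      then show "a = b" using less[of a b] less[of b a] by (cases a b rule: linorder_cases) simp_all
    qed
  qed
  have "(\<lambda>a. card {x\<in>A. x < a}) ` A \<subseteq> {..<card A}"
  proof (rule image_subsetI)
    fix a assume "a \<in> A"
    then have "{x\<in>A. x < a} \<subset> A" by blast
    then show "card {x\<in>A. x < a} \<in> {..<card A}" using psubset_card_mono[OF assms] by simp
  qed
  then have "(\<lambda>a. card {x\<in>A. x < a}) ` A = {..<card A}"
    using card_image[OF inj] by (intro card_subset_eq) auto
  then show "bij_betw (\<lambda>a. card {x\<in>A. x < a}) A {..<card A}"
    using inj by (simp add: bij_betw_def)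
qed

definition avg_all :: "nat \<Rightarrow> nat \<Rightarrow> (nat set \<Rightarrow> real) \<Rightarrow> real" where
  "avg_all n s H = (\<Sum>S | S \<subseteq> {1..<n} \<and> card S = s. H S) / (n - 1 choose s)"

definition avg_in :: "nat \<Rightarrow> nat \<Rightarrow> nat \<Rightarrow> (nat set \<Rightarrow> real) \<Rightarrow> real" where
  "avg_in n s i H = (\<Sum>S | S \<subseteq> {1..<n} \<and> card S = s \<and> i \<in> S. H S) / (n - 2 choose (s - 1))"

lemma mean_all_bounds:
  assumes "finite A"
  shows "0 \<le> mean_all A y" "mean_all A y \<le> card A" "y < 0 \<Longrightarrow> mean_all A y = 0"
proof -
  show "0 \<le> mean_all A y" by (simp add: mean_all_def sum_nonneg cheap_ranks_nonneg)
  have "(\<Sum>xs\<in>permutations_of_set A. cheap_ranks 0 xs y) \<le> (\<Sum>xs\<in>permutations_of_set A. real (card A))"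
  proof (intro sum_mono)
    fix xs assume "xs \<in> permutations_of_set A"
    then show "cheap_ranks 0 xs y \<le> real (card A)"
      using cheap_ranks_le[of 0 xs y] length_finite_permutations_of_set by fastforce
  qed
  then show "mean_all A y \<le> card A" using assms by (simp add: mean_all_def field_simps)
  show "mean_all A y = 0" if "y < 0" using that by (simp add: mean_all_def cheap_ranks_neg)
qed

lemma min_at_permutation:
  assumes "xs \<in> min_at A i"
  shows "length xs = card A" "distinct xs"
  using assms length_finite_permutations_of_set[of xs A] permutations_of_setD[of xs A]
  by (auto simp: min_at_def)

lemma mean_at_bounds:
  fixes y :: real
  assumes "finite A" "i < card A"
  shows "0 \<le> mean_at b A i y" "y < 0 \<Longrightarrow> mean_at b A i y = 0"
    and "card A \<le> y \<Longrightarrow> mean_at b A i y = real (card A - b)"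
    and "mean_at b A i y \<le> real (card A - b)"
proof -
  show "0 \<le> mean_at b A i y" by (simp add: mean_at_def sum_nonneg cheap_ranks_nonneg)
  show "mean_at b A i y = 0" if "y < 0" using that by (simp add: mean_at_def cheap_ranks_neg)
  show "mean_at b A i y = real (card A - b)" if "card A \<le> y"
  proof -
    have "(\<Sum>xs\<in>min_at A i. cheap_ranks b xs y) = (\<Sum>xs\<in>min_at A i. real (card A - b))"
      using that by (intro sum.cong) (auto simp: cheap_ranks_full min_at_permutation)
    then show ?thesis using card_min_at[OF assms] by (simp add: mean_at_def)
  qed
  have "(\<Sum>xs\<in>min_at A i. cheap_ranks b xs y) \<le> (\<Sum>xs\<in>min_at A i. real (card A - b))"
    using cheap_ranks_le min_at_permutation by (intro sum_mono) metis
  then show "mean_at b A i y \<le> real (card A - b)"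
    using card_min_at[OF assms] by (simp add: mean_at_def field_simps)
qed

text \<open>The weight is the number of lists with small positions \<open>S\<close>. Thus the rank
  of the pivot is uniform and, given this rank, all sets of small positions are equally
  likely.\<close>

lemma sum_patterns_all:
  assumes A: "finite A" "n = card A" "1 \<le> n"
  shows "(\<Sum>a\<in>A. \<Sum>S\<in>patterns A a. fact (card S) * fact (n - card S - 1) * H S) =
    fact (n - 1) * (\<Sum>s<n. avg_all n s H)"
proof -
  have "(\<Sum>a\<in>A. \<Sum>S\<in>patterns A a. fact (card S) * fact (n - card S - 1) * H S) =
    (\<Sum>a\<in>A. (\<lambda>s. \<Sum>S | S \<subseteq> {1..<n} \<and> card S = s. fact s * fact (n - s - 1) * H S) (card {x\<in>A. x < a}))"
    unfolding patterns_def A(2) by (intro sum.cong refl) auto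
  also have "\<dots> = (\<Sum>s<n. \<Sum>S | S \<subseteq> {1..<n} \<and> card S = s. fact s * fact (n - s - 1) * H S)"
    unfolding A(2) by (rule sum_over_rank_of_pivot[OF A(1)])
  also have "\<dots> = (\<Sum>s<n. fact (n - 1) * avg_all n s H)"
  proof (intro sum.cong refl)
    fix s assume "s \<in> {..<n}"
    then have "fact s * fact (n - 1 - s) * real (n - 1 choose s) = fact (n - 1)"
      by (metis binomial_fact_lemma less_Suc_eq_le lessThan_iff Suc_pred' of_nat_fact of_nat_mult gr_implies_not0 not_gr0)
    moreover have "real (n - 1 choose s) \<noteq> 0" using \<open>s \<in> {..<n}\<close> by auto
    ultimately have eq: "fact s * fact (n - s - 1) = fact (n - 1) / real (n - 1 choose s)"
      by (simp add: field_simps)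
    show "(\<Sum>S | S \<subseteq> {1..<n} \<and> card S = s. fact s * fact (n - s - 1) * H S) = fact (n - 1) * avg_all n s H"
      unfolding eq avg_all_def sum_distrib_left[symmetric] by simp
  qed
  finally show ?thesis by (simp add: sum_distrib_left)
qed

lemma sum_patterns_in:
  assumes A: "finite A" "n = card A" and i: "0 < i" "i < n"
  shows "(\<Sum>a\<in>A - {Min A}. \<Sum>S\<in>{S\<in>patterns A a. i \<in> S}. fact (card S - 1) * fact (n - card S - 1) * H S) =
    fact (n - 2) * (\<Sum>s\<in>{1..<n}. avg_in n s i H)"
proof -
  define g where "g s = (\<Sum>S | S \<subseteq> {1..<n} \<and> card S = s \<and> i \<in> S. fact (s - 1) * fact (n - s - 1) * H S)" for s
  have ne: "A \<noteq> {}" "Min A \<in> A" using A i by (auto intro!: Min_in)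
  have "(\<Sum>a\<in>A - {Min A}. \<Sum>S\<in>{S\<in>patterns A a. i \<in> S}. fact (card S - 1) * fact (n - card S - 1) * H S) =
    (\<Sum>a\<in>A - {Min A}. g (card {x\<in>A. x < a}))"
    unfolding patterns_def A(2) g_def by (intro sum.cong refl) auto
  also have "\<dots> = (\<Sum>a\<in>A. g (card {x\<in>A. x < a})) - g (card {x\<in>A. x < Min A})"
    using A ne by (simp add: sum_diff1)
  also have "(\<Sum>a\<in>A. g (card {x\<in>A. x < a})) = (\<Sum>s<n. g s)"
    unfolding A(2) by (rule sum_over_rank_of_pivot[OF A(1)])
  also have "{x\<in>A. x < Min A} = {}" using A Min_le by (auto simp: not_less[symmetric])
  also have "(\<Sum>s<n. g s) - g (card ({} :: nat set)) = (\<Sum>s\<in>{1..<n}. g s)"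
    using i by (simp add: lessThan_atLeast0 sum.atLeast_Suc_lessThan)
  also have "\<dots> = (\<Sum>s\<in>{1..<n}. fact (n - 2) * avg_in n s i H)"
  proof (intro sum.cong refl)
    fix s assume s: "s \<in> {1..<n}"
    then have le: "s - 1 \<le> n - 2" and eq: "n - 2 - (s - 1) = n - s - 1" by auto
    have "fact (s - 1) * fact (n - s - 1) * real (n - 2 choose (s - 1)) = fact (n - 2)"
      using binomial_fact_lemma[OF le] unfolding eq by (metis of_nat_fact of_nat_mult)
    moreover have "real (n - 2 choose (s - 1)) \<noteq> 0" using le by simp
    ultimately have eq: "fact (s - 1) * fact (n - s - 1) = fact (n - 2) / real (n - 2 choose (s - 1))"
      by (simp add: field_simps)
    show "g s = fact (n - 2) * avg_in n s i H"
      unfolding g_def eq avg_in_def sum_distrib_left[symmetric] by simp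
  qed
  finally show ?thesis by (simp add: sum_distrib_left)
qed

lemma pivot_lists_Min:
  assumes "finite A" "A \<noteq> {}"
  shows "pivot_lists A (Min A) {} = min_at A 0"
proof (intro set_eqI iffI)
  fix xs assume xs: "xs \<in> pivot_lists A (Min A) {}"
  then have "xs \<noteq> []" using pivot_lists_permutation[OF xs] assms by auto
  then show "xs \<in> min_at A 0" using xs by (auto simp: pivot_lists_def min_at_def hd_conv_nth)
next
  fix xs assume xs: "xs \<in> min_at A 0"
  then have *: "xs \<in> permutations_of_set A" "xs ! 0 = Min A" by (auto simp: min_at_def)
  then have "set xs = A" "length xs = card A" by (auto dest: permutations_of_setD length_finite_permutations_of_set)
  then have "xs \<noteq> []" using assms by auto
  moreover have "\<not> xs ! p < Min A" if "p < length xs" for p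
    using Min_le[OF assms(1), of "xs ! p"] that \<open>set xs = A\<close> by (metis leD nth_mem)
  then have "smalls (Min A) xs = {}" unfolding smalls_def by blast
  ultimately show "xs \<in> pivot_lists A (Min A) {}" using * by (simp add: pivot_lists_def hd_conv_nth)
qed

lemma card_split_at_pivot:
  assumes "finite A" "S \<in> patterns A a"
  shows "card {x\<in>A. x < a} = card S" "card {x\<in>A. a \<le> x} = card A - card S"
proof -
  show *: "card {x\<in>A. x < a} = card S" using assms by (simp add: patterns_def)
  have "card A = card ({x\<in>A. x < a} \<union> {x\<in>A. a \<le> x})" by (rule arg_cong[where f = card]) auto
  also have "\<dots> = card {x\<in>A. x < a} + card {x\<in>A. a \<le> x}"
    using assms by (intro card_Un_disjoint) auto
  finally show "card {x\<in>A. a \<le> x} = card A - card S" using * by simp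
qed

text \<open>The minimum of the right sublist is the pivot. Its rank is counted as cheap outright,
  which is the summand 1; the other \<open>n - 1 - card S\<close> ranks of that sublist are those
  counted by \<open>mean_at 1\<close>.\<close>

lemma mean_all_le_recursion:
  fixes G :: "nat \<Rightarrow> real \<Rightarrow> real" and y :: real
  assumes A: "finite A" "card A = n" "2 \<le> n"
    and IHa: "\<And>B y. finite B \<Longrightarrow> card B < n \<Longrightarrow> mean_all B y \<le> card B * G (card B) y"
    and IHm: "\<And>B i y. finite B \<Longrightarrow> i < card B \<Longrightarrow> card B < n \<Longrightarrow>
        mean_at 1 B i y \<le> real (card B - 1) * G (card B - 1) y"
  shows "mean_all A y \<le> (\<Sum>s<n. avg_all n s (\<lambda>S. 1 + real (card S) * G (card S) (y - exchanges n S) +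
      real (n - 1 - card S) * G (n - 1 - card S) (y - exchanges n S))) / n" (is "_ \<le> (\<Sum>s<n. avg_all n s ?H) / n")
proof -
  have ne: "A \<noteq> {}" using A by auto
  have "(\<Sum>xs\<in>permutations_of_set A. cheap_ranks 0 xs y) = (\<Sum>a\<in>A. \<Sum>S\<in>patterns A a. \<Sum>xs\<in>pivot_lists A a S. cheap_ranks 0 xs y)"
    by (rule sum_permutations_of_set_by_pivot[OF A(1) ne])
  also have "\<dots> \<le> (\<Sum>a\<in>A. \<Sum>S\<in>patterns A a. fact (card S) * fact (n - card S - 1) * ?H S)"
  proof (intro sum_mono)
    fix a S assume a: "a \<in> A" and S: "S \<in> patterns A a"
    note c = card_split_at_pivot[OF A(1) S, unfolded A(2)]
    have sub: "S \<subseteq> {1..<n}" using S by (simp add: patterns_def A(2))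
    have sn: "card S \<le> n - 1" using card_pattern[OF sub] by simp
    show "(\<Sum>xs\<in>pivot_lists A a S. cheap_ranks 0 xs y) \<le> fact (card S) * fact (n - card S - 1) * ?H S"
    proof (cases "S = {}")
      \<comment> \<open>A minimal pivot is a left sublist of its own and costs nothing. The summand
        1 covers its rank and the rest has size \<open>n - 1\<close>, in agreement with
        \<open>card S = 0\<close> in the formula.\<close>
      case True
      then have "{x\<in>A. x < a} = {}" using c A by simp
      then have "a = Min A" using a A by (intro Min_eqI[symmetric]) (auto simp: not_less)
      then have "(\<Sum>xs\<in>pivot_lists A a S. cheap_ranks 0 xs y) = fact (n - 1) * mean_at 0 A 0 y"
        using True pivot_lists_Min[OF A(1) ne] by (simp add: mean_at_def A(2))
      also have "\<dots> = fact (n - 1) * (of_bool (0 \<le> y) + mean_all (A - {Min A}) y)"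
        using mean_at_Min_first[of A y] A by simp
      also have "\<dots> \<le> fact (n - 1) * (1 + real (n - 1) * G (n - 1) y)"
        using IHa[of "A - {Min A}" y] A ne by (intro mult_left_mono add_mono) auto
      finally show ?thesis using True by (simp add: exchanges_def)
    next
      case False
      define T where "T = real (exchanges n S)"
      from sum_cheap_ranks_pivot_lists(1)[OF A(1) a S False] obtain k where k: "k < n - card S"
        and eq: "(\<Sum>xs\<in>pivot_lists A a S. cheap_ranks 0 xs y) = fact (card S) * fact (n - card S - 1) *
          (mean_all {x\<in>A. x < a} (y - T) + mean_at 0 {x\<in>A. a \<le> x} k (y - T))"
        unfolding A(2) T_def by blast
      have s0: "0 < card S" using False card_pattern[OF sub] by (simp add: card_gt_0_iff)
      have "mean_all {x\<in>A. x < a} (y - T) \<le> card S * G (card S) (y - T)"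
        using IHa[of "{x\<in>A. x < a}" "y - T"] c A sn by simp
      moreover have "mean_at 0 {x\<in>A. a \<le> x} k (y - T) \<le> 1 + mean_at 1 {x\<in>A. a \<le> x} k (y - T)"
        using A k c by (intro mean_at_0_le) auto
      moreover have "mean_at 1 {x\<in>A. a \<le> x} k (y - T) \<le> real (n - 1 - card S) * G (n - 1 - card S) (y - T)"
        using IHm[of "{x\<in>A. a \<le> x}" k "y - T"] c A sn s0 k by simp
      ultimately show ?thesis unfolding eq T_def[symmetric] by (intro mult_left_mono) auto
    qed
  qed
  also have "\<dots> = fact (n - 1) * (\<Sum>s<n. avg_all n s ?H)"
    using A by (intro sum_patterns_all) auto
  finally have "(\<Sum>xs\<in>permutations_of_set A. cheap_ranks 0 xs y) \<le> fact (n - 1) * (\<Sum>s<n. avg_all n s ?H)" .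
  moreover have "fact n = real n * fact (n - 1)" using A by (intro fact_reduce) auto
  ultimately show ?thesis using A by (simp add: mean_all_def field_simps)
qed

text \<open>The minimum goes to the left sublist, where its rank is still left out, and the rank of
  the pivot is given away on the right. Of the \<open>n - 1\<close> counted ranks there remain
  \<open>card S - 1\<close> and \<open>n - 1 - card S\<close>: the shape of the recursion for random
  lists of size \<open>n - 1\<close>.\<close>

lemma mean_at_1_le_recursion:
  fixes G :: "nat \<Rightarrow> real \<Rightarrow> real" and y :: real
  assumes A: "finite A" "card A = n" and i: "0 < i" "i < n"
    and IHm: "\<And>B i y. finite B \<Longrightarrow> i < card B \<Longrightarrow> card B < n \<Longrightarrow>
        mean_at 1 B i y \<le> real (card B - 1) * G (card B - 1) y"
  shows "mean_at 1 A i y \<le> (\<Sum>s\<in>{1..<n}. avg_in n s i (\<lambda>S. 1 + real (card S - 1) * G (card S - 1) (y - exchanges n S) +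
      real (n - 1 - card S) * G (n - 1 - card S) (y - exchanges n S))) / real (n - 1)" (is "_ \<le> (\<Sum>s\<in>{1..<n}. avg_in n s i ?H) / _")
proof -
  have "(\<Sum>xs\<in>min_at A i. cheap_ranks 1 xs y) =
    (\<Sum>a\<in>A - {Min A}. \<Sum>S\<in>{S\<in>patterns A a. i \<in> S}. \<Sum>xs\<in>{xs\<in>pivot_lists A a S. xs ! i = Min A}. cheap_ranks 1 xs y)"
    using A i by (intro sum_min_at_by_pivot) auto
  also have "\<dots> \<le> (\<Sum>a\<in>A - {Min A}. \<Sum>S\<in>{S\<in>patterns A a. i \<in> S}. fact (card S - 1) * fact (n - card S - 1) * ?H S)"
  proof (intro sum_mono)
    fix a S assume "a \<in> A - {Min A}" and "S \<in> {S\<in>patterns A a. i \<in> S}"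
    then have a: "a \<in> A" and S: "S \<in> patterns A a" "i \<in> S" by auto
    note c = card_split_at_pivot[OF A(1) S(1), unfolded A(2)]
    have sub: "S \<subseteq> {1..<n}" using S by (simp add: patterns_def A(2))
    have ne: "S \<noteq> {}" using S by auto
    define T where "T = real (exchanges n S)"
    from sum_cheap_ranks_pivot_lists(2)[OF A(1) a S(1) ne] S(2) obtain j k where jk: "j < card S" "k < n - card S"
      and "\<forall>b y. b \<le> 1 \<longrightarrow> (\<Sum>xs\<in>{xs\<in>pivot_lists A a S. xs ! i = Min A}. cheap_ranks b xs y) =
          fact (card S - 1) * fact (n - card S - 1) *
          (mean_at b {x\<in>A. x < a} j (y - exchanges n S) + mean_at 0 {x\<in>A. a \<le> x} k (y - exchanges n S))"
      unfolding A(2) by blast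
    then have eq: "(\<Sum>xs\<in>{xs\<in>pivot_lists A a S. xs ! i = Min A}. cheap_ranks 1 xs y) = fact (card S - 1) * fact (n - card S - 1) *
          (mean_at 1 {x\<in>A. x < a} j (y - T) + mean_at 0 {x\<in>A. a \<le> x} k (y - T))"
      unfolding T_def by simp
    have "mean_at 1 {x\<in>A. x < a} j (y - T) \<le> real (card S - 1) * G (card S - 1) (y - T)"
      using IHm[of "{x\<in>A. x < a}" j "y - T"] c A jk by simp
    moreover have "mean_at 0 {x\<in>A. a \<le> x} k (y - T) \<le> 1 + mean_at 1 {x\<in>A. a \<le> x} k (y - T)"
      using A jk c by (intro mean_at_0_le) auto
    moreover have "mean_at 1 {x\<in>A. a \<le> x} k (y - T) \<le> real (n - 1 - card S) * G (n - 1 - card S) (y - T)"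
      using IHm[of "{x\<in>A. a \<le> x}" k "y - T"] c A jk by simp
    ultimately show "(\<Sum>xs\<in>{xs\<in>pivot_lists A a S. xs ! i = Min A}. cheap_ranks 1 xs y) \<le>
        fact (card S - 1) * fact (n - card S - 1) * ?H S"
      unfolding eq T_def[symmetric] by (intro mult_left_mono) auto
  qed
  also have "\<dots> = fact (n - 2) * (\<Sum>s\<in>{1..<n}. avg_in n s i ?H)"
    using A i by (intro sum_patterns_in) auto
  finally have le: "(\<Sum>xs\<in>min_at A i. cheap_ranks 1 xs y) \<le> fact (n - 2) * (\<Sum>s\<in>{1..<n}. avg_in n s i ?H)" .
  have "fact (n - 1) = real (n - 1) * fact (n - 2)"
    using i by (subst fact_reduce) (auto simp: numeral_2_eq_2)
  then have "mean_at 1 A i y \<le> (fact (n - 2) * (\<Sum>s\<in>{1..<n}. avg_in n s i ?H)) / (real (n - 1) * fact (n - 2))"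
    unfolding mean_at_def A(2) using le by (simp only:) (intro divide_right_mono, auto)
  then show ?thesis by simp
qed

text \<open>In a lower bound no rank can be given away, so all ranks stay in the count. Both
  sublists have their minimum at a known index, hence the recursion closes in
  \<open>mean_at 0\<close> alone, with sizes \<open>card S\<close> and
  \<open>n - card S\<close>.\<close>

lemma mean_at_0_ge_recursion:
  fixes G :: "nat \<Rightarrow> real \<Rightarrow> real" and y :: real
  assumes A: "finite A" "card A = n" and i: "0 < i" "i < n"
    and IH: "\<And>B i y. finite B \<Longrightarrow> i < card B \<Longrightarrow> card B < n \<Longrightarrow>
        card B * G (card B) y \<le> mean_at 0 B i y"
  shows "(\<Sum>s\<in>{1..<n}. avg_in n s i (\<lambda>S. real (card S) * G (card S) (y - exchanges n S) +
      real (n - card S) * G (n - card S) (y - exchanges n S))) / real (n - 1) \<le> mean_at 0 A i y" (is "(\<Sum>s\<in>{1..<n}. avg_in n s i ?H) / _ \<le> _")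
proof -
  have "fact (n - 2) * (\<Sum>s\<in>{1..<n}. avg_in n s i ?H) =
    (\<Sum>a\<in>A - {Min A}. \<Sum>S\<in>{S\<in>patterns A a. i \<in> S}. fact (card S - 1) * fact (n - card S - 1) * ?H S)"
    using A i by (intro sum_patterns_in[symmetric]) auto
  also have "\<dots> \<le> (\<Sum>a\<in>A - {Min A}. \<Sum>S\<in>{S\<in>patterns A a. i \<in> S}. \<Sum>xs\<in>{xs\<in>pivot_lists A a S. xs ! i = Min A}. cheap_ranks 0 xs y)"
  proof (intro sum_mono)
    fix a S assume "a \<in> A - {Min A}" and "S \<in> {S\<in>patterns A a. i \<in> S}"
    then have a: "a \<in> A" and S: "S \<in> patterns A a" "i \<in> S" by auto
    note c = card_split_at_pivot[OF A(1) S(1), unfolded A(2)]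
    have sub: "S \<subseteq> {1..<n}" using S by (simp add: patterns_def A(2))
    have ne: "S \<noteq> {}" using S by auto
    define T where "T = real (exchanges n S)"
    from sum_cheap_ranks_pivot_lists(2)[OF A(1) a S(1) ne] S(2) obtain j k where jk: "j < card S" "k < n - card S"
      and "\<forall>b y. b \<le> 1 \<longrightarrow> (\<Sum>xs\<in>{xs\<in>pivot_lists A a S. xs ! i = Min A}. cheap_ranks b xs y) =
          fact (card S - 1) * fact (n - card S - 1) *
          (mean_at b {x\<in>A. x < a} j (y - exchanges n S) + mean_at 0 {x\<in>A. a \<le> x} k (y - exchanges n S))"
      unfolding A(2) by blast
    then have eq: "(\<Sum>xs\<in>{xs\<in>pivot_lists A a S. xs ! i = Min A}. cheap_ranks 0 xs y) = fact (card S - 1) * fact (n - card S - 1) *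
          (mean_at 0 {x\<in>A. x < a} j (y - T) + mean_at 0 {x\<in>A. a \<le> x} k (y - T))"
      unfolding T_def by simp
    have "card S * G (card S) (y - T) \<le> mean_at 0 {x\<in>A. x < a} j (y - T)"
      using IH[of "{x\<in>A. x < a}" j "y - T"] c A jk by simp
    moreover have "real (n - card S) * G (n - card S) (y - T) \<le> mean_at 0 {x\<in>A. a \<le> x} k (y - T)"
      using IH[of "{x\<in>A. a \<le> x}" k "y - T"] c A jk by simp
    ultimately show "fact (card S - 1) * fact (n - card S - 1) * ?H S \<le>
        (\<Sum>xs\<in>{xs\<in>pivot_lists A a S. xs ! i = Min A}. cheap_ranks 0 xs y)"
      unfolding eq T_def[symmetric] by (intro mult_left_mono add_mono) auto
  qed
  also have "\<dots> = (\<Sum>xs\<in>min_at A i. cheap_ranks 0 xs y)"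
    using A i by (intro sum_min_at_by_pivot[symmetric]) auto
  finally have le: "fact (n - 2) * (\<Sum>s\<in>{1..<n}. avg_in n s i ?H) \<le> (\<Sum>xs\<in>min_at A i. cheap_ranks 0 xs y)" .
  have "fact (n - 1) = real (n - 1) * fact (n - 2)"
    using i by (subst fact_reduce) (auto simp: numeral_2_eq_2)
  then have "(fact (n - 2) * (\<Sum>s\<in>{1..<n}. avg_in n s i ?H)) / (real (n - 1) * fact (n - 2)) \<le> mean_at 0 A i y"
    unfolding mean_at_def A(2) using le by (simp only:) (intro divide_right_mono, auto)
  then show ?thesis by simp
qed

section \<open>Moment generating function of the number of exchanges\<close>

text \<open>Hoeffding's lemma for a variable with the values \<open>x\<close> and \<open>y\<close>,
  taken with probabilities \<open>q\<close> and \<open>1 - q\<close>. The case x < y follows by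
  exchanging the values.\<close>

lemma exp_two_point_le:
  fixes q x y :: real
  assumes "0 \<le> q" "q \<le> 1"
  shows "q * exp x + (1 - q) * exp y \<le> exp (q * x + (1 - q) * y + (x - y)\<^sup>2 / 8)"
proof -
  have *: "q * exp x + (1 - q) * exp y \<le> exp (q * x + (1 - q) * y + (x - y)\<^sup>2 / 8)"
    if "y \<le> x" "0 \<le> q" "q \<le> 1" for q x y :: real
  proof -
    define h where "h = x - y"
    have h: "0 \<le> h" using that by (simp add: h_def)
    have pos: "1 + q * (exp h - 1) > 0" using h that by (intro add_pos_nonneg mult_nonneg_nonneg) auto
    have "ln (1 + q * (exp h - 1)) \<le> h * q + h\<^sup>2 / 8"
      using Hoeffdings_lemma_aux[OF h that(2)] by simp
    then have "1 + q * (exp h - 1) \<le> exp (h * q + h\<^sup>2 / 8)"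
      using pos by (metis exp_le_cancel_iff exp_ln)
    then have "exp y * (1 + q * (exp h - 1)) \<le> exp y * exp (h * q + h\<^sup>2 / 8)"
      by simp
    moreover have "exp y * (1 + q * (exp h - 1)) = q * exp x + (1 - q) * exp y"
    proof -
      have "exp y * exp h = exp x" by (simp add: h_def flip: exp_add)
      then show ?thesis by (simp add: algebra_simps)
    qed
    moreover have "exp y * exp (h * q + h\<^sup>2 / 8) = exp (q * x + (1 - q) * y + (x - y)\<^sup>2 / 8)"
      by (simp add: h_def algebra_simps flip: exp_add)
    ultimately show ?thesis by simp
  qed
  show ?thesis
  proof (cases "y \<le> x")
    case False
    then show ?thesis using *[of x y "1 - q"] assms by (simp add: add.commute power2_commute)
  qed (use *[of y x q] assms in simp)
qed

lemma sum_subsets_insert: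
  assumes "finite P" "p \<notin> P"
  shows "(\<Sum>S | S \<subseteq> insert p P \<and> card S = Suc j. f S) =
    (\<Sum>S | S \<subseteq> P \<and> card S = j. f (insert p S)) + (\<Sum>S | S \<subseteq> P \<and> card S = Suc j. f S :: real)"
proof -
  have "{S. S \<subseteq> insert p P \<and> card S = Suc j} =
      insert p ` {S. S \<subseteq> P \<and> card S = j} \<union> {S. S \<subseteq> P \<and> card S = Suc j}" (is "?L = ?A \<union> ?B")
  proof (intro set_eqI iffI)
    fix S assume S: "S \<in> ?L"
    show "S \<in> ?A \<union> ?B"
    proof (cases "p \<in> S")
      case True
      have "finite S" using S assms by (auto intro: finite_subset)
      then have "S = insert p (S - {p})" "S - {p} \<subseteq> P" "card (S - {p}) = j" using S True by auto
      then show ?thesis by blast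
    qed (use S in auto)
  next
    fix S assume "S \<in> ?A \<union> ?B"
    moreover have "card (insert p T) = Suc (card T)" if "T \<subseteq> P" for T
      using that assms finite_subset by (metis card_insert_disjoint subsetD)
    ultimately show "S \<in> ?L" by auto
  qed
  moreover have "inj_on (insert p) {S. S \<subseteq> P \<and> card S = j}"
    using assms by (auto intro!: inj_onI)
  moreover have "?A \<inter> ?B = {}" using assms by auto
  moreover have "finite ?A" "finite ?B" using assms by auto
  ultimately show ?thesis by (simp add: sum.union_disjoint sum.reindex)
qed

text \<open>Induction over \<open>W\<close>. The next element \<open>p\<close> lies in
  \<open>S\<close> with probability j / card P, and both branches are again hypergeometric. Their
  exponents differ by t (1 - w / n), at most |t| in modulus, so by the two-point bound every element
  of \<open>W\<close> costs t^2 / 8.\<close>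

lemma hypergeometric_mgf:
  fixes t :: real
  assumes "finite P" "W \<subseteq> P" "j \<le> card P"
  shows "(\<Sum>S | S \<subseteq> P \<and> card S = j. exp (t * card (S \<inter> W))) \<le>
    (card P choose j) * exp (t * (j * card W / card P) + t\<^sup>2 * card W / 8)"
proof -
  have "finite W" using assms finite_subset by blast
  then show ?thesis using assms
  proof (induction W arbitrary: P j rule: finite_induct)
    case empty
    then show ?case by (simp add: n_subsets)
  next
    case (insert p W)
    define P' where "P' = P - {p}"
    define n where "n = card P'"
    have P: "P = insert p P'" "p \<notin> P'" "finite P'" "W \<subseteq> P'" "card P = Suc n"
      using insert.prems insert.hyps card_Suc_Diff1[of P p] by (auto simp: P'_def n_def)
    show ?case
    proof (cases j)
      case 0
      have "{S. S \<subseteq> P \<and> card S = 0} = {{}}"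
        using insert.prems by (auto dest: finite_subset)
      then show ?thesis using 0 by simp
    next
      case (Suc i)
      define w where "w = card W"
      define V where "V = t\<^sup>2 * w / 8"
      have w: "w \<le> n" using P(3,4) by (simp add: w_def n_def card_mono)
      have i: "i \<le> n" using insert.prems P Suc by simp
      have cardI: "card (insert p S \<inter> insert p W) = Suc (card (S \<inter> W))" if "S \<subseteq> P'" for S
      proof -
        have "insert p S \<inter> insert p W = insert p (S \<inter> W)" by auto
        moreover have "p \<notin> S \<inter> W" "finite (S \<inter> W)" using insert.hyps by auto
        ultimately show ?thesis by simp
      qed
      have expI: "exp (t * card (insert p S \<inter> insert p W)) = exp t * exp (t * card (S \<inter> W))"
        if "S \<subseteq> P'" for S
        unfolding cardI[OF that] by (simp add: distrib_left exp_add)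
      have card2: "S \<inter> insert p W = S \<inter> W" if "S \<subseteq> P'" for S using that P(2) by auto
      define a b where "a = t * (i * w / n) + V" and "b = t * (Suc i * w / n) + V"
      have A: "(\<Sum>S | S \<subseteq> P' \<and> card S = i. exp (t * card (S \<inter> W))) \<le> (n choose i) * exp a"
        using insert.IH[OF P(3,4), of i] i by (simp add: n_def w_def a_def V_def)
      have B: "(\<Sum>S | S \<subseteq> P' \<and> card S = Suc i. exp (t * card (S \<inter> W))) \<le> (n choose Suc i) * exp b"
      proof (cases "Suc i \<le> n")
        case True
        then show ?thesis using insert.IH[OF P(3,4), of "Suc i"] by (simp add: n_def w_def b_def V_def)
      next
        case False
        have "\<not> (S \<subseteq> P' \<and> card S = Suc i)" for S
          using card_mono[OF P(3), of S] False unfolding n_def by linarith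
        then have "{S. S \<subseteq> P' \<and> card S = Suc i} = {}" by blast
        then show ?thesis by (simp only: sum.empty) simp
      qed
      define C where "C = real (Suc n choose Suc i)"
      define q where "q = real (Suc i) / Suc n"
      have q: "0 \<le> q" "q \<le> 1" using i by (auto simp: q_def)
      have Ci: "real (n choose i) = C * q"
        using Suc_times_binomial_eq[of n i] by (simp add: C_def q_def field_simps flip: of_nat_mult)
      have Cs: "real (n choose Suc i) = C * (1 - q)"
      proof -
        have "C = real (n choose i) + real (n choose Suc i)" by (simp add: C_def)
        then show ?thesis using Ci by (simp add: algebra_simps)
      qed
      have "(\<Sum>S | S \<subseteq> P \<and> card S = j. exp (t * card (S \<inter> insert p W))) =
         (\<Sum>S | S \<subseteq> P' \<and> card S = i. exp (t * card (insert p S \<inter> insert p W))) +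
         (\<Sum>S | S \<subseteq> P' \<and> card S = Suc i. exp (t * card (S \<inter> insert p W)))"
        unfolding P(1) Suc by (rule sum_subsets_insert[OF P(3,2)])
      also have "\<dots> = (\<Sum>S | S \<subseteq> P' \<and> card S = i. exp t * exp (t * card (S \<inter> W))) +
         (\<Sum>S | S \<subseteq> P' \<and> card S = Suc i. exp (t * card (S \<inter> W)))"
        by (intro arg_cong2[where f = "(+)"] sum.cong refl) (simp_all only: mem_Collect_eq expI card2)
      also have "\<dots> \<le> exp t * ((n choose i) * exp a) + (n choose Suc i) * exp b"
        unfolding sum_distrib_left[symmetric] by (intro add_mono mult_left_mono A B) auto
      also have "\<dots> = C * (q * exp (t + a) + (1 - q) * exp b)"
        unfolding Ci Cs by (simp add: exp_add algebra_simps)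
      also have "\<dots> \<le> C * exp (q * (t + a) + (1 - q) * b + (t + a - b)\<^sup>2 / 8)"
        by (intro mult_left_mono exp_two_point_le q) (simp add: C_def)
      also have "q * (t + a) + (1 - q) * b = t * (real j * card (insert p W) / card P) + V"
      proof (cases "n = 0")
        case True
        then have "w = 0" "i = 0" using w i by auto
        then show ?thesis using True insert.hyps P Suc by (simp add: a_def b_def q_def V_def w_def)
      next
        case False
        define i' n' w' where "i' = real i" and "n' = real n" and "w' = real w"
        have pos: "n' > 0" "1 + n' > 0" using False by (auto simp: n'_def)
        have "(1 + i') / (1 + n') * (t + (t * (i' * w' / n') + V)) +
            (1 - (1 + i') / (1 + n')) * (t * ((1 + i') * w' / n') + V) =
            t * ((1 + i') * (1 + w') / (1 + n')) + V"
        proof -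
          have "n' * inverse n' = 1" "(1 + n') * inverse (1 + n') = 1"
            using pos by auto
          then show ?thesis unfolding divide_inverse by algebra
        qed
        then show ?thesis using insert.hyps P(5) Suc
          by (simp add: a_def b_def q_def i'_def n'_def w'_def del: mult_Suc flip: w_def)
      qed
      also have "C * exp (t * (real j * card (insert p W) / card P) + V + (t + a - b)\<^sup>2 / 8)
         \<le> C * exp (t * (real j * card (insert p W) / card P) + t\<^sup>2 * card (insert p W) / 8)"
      proof -
        have "t + a - b = t * (1 - w / n)"
          by (simp add: a_def b_def algebra_simps add_divide_distrib)
        moreover have "(1 - w / n :: real)\<^sup>2 \<le> 1"
          using w by (auto simp: power_le_one_iff divide_simps)
        ultimately have "(t + a - b)\<^sup>2 \<le> t\<^sup>2"
          by (simp add: power_mult_distrib mult_left_le)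
        moreover have "t\<^sup>2 * card (insert p W) / 8 = V + t\<^sup>2 / 8"
          using insert.hyps by (simp add: V_def w_def algebra_simps add_divide_distrib)
        ultimately show ?thesis
          by (intro mult_left_mono) (auto simp: C_def)
      qed
      finally show ?thesis by (simp add: C_def P(5) Suc del: mult_Suc binomial_Suc_Suc)
    qed
  qed
qed

lemma card_eq_exchanges_plus:
  assumes "S \<subseteq> {1..<n}"
  shows "real (exchanges n S) = real (card S) - real (card (S \<inter> {1..<card S}))"
proof -
  have "finite S" using card_pattern[OF assms] by simp
  have "S = (S \<inter> {card S..<n}) \<union> (S \<inter> {1..<card S})" using assms by auto
  then have "card S = card ((S \<inter> {card S..<n}) \<union> (S \<inter> {1..<card S}))" by simp
  also have "\<dots> = card (S \<inter> {card S..<n}) + card (S \<inter> {1..<card S})"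
    using \<open>finite S\<close> by (intro card_Un_disjoint) auto
  finally show ?thesis by (simp add: exchanges_def)
qed

text \<open>The exchanges are the small positions from \<open>s\<close> on, or \<open>s\<close>
  minus the number of small positions below \<open>s\<close>. The mean is the same, but Hoeffding's
  bound costs the size of the window, n - s or s - 1. The first suits the left sublist, of size s,
  and the second the right one, so that the cost never exceeds the decrease in size.\<close>

lemma avg_all_mgf:
  fixes t :: real
  assumes s: "s < n" and n: "2 \<le> n"
  shows "1 \<le> s \<Longrightarrow> avg_all n s (\<lambda>S. exp (t * exchanges n S)) \<le> exp (t * (real s * (real n - s) / (real n - 1)) + t\<^sup>2 * (real n - s) / 8)"
    and "avg_all n s (\<lambda>S. exp (t * exchanges n S)) \<le> exp (t * (real s * (real n - s) / (real n - 1)) + t\<^sup>2 * (s - 1) / 8)"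
proof -
  define C where "C = real (n - 1 choose s)"
  have C: "0 < C" using s by (simp add: C_def)
  have hyper: "(\<Sum>S | S \<subseteq> {1..<n} \<and> card S = s. exp (r * card (S \<inter> W))) / C \<le>
      exp (r * (real s * real (card W) / (real n - 1)) + r\<^sup>2 * card W / 8)" if "W \<subseteq> {1..<n}" for r :: real and W
    using hypergeometric_mgf[of "{1..<n}" W s r] that s n C by (simp add: of_nat_diff C_def pos_divide_le_eq mult.commute)
  {
    assume s1: "1 \<le> s"
    have "avg_all n s (\<lambda>S. exp (t * exchanges n S)) =
        (\<Sum>S | S \<subseteq> {1..<n} \<and> card S = s. exp (t * card (S \<inter> {s..<n}))) / C"
      unfolding avg_all_def C_def by (intro arg_cong2[where f = "(/)"] sum.cong) (auto simp: exchanges_def)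
    also have "\<dots> \<le> exp (t * (real s * real (card {s..<n}) / (real n - 1)) + t\<^sup>2 * card {s..<n} / 8)"
      using s1 by (intro hyper) auto
    finally show "avg_all n s (\<lambda>S. exp (t * exchanges n S)) \<le> exp (t * (real s * (real n - s) / (real n - 1)) + t\<^sup>2 * (real n - s) / 8)"
      using s by (simp add: of_nat_diff)
  }
  have "avg_all n s (\<lambda>S. exp (t * exchanges n S)) =
      (\<Sum>S | S \<subseteq> {1..<n} \<and> card S = s. exp (t * s) * exp (- t * card (S \<inter> {1..<s}))) / C"
    unfolding avg_all_def C_def
    by (intro arg_cong2[where f = "(/)"] sum.cong)
      (auto simp: card_eq_exchanges_plus algebra_simps simp flip: exp_add)
  also have "\<dots> = exp (t * s) * ((\<Sum>S | S \<subseteq> {1..<n} \<and> card S = s. exp (- t * card (S \<inter> {1..<s}))) / C)"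
    by (simp add: sum_distrib_left)
  also have "\<dots> \<le> exp (t * s) * exp (- t * (real s * real (card {1..<s}) / (real n - 1)) + (- t)\<^sup>2 * card {1..<s} / 8)"
    using s by (intro mult_left_mono hyper) auto
  also have "\<dots> = exp (t * (real s - real s * real (card {1..<s}) / (real n - 1)) + t\<^sup>2 * card {1..<s} / 8)"
    by (simp add: algebra_simps flip: exp_add)
  also have "real s - real s * real (card {1..<s}) / (real n - 1) = real s * (real n - s) / (real n - 1)"
    using s n by (cases s) (auto simp: field_simps of_nat_diff)
  finally show "avg_all n s (\<lambda>S. exp (t * exchanges n S)) \<le> exp (t * (real s * (real n - s) / (real n - 1)) + t\<^sup>2 * (s - 1) / 8)"
    using s by simp
qed

lemma sum_subsets_containing:
  fixes H :: "nat set \<Rightarrow> real"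
  assumes "i \<in> P" "finite P" "1 \<le> s"
  shows "(\<Sum>S | S \<subseteq> P \<and> card S = s \<and> i \<in> S. H S) = (\<Sum>S | S \<subseteq> P - {i} \<and> card S = s - 1. H (insert i S))"
proof (rule sum.reindex_bij_witness[where i = "insert i" and j = "\<lambda>S. S - {i}"])
  fix S assume S: "S \<in> {S. S \<subseteq> P \<and> card S = s \<and> i \<in> S}"
  then have "finite S" using assms finite_subset by blast
  then show "S - {i} \<in> {S. S \<subseteq> P - {i} \<and> card S = s - 1}" using S by auto
next
  fix S assume S: "S \<in> {S. S \<subseteq> P - {i} \<and> card S = s - 1}"
  then have "finite S" using assms finite_subset by blast
  then show "insert i S \<in> {S. S \<subseteq> P \<and> card S = s \<and> i \<in> S}" using S assms by (auto simp: card_insert_if)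
qed (auto simp: insert_absorb)

text \<open>Given that \<open>i\<close> belongs to \<open>S\<close>, the rest of \<open>S\<close> is
  a uniform subset of the other \<open>n - 2\<close> positions; \<open>e\<close> tells whether
  \<open>i\<close> itself counts as an exchange. The exact mean \<open>\<mu>\<close> depends on
  \<open>i\<close>, so only bounds for it that are free of \<open>i\<close> are exported.\<close>

lemma avg_in_mgf:
  fixes t :: real
  assumes s: "1 \<le> s" "s < n" and n: "3 \<le> n" and i: "0 < i" "i < n"
  obtains \<mu> :: real where "(real s - 1) * (real n - s) / (real n - 2) \<le> \<mu>" "\<mu> \<le> real s * (real n - s) / (real n - 2)"
    and "avg_in n s i (\<lambda>S. exp (t * exchanges n S)) \<le> exp (t * \<mu> + t\<^sup>2 * (real n - s) / 8)"
    and "avg_in n s i (\<lambda>S. exp (t * exchanges n S)) \<le> exp (t * \<mu> + t\<^sup>2 * (s - 1) / 8)"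
proof
  define C where "C = real (n - 2 choose (s - 1))"
  define e where "e = (if s \<le> i then 1 else 0 :: nat)"
  define \<mu> where "\<mu> = (real e * (real n - 1 - s) + (real s - 1) * (real n - s)) / (real n - 2)"
  define P where "P = {1..<n} - {i}"
  have P: "finite P" "card P = n - 2" using i by (auto simp: P_def)
  have "s - 1 \<le> n - 2" using s by simp
  then have C: "0 < C" by (simp add: C_def)
  have hyper: "(\<Sum>S | S \<subseteq> P \<and> card S = s - 1. exp (r * card (S \<inter> W))) / C \<le>
      exp (r * ((real s - 1) * real (card W) / (real n - 2)) + r\<^sup>2 * card W / 8)" if "W \<subseteq> P" for r :: real and W
    using hypergeometric_mgf[of P W "s - 1" r] that P C \<open>s - 1 \<le> n - 2\<close> s n
    by (simp add: of_nat_diff C_def pos_divide_le_eq mult.commute)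
  have avg: "avg_in n s i H = (\<Sum>S | S \<subseteq> P \<and> card S = s - 1. H (insert i S)) / C" for H
    unfolding avg_in_def C_def P_def using i s by (subst sum_subsets_containing) auto
  have cardS: "card (insert i S) = s" "insert i S \<subseteq> {1..<n}" "i \<notin> S" "finite S"
    if "S \<subseteq> P" "card S = s - 1" for S
  proof -
    show "finite S" using that P finite_subset by blast
    moreover have "i \<notin> S" using that by (auto simp: P_def)
    ultimately show "card (insert i S) = s" "insert i S \<subseteq> {1..<n}" "i \<notin> S" using that i s by (auto simp: P_def)
  qed
  define W1 W2 where "W1 = {s..<n} - {i}" and "W2 = {1..<s} - {i}"
  have cW1: "real (card W1) = real n - s - e"
    using s i by (auto simp: W1_def e_def card_Diff_singleton_if of_nat_diff)
  have cW2: "real (card W2) = real s - 2 + e"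
    using s i by (auto simp: W2_def e_def card_Diff_singleton_if of_nat_diff)
  have n2: "real n - 2 > 0" using n by simp
  have ex1: "real (exchanges n (insert i S)) = e + card (S \<inter> W1)" if "S \<subseteq> P" "card S = s - 1" for S
  proof -
    note c = cardS[OF that]
    have "insert i S \<inter> {s..<n} = (if s \<le> i then insert i (S \<inter> W1) else S \<inter> W1)"
      using c i by (auto simp: W1_def)
    then show ?thesis using c by (auto simp: exchanges_def e_def W1_def)
  qed
  have ex2: "real (exchanges n (insert i S)) = real s - 1 + real e - real (card (S \<inter> W2))" if "S \<subseteq> P" "card S = s - 1" for S
  proof -
    note c = cardS[OF that]
    have "insert i S \<inter> {1..<s} = (if s \<le> i then S \<inter> W2 else insert i (S \<inter> W2))"
      using c i by (auto simp: W2_def)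
    then have "card (insert i S \<inter> {1..<s}) = card (S \<inter> W2) + (1 - e)"
      using c by (auto simp: e_def W2_def)
    then show ?thesis using card_eq_exchanges_plus[OF c(2)] c(1) s by (auto simp: e_def)
  qed
  show "(real s - 1) * (real n - s) / (real n - 2) \<le> \<mu>"
    unfolding \<mu>_def using s n2 by (intro divide_right_mono) auto
  have "real e * (real n - 1 - s) + (real s - 1) * (real n - s) \<le> real s * (real n - s)"
    using s by (auto simp: e_def algebra_simps)
  then show "\<mu> \<le> real s * (real n - s) / (real n - 2)"
    unfolding \<mu>_def using n2 by (intro divide_right_mono) auto
  have "avg_in n s i (\<lambda>S. exp (t * exchanges n S)) =
      (\<Sum>S | S \<subseteq> P \<and> card S = s - 1. exp (t * e) * exp (t * card (S \<inter> W1))) / C"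
    unfolding avg by (intro arg_cong2[where f = "(/)"] sum.cong) (auto simp: ex1 distrib_left exp_add)
  also have "\<dots> = exp (t * e) * ((\<Sum>S | S \<subseteq> P \<and> card S = s - 1. exp (t * card (S \<inter> W1))) / C)"
    by (simp add: sum_distrib_left)
  also have "\<dots> \<le> exp (t * e) * exp (t * ((real s - 1) * real (card W1) / (real n - 2)) + t\<^sup>2 * card W1 / 8)"
    using s by (intro mult_left_mono hyper) (auto simp: W1_def P_def)
  also have "\<dots> = exp (t * (e + (real s - 1) * real (card W1) / (real n - 2)) + t\<^sup>2 * card W1 / 8)"
    by (simp add: algebra_simps flip: exp_add)
  also have "real e + (real s - 1) * real (card W1) / (real n - 2) = \<mu>"
    unfolding \<mu>_def cW1 using n2 by (simp add: field_simps)
  also have "exp (t * \<mu> + t\<^sup>2 * card W1 / 8) \<le> exp (t * \<mu> + t\<^sup>2 * (real n - s) / 8)"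
    using s by (auto simp: cW1 of_nat_diff intro!: mult_left_mono)
  finally show "avg_in n s i (\<lambda>S. exp (t * exchanges n S)) \<le> exp (t * \<mu> + t\<^sup>2 * (real n - s) / 8)" .
  have "avg_in n s i (\<lambda>S. exp (t * exchanges n S)) =
      (\<Sum>S | S \<subseteq> P \<and> card S = s - 1. exp (t * (real s - 1 + e)) * exp (- t * card (S \<inter> W2))) / C"
    unfolding avg by (intro arg_cong2[where f = "(/)"] sum.cong) (auto simp: ex2 algebra_simps simp flip: exp_add)
  also have "\<dots> = exp (t * (real s - 1 + e)) * ((\<Sum>S | S \<subseteq> P \<and> card S = s - 1. exp (- t * card (S \<inter> W2))) / C)"
    by (simp add: sum_distrib_left)
  also have "\<dots> \<le> exp (t * (real s - 1 + e)) * exp (- t * ((real s - 1) * real (card W2) / (real n - 2)) + (- t)\<^sup>2 * card W2 / 8)"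
    using s by (intro mult_left_mono hyper) (auto simp: W2_def P_def)
  also have "\<dots> = exp (t * (real s - 1 + real e - (real s - 1) * real (card W2) / (real n - 2)) + t\<^sup>2 * card W2 / 8)"
    by (simp add: algebra_simps diff_divide_distrib flip: exp_add)
  also have "real s - 1 + real e - (real s - 1) * real (card W2) / (real n - 2) = \<mu>"
    unfolding \<mu>_def cW2 using n2 by (simp add: field_simps)
  also have "exp (t * \<mu> + t\<^sup>2 * card W2 / 8) \<le> exp (t * \<mu> + t\<^sup>2 * (s - 1) / 8)"
    using s by (auto simp: cW2 e_def of_nat_diff intro!: mult_left_mono)
  finally show "avg_in n s i (\<lambda>S. exp (t * exchanges n S)) \<le> exp (t * \<mu> + t\<^sup>2 * (s - 1) / 8)" .
qed

section \<open>Comparison with the limit law in one step\<close>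

text \<open>
  In the next two lemmas \<open>u\<close> lies in the interval attached to the subproblem size \<open>k\<close>, so that
  \<open>sqrt u\<close> is close to \<open>k / N\<close>; they compare the exponents before and after one step.
\<close>

lemma lower_exponent:
  fixes N k :: nat and u z x :: real
  assumes N: "49 \<le> real N" and k: "1 \<le> k" "k < N"
    and u: "1 / N + real k * (real k - 1) / N\<^sup>2 < u" "u \<le> 1 / N + (real k + 1) * real k / N\<^sup>2"
    and x: "x = split_pre z u" "x \<le> 1"
  shows "real N * z - k * x - k * (real N - k) / N \<le> 7 * (sqrt N - sqrt k) - 2 * sqrt N * (1 - k / N)"
proof -
  define v where "v = sqrt u"
  define n where "n = real N"
  define c where "c = real k"
  have n: "49 \<le> n" and c: "1 \<le> c" "c \<le> n - 1" using N k by (auto simp: n_def c_def)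
  have u0: "0 < u"
  proof -
    have "0 \<le> 1 / n + c * (c - 1) / n\<^sup>2" using n c by auto
    then show ?thesis using u(1) by (simp add: n_def c_def)
  qed
  have v: "0 < v" "v\<^sup>2 = u" using u0 by (auto simp: v_def)
  have nv: "(n * v)\<^sup>2 = n\<^sup>2 * u" using v by (simp add: power_mult_distrib)
  have "n\<^sup>2 * (1 / n + c * (c - 1) / n\<^sup>2) \<le> n\<^sup>2 * u" "n\<^sup>2 * u \<le> n\<^sup>2 * (1 / n + (c + 1) * c / n\<^sup>2)"
    using u n by (auto simp: n_def c_def)
  moreover have "n\<^sup>2 * (1 / n + y / n\<^sup>2) = n + y" for y
    using n by (simp add: distrib_left power2_eq_square)
  ultimately have b: "n + c * (c - 1) \<le> (n * v)\<^sup>2" "(n * v)\<^sup>2 \<le> n + (c + 1) * c"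
    by (simp_all add: nv)
  \<comment> \<open>The right end of the interval will give 2 c d + d^2 <= 2 n, hence both d <= 3/2
    sqrt n and c d <= n. The first is the better bound for small c, the second for large c.\<close>
  define d where "d = n * v - c"
  have d0: "0 \<le> d"
  proof -
    have "c\<^sup>2 \<le> (n * v)\<^sup>2" using b(1) c by (simp add: power2_eq_square algebra_simps)
    then have "c \<le> n * v" by (rule power2_le_imp_le) (use v n in simp)
    then show ?thesis by (simp add: d_def)
  qed
  have cd: "(c + d)\<^sup>2 \<le> c\<^sup>2 + 2 * n"
    using b(2) c by (simp add: d_def power2_eq_square algebra_simps)
  define q where "q = sqrt n"
  have q: "7 \<le> q" "q\<^sup>2 = n" using n real_le_rsqrt[of 7 n] by (auto simp: q_def)
  define r where "r = sqrt c / q"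
  have r: "0 < r" "r < 1" "sqrt c = r * q" "c = r\<^sup>2 * n"
  proof -
    show "0 < r" using q c by (simp add: r_def)
    show "r < 1" using q c by (simp add: r_def q_def)
    show "sqrt c = r * q" using q by (simp add: r_def)
    have "c = (sqrt c)\<^sup>2" using c by simp
    then show "c = r\<^sup>2 * n" using q by (simp add: \<open>sqrt c = r * q\<close> power_mult_distrib)
  qed
  have cd0: "0 \<le> c * d" using c d0 by simp
  have d1: "d \<le> 3 / 2 * q"
  proof -
    have "d\<^sup>2 \<le> 2 * q\<^sup>2" using cd cd0 unfolding q(2) power2_sum by linarith
    also have "\<dots> \<le> (3 / 2 * q)\<^sup>2" by (simp add: power2_eq_square)
    finally show ?thesis by (rule power2_le_imp_le) (use q in simp)
  qed
  have d2: "c * d \<le> n"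
    using cd zero_le_power2[of d] unfolding power2_sum by linarith
  have d2': "7 * r\<^sup>2 * d \<le> q"
  proof -
    have "q * (7 * r\<^sup>2 * d) \<le> q * (q * r\<^sup>2 * d)"
      using q r d0 by (intro mult_left_mono mult_right_mono) auto
    also have "\<dots> = c * d" using r(4) q(2) by (simp add: power2_eq_square mult_ac)
    also have "\<dots> \<le> q * q" using d2 q(2) by (simp add: power2_eq_square)
    finally show ?thesis using q by simp
  qed
  \<comment> \<open>The constant 7 is attained by the first case: d = 3/2 q and r = 2/5 give 2 (5/2)
    (7/5) = 7. For larger r the bound on c d takes over.\<close>
  have key: "2 * (d + q) * (1 + r) \<le> 7 * q"
  proof -
    consider "r \<le> 2 / 5" | "2 / 5 \<le> r" "r \<le> 4 / 5" | "4 / 5 \<le> r" by linarith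
    then show ?thesis
    proof cases
      case 1
      have "2 * (d + q) * (1 + r) \<le> 2 * (3 / 2 * q + q) * (1 + 2 / 5)"
        using d1 1 r q d0 by (intro mult_mono) auto
      also have "\<dots> \<le> 7 * q" by simp
      finally show ?thesis .
    next
      case 2
      have "4 / 25 \<le> r\<^sup>2" using power_mono[OF 2(1), of 2] by (simp add: power2_eq_square)
      then have "7 * (4 / 25) * d \<le> 7 * r\<^sup>2 * d" using d0 by (intro mult_right_mono) auto
      then have "d \<le> 25 / 28 * q" using d2' by linarith
      then have "2 * (d + q) * (1 + r) \<le> 2 * (25 / 28 * q + q) * (1 + 4 / 5)"
        using 2 r q d0 by (intro mult_mono) auto
      also have "\<dots> \<le> 7 * q" using q by simp
      finally show ?thesis .
    next
      case 3
      have "16 / 25 \<le> r\<^sup>2" using power_mono[OF 3, of 2] by (simp add: power2_eq_square)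
      then have "7 * (16 / 25) * d \<le> 7 * r\<^sup>2 * d" using d0 by (intro mult_right_mono) auto
      then have "d \<le> 25 / 112 * q" using d2' by linarith
      then have "2 * (d + q) * (1 + r) \<le> 2 * (25 / 112 * q + q) * (1 + 1)"
        using r q d0 by (intro mult_mono) auto
      also have "\<dots> \<le> 7 * q" using q by simp
      finally show ?thesis .
    qed
  qed
  have z: "z = v * (x + 1 - v)"
    using x(1) v by (simp add: split_pre_def v_def[symmetric] field_simps)
  have "n * z - c * x - c * (n - c) / n = d * x + n * v * (1 - v) - c * (n - c) / n"
    by (simp add: z d_def algebra_simps)
  \<comment> \<open>As d >= 0, the worst case is x = 1, and then all but 2 d (1 - c / n) - d^2 / n
    cancels.\<close>
  also have "\<dots> \<le> d * 1 + n * v * (1 - v) - c * (n - c) / n"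
    using d0 x(2) by (intro diff_right_mono add_right_mono mult_left_mono) auto
  also have "\<dots> = 2 * d * (1 - c / n) - d\<^sup>2 / n"
    using n by (simp add: d_def field_simps power2_eq_square)
  also have "\<dots> \<le> 2 * d * (1 - r\<^sup>2)" using n r(4) by simp
  \<comment> \<open>More than necessary is charged to 7 (q - sqrt c). The surplus 2 q (1 - r^2) is
    kept as a reserve against the rounding of the mean number of exchanges.\<close>
  also have "\<dots> = 2 * (d + q) * (1 + r) * (1 - r) - 2 * q * (1 - r\<^sup>2)"
    by (simp add: power2_eq_square algebra_simps)
  also have "\<dots> \<le> 7 * q * (1 - r) - 2 * q * (1 - r\<^sup>2)"
    using key r by (intro diff_right_mono mult_right_mono) auto
  also have "\<dots> = 7 * (q - sqrt c) - 2 * q * (1 - c / n)"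
    using r n by (simp add: algebra_simps)
  finally show ?thesis by (simp add: n_def c_def q_def)
qed

lemma upper_exponent:
  fixes m k :: nat and u z x :: real
  assumes m: "49 \<le> real m" and k: "1 \<le> k" "k < m"
    and u: "real k * (real k - 1) / (m * (real m - 1)) < u" "u \<le> (real k + 1) * real k / (m * (real m - 1))"
    and x: "0 \<le> x" "x \<le> 1" "x \<le> split_pre z u"
  shows "k * x - m * z + k * (real m - k) / (real m - 2) \<le> 7 * (sqrt m - sqrt k) + 1 - 2 * sqrt m * (1 - k / m)"
proof -
  define v where "v = sqrt u"
  define n where "n = real m"
  define c where "c = real k"
  have n: "49 \<le> n" and c: "1 \<le> c" "c \<le> n - 1" using m k by (auto simp: n_def c_def)
  have u0: "0 < u"
  proof -
    have "0 \<le> c * (c - 1) / (n * (n - 1))" using n c by auto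
    then show ?thesis using u(1) by (simp add: n_def c_def)
  qed
  have v: "0 < v" "v\<^sup>2 = u" using u0 by (auto simp: v_def)
  have nv: "(n * v)\<^sup>2 * (n - 1) = n * (n * (n - 1) * u)" using v by (simp add: power_mult_distrib power2_eq_square)
  have b: "c * (c - 1) < n * (n - 1) * u" "n * (n - 1) * u \<le> (c + 1) * c"
    using u n by (simp_all add: n_def c_def field_simps)
  \<comment> \<open>Without the shift of u by 1 / N that occurs in the other comparison, sqrt u
    stays within 1 / m of k / m, so that \<open>e\<close> is at most 1 in modulus.\<close>
  define e where "e = c - n * v"
  have e1: "e \<le> 1"
  proof -
    have "(c - 1)\<^sup>2 * (n - 1) \<le> n * (c * (c - 1))"
    proof -
      have "n * (c * (c - 1)) - (c - 1)\<^sup>2 * (n - 1) = (c - 1) * (n + c - 1)"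
        by (simp add: power2_eq_square algebra_simps)
      moreover have "0 \<le> (c - 1) * (n + c - 1)" using c n by simp
      ultimately show ?thesis by linarith
    qed
    also have "\<dots> \<le> (n * v)\<^sup>2 * (n - 1)" unfolding nv using b n by (intro mult_left_mono) auto
    finally have "(c - 1)\<^sup>2 \<le> (n * v)\<^sup>2" using n by simp
    then have "c - 1 \<le> n * v" by (rule power2_le_imp_le) (use v n in simp)
    then show ?thesis by (simp add: e_def)
  qed
  have e2: "- 1 \<le> e"
  proof -
    have "(n * v)\<^sup>2 * (n - 1) \<le> n * ((c + 1) * c)" unfolding nv using b n by (intro mult_left_mono) auto
    also have "\<dots> \<le> (c + 1)\<^sup>2 * (n - 1)"
    proof -
      have "(c + 1)\<^sup>2 * (n - 1) - n * ((c + 1) * c) = (c + 1) * (n - 1 - c)"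
        by (simp add: power2_eq_square algebra_simps)
      moreover have "0 \<le> (c + 1) * (n - 1 - c)" using c n by simp
      ultimately show ?thesis by linarith
    qed
    finally have "(n * v)\<^sup>2 \<le> (c + 1)\<^sup>2" using n by simp
    then have "n * v \<le> c + 1" by (rule power2_le_imp_le) (use c in simp)
    then show ?thesis by (simp add: e_def)
  qed
  define X where "X = 1 - c / n"
  have X: "1 / n \<le> X" "X \<le> 1" using c n by (auto simp: X_def field_simps)
  have z: "v * (x + 1 - v) \<le> z"
    using x(3) v by (simp add: split_pre_def v_def[symmetric] field_simps)
  have "c * x - n * z \<le> c * x - n * (v * (x + 1 - v))"
    using z n by simp
  also have "\<dots> = - c * X + e * (x - 1 + 2 * X) + e\<^sup>2 / n"
    using n by (simp add: e_def X_def field_simps power2_eq_square)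
  also have "\<dots> \<le> - c * X + (1 + 3 * X)"
  proof -
    have "e\<^sup>2 \<le> 1" using e1 e2 by (auto simp: abs_square_le_1)
    then have "e\<^sup>2 / n \<le> X" using X n by (intro order.trans[OF divide_right_mono X(1)]) auto
    moreover have "e * (x - 1 + 2 * X) \<le> 1 + 2 * X"
    proof -
      have "e * (x - 1 + 2 * X) \<le> \<bar>e\<bar> * \<bar>x - 1 + 2 * X\<bar>" by (simp add: abs_mult[symmetric])
      also have "\<dots> \<le> 1 * (1 + 2 * X)"
      proof (intro mult_mono)
        have "0 \<le> X" using X n by (intro order.trans[OF _ X(1)]) auto
        then show "\<bar>x - 1 + 2 * X\<bar> \<le> 1 + 2 * X" using x by linarith
      qed (use e1 e2 in auto)
      finally show ?thesis by simp
    qed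
    ultimately show ?thesis by linarith
  qed
  finally have A: "c * x - n * z \<le> - c * X + (1 + 3 * X)" .
  have X0: "0 \<le> X" using X n by (intro order.trans[OF _ X(1)]) auto
  have B: "c * (n - c) / (n - 2) \<le> c * X + 3 * X"
  proof -
    have "n / (n - 2) = 1 + 2 / (n - 2)" using n by (simp add: field_simps)
    moreover have "c * (n - c) / (n - 2) = c * X * (n / (n - 2))" using n by (simp add: X_def field_simps)
    ultimately have "c * (n - c) / (n - 2) = c * X + (2 * c / (n - 2)) * X" by (simp add: algebra_simps)
    moreover have "2 * c / (n - 2) \<le> 3" using c n by (simp add: field_simps)
    ultimately show ?thesis using mult_right_mono[OF _ X0, of "2 * c / (n - 2)" 3] by linarith
  qed
  define q where "q = sqrt n"
  have q: "7 \<le> q" "q\<^sup>2 = n" using n real_le_rsqrt[of 7 n] by (auto simp: q_def)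
  define r where "r = sqrt c / q"
  have r: "0 < r" "r < 1" "sqrt c = r * q" "c = r\<^sup>2 * n"
  proof -
    show "0 < r" using q c by (simp add: r_def)
    show "r < 1" using q c by (simp add: r_def q_def)
    show "sqrt c = r * q" using q by (simp add: r_def)
    have "c = (sqrt c)\<^sup>2" using c by simp
    then show "c = r\<^sup>2 * n" using q by (simp add: \<open>sqrt c = r * q\<close> power_mult_distrib)
  qed
  have XR: "X = (1 - r) * (1 + r)" using r(4) n by (simp add: X_def power2_eq_square algebra_simps)
  \<comment> \<open>The errors 6 X and the reserve 2 q X are both paid from 7 (q - sqrt c), by q >=
    7 and X = (1 - r) (1 + r) <= 2 (1 - r). Only the constant 1 is left over, as it does not vanish
    when k approaches m.\<close>
  have "6 * X + 2 * q * X \<le> 20 / 7 * q * X"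
    using q X0 mult_right_mono[of "6 + 2 * q" "20 / 7 * q" X] by (simp add: algebra_simps)
  also have "\<dots> = 20 / 7 * q * (1 - r) * (1 + r)" by (simp add: XR)
  also have "\<dots> \<le> 20 / 7 * q * (1 - r) * 2" using q r by (intro mult_left_mono) auto
  also have "\<dots> \<le> 7 * q * (1 - r)" using q r by simp
  also have "\<dots> = 7 * (q - sqrt c)" using r by (simp add: algebra_simps)
  finally have "6 * X + 2 * q * X \<le> 7 * (q - sqrt c)" .
  then have "c * x - n * z + c * (n - c) / (n - 2) \<le> 7 * (q - sqrt c) + 1 - 2 * q * X"
    using A B by linarith
  then show ?thesis by (simp add: n_def c_def q_def X_def)
qed

text \<open>The left side is convex on [1,4], since its second derivative is (6 - l) exp l, and the
  right side is linear, so the two ends suffice. At l = 4 little room is left: \<open>exp 4\<close>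
  is about 54.6. The purpose is exp l <= l q whenever 7 < q (1 - l / 8).\<close>

lemma exp_le_56:
  fixes l :: real
  assumes "1 \<le> l" "l \<le> 4"
  shows "(8 - l) * exp l \<le> 56 * l"
proof -
  let ?f = "\<lambda>l :: real. (8 - l) * exp l"
  have conv: "convex_on {1..4} ?f"
  proof (rule f''_ge0_imp_convex[where f' = "\<lambda>l. (7 - l) * exp l" and f'' = "\<lambda>l. (6 - l) * exp l"])
    show "(?f has_real_derivative (7 - x) * exp x) (at x)" for x
      by (auto intro!: derivative_eq_intros simp: algebra_simps)
    show "((\<lambda>l. (7 - l) * exp l) has_real_derivative (6 - x) * exp x) (at x)" for x :: real
      by (auto intro!: derivative_eq_intros simp: algebra_simps)
  qed auto
  define s where "s = (l - 1) / 3"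
  have s: "0 \<le> s" "s \<le> 1" "l = (1 - s) * 1 + s * 4" using assms by (auto simp: s_def field_simps)
  have e: "exp 1 < (272 / 100 :: real)" by (rule e_less_272)
  have "exp 4 = (exp 1 :: real) ^ 4" by (simp flip: exp_of_nat_mult)
  also have "\<dots> \<le> (272 / 100) ^ 4" using e by (intro power_mono) auto
  also have "\<dots> \<le> 56" by (simp add: power4_eq_xxxx)
  finally have e4: "exp 4 \<le> (56 :: real)" .
  have "?f ((1 - s) *\<^sub>R 1 + s *\<^sub>R 4) \<le> (1 - s) * ?f 1 + s * ?f 4"
    using s by (intro convex_onD[OF conv]) auto
  also have "\<dots> \<le> (1 - s) * 56 + s * (4 * 56)"
    using s e e4 by (intro add_mono mult_left_mono) auto
  also have "\<dots> = 56 * l" using s(3) by (simp add: algebra_simps)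
  finally show ?thesis using s(3) by simp
qed

lemma sum_geometric_le:
  fixes a :: real and m :: nat
  assumes "0 < a"
  shows "(\<Sum>d\<in>{1..<m}. exp (- a * d)) \<le> 1 / a"
proof -
  have ea: "a \<le> exp a - 1" using exp_ge_add_one_self[of a] by linarith
  have "(\<Sum>d\<in>{1..<m}. exp (- a * real d)) * a \<le> (\<Sum>d\<in>{1..<m}. exp (- a * real d)) * (exp a - 1)"
    by (intro mult_left_mono sum_nonneg ea) auto
  also have "\<dots> = (\<Sum>d\<in>{1..<m}. exp (- a * (real d - 1)) - exp (- a * d))"
    unfolding sum_distrib_right by (intro sum.cong refl) (simp add: algebra_simps flip: exp_add)
  also have "\<dots> \<le> 1"
  proof (cases "1 \<le> m")
    case True
    then have "(\<Sum>d\<in>{1..<m}. exp (- a * (real d - 1)) - exp (- a * d)) = 1 - exp (- a * (real m - 1))"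
      by (induction m rule: dec_induct) auto
    then show ?thesis by simp
  qed simp
  finally show ?thesis using assms by (simp add: field_simps)
qed

text \<open>
  Here \<open>w k\<close> is the probability of the subproblem size \<open>k\<close> and the exponential is the loss factor
  left over by the exponent comparison; the hypothesis on \<open>m\<close> says that the bounds to be proved
  are not trivial.
\<close>

lemma sum_weights_exp_le_1:
  fixes w :: "nat \<Rightarrow> real" and l :: real
  assumes l: "0 < l" "l \<le> 4" and m: "7 < sqrt m * (1 - l / 8)" "1 \<le> m"
    and w: "\<And>k. k \<in> {1..<m} \<Longrightarrow> 0 \<le> w k \<and> w k \<le> 2 / m" "(\<Sum>k\<in>{1..<m}. w k) \<le> 1"
  shows "(\<Sum>k\<in>{1..<m}. w k * exp (l * (1 - 2 * sqrt m * (1 - k / m)))) \<le> 1"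
proof -
  define q where "q = sqrt m"
  have q0: "0 < q" using m by (simp add: q_def)
  have mq: "real m = q\<^sup>2" by (simp add: q_def)
  \<comment> \<open>Bounding \<open>w k\<close> by 2 / m and writing d = m - k makes the sum
    geometric with ratio exp (- 2 a / q); it is at most exp a / (a q).\<close>
  have large: "(\<Sum>k\<in>{1..<m}. w k * exp (a * (1 - 2 * q * (1 - k / m)))) \<le> 1"
    if a: "1 \<le> a" "a \<le> 4" "exp a \<le> a * q" for a
  proof -
    have "(\<Sum>k\<in>{1..<m}. w k * exp (a * (1 - 2 * q * (1 - k / m)))) \<le>
        (\<Sum>k\<in>{1..<m}. 2 / m * exp (a * (1 - 2 * q * (1 - k / m))))"
      using w by (intro sum_mono mult_right_mono) auto
    also have "\<dots> = (\<Sum>d\<in>{1..<m}. 2 / m * exp (a * (1 - 2 * q * (1 - real (m - d) / m))))"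
      by (rule sum.reindex_bij_witness[where i = "\<lambda>d. m - d" and j = "\<lambda>d. m - d"]) auto
    also have "\<dots> = (\<Sum>d\<in>{1..<m}. 2 / q\<^sup>2 * exp a * exp (- (2 * a / q) * d))"
    proof (intro sum.cong refl)
      fix d assume d: "d \<in> {1..<m}"
      have "1 - real (m - d) / m = d / q\<^sup>2" using d q0 by (simp add: of_nat_diff mq field_simps)
      moreover have "a * (1 - 2 * q * (d / q\<^sup>2)) = a + - (2 * a / q) * d"
        using q0 by (simp add: power2_eq_square field_simps)
      ultimately show "2 / m * exp (a * (1 - 2 * q * (1 - real (m - d) / m))) = 2 / q\<^sup>2 * exp a * exp (- (2 * a / q) * d)"
        by (simp only: mq exp_add mult.assoc)
    qed
    also have "\<dots> = 2 / q\<^sup>2 * exp a * (\<Sum>d\<in>{1..<m}. exp (- (2 * a / q) * d))"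
      by (simp add: sum_distrib_left)
    also have "\<dots> \<le> 2 / q\<^sup>2 * exp a * (1 / (2 * a / q))"
      using a q0 by (intro mult_left_mono sum_geometric_le) auto
    also have "\<dots> = exp a / (a * q)" using q0 a by (simp add: power2_eq_square field_simps)
    also have "\<dots> \<le> 1" using a q0 by simp
    finally show ?thesis .
  qed
  show ?thesis
  proof (cases "1 \<le> l")
    case True
    have "(8 - l) * exp l \<le> 7 * (8 * l)" using exp_le_56[OF True l(2)] by simp
    also have "\<dots> \<le> q * (1 - l / 8) * (8 * l)" using l m by (intro mult_right_mono) (auto simp: q_def)
    also have "\<dots> = (8 - l) * (l * q)" by (simp add: algebra_simps)
    finally have "exp l \<le> l * q" using l by simp
    then show ?thesis using large[of l] l True by (simp add: q_def)
  next
    case False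
    have "q * (1 - l / 8) \<le> q * 1" using q0 l by (intro mult_left_mono) auto
    then have q7: "7 < q" using m(1)[folded q_def] by linarith
    have q8: "(\<Sum>k\<in>{1..<m}. w k * exp (1 * (1 - 2 * q * (1 - k / m)))) \<le> 1"
    proof (rule large)
      show "exp 1 \<le> 1 * q" using e_less_272 q7 by linarith
    qed auto
    \<comment> \<open>For small l the condition exp l <= l q may fail. Convexity, in the form exp (l
      x) <= (1 - l) + l exp x, reduces this case to a = 1.\<close>
    have "(\<Sum>k\<in>{1..<m}. w k * exp (l * (1 - 2 * q * (1 - k / m)))) \<le>
       (\<Sum>k\<in>{1..<m}. (1 - l) * w k + l * (w k * exp (1 * (1 - 2 * q * (1 - k / m)))))"
    proof (intro sum_mono)
      fix k assume k: "k \<in> {1..<m}"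
      have "exp (l * (1 - 2 * q * (1 - k / m))) \<le> (1 - l) + l * exp (1 - 2 * q * (1 - k / m))"
        using convex_onD[OF exp_convex, of l 0 "1 - 2 * q * (1 - k / m)"] l False by simp
      then have "w k * exp (l * (1 - 2 * q * (1 - k / m))) \<le> w k * ((1 - l) + l * exp (1 - 2 * q * (1 - k / m)))"
        using w(1)[OF k] by (intro mult_left_mono) auto
      then show "w k * exp (l * (1 - 2 * q * (1 - k / m))) \<le> (1 - l) * w k + l * (w k * exp (1 * (1 - 2 * q * (1 - k / m))))"
        by (simp add: algebra_simps)
    qed
    also have "\<dots> = (1 - l) * (\<Sum>k\<in>{1..<m}. w k) + l * (\<Sum>k\<in>{1..<m}. w k * exp (1 * (1 - 2 * q * (1 - k / m))))"
      by (simp add: sum.distrib sum_distrib_left)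
    also have "\<dots> \<le> (1 - l) * 1 + l * 1"
      using l False w(2) q8 by (intro add_mono mult_left_mono) auto
    finally show ?thesis by (simp add: q_def)
  qed
qed

section \<open>Envelopes and the comparison step for abstract means\<close>

definition loss :: "real \<Rightarrow> nat \<Rightarrow> real" where
  "loss l k = 7 * l * sqrt k + l\<^sup>2 * k / 8"

text \<open>
  The envelopes are the best bounds on the distribution function of the exchange count at size \<open>k\<close>
  that follow from exponential comparison with the scaled limit law, over all its arguments \<open>z\<close>.
\<close>

definition lower_env :: "real \<Rightarrow> nat \<Rightarrow> real \<Rightarrow> real" where
  "lower_env l k y = min 1 (INF z. cdf X_law z + exp (loss l k - l * (real k * z - y)))"

definition upper_env :: "real \<Rightarrow> nat \<Rightarrow> real \<Rightarrow> real" where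
  "upper_env l k y = max 0 (SUP z. cdf X_law z - exp (loss l k - l * (y - real k * z)))"

lemma lower_env_le: "lower_env l k y \<le> cdf X_law z + exp (loss l k - l * (real k * z - y))"
proof -
  have "(INF z. cdf X_law z + exp (loss l k - l * (real k * z - y))) \<le> cdf X_law z + exp (loss l k - l * (real k * z - y))"
    by (rule cINF_lower) (auto intro!: bdd_belowI[of _ 0] add_nonneg_nonneg simp: cdf_X_law_bounds)
  then show ?thesis by (simp add: lower_env_def)
qed

lemma lower_env_le_1: "lower_env l k y \<le> 1"
  by (simp add: lower_env_def)

lemma le_lower_env:
  assumes "P \<le> 1" "\<And>z. P \<le> cdf X_law z + exp (loss l k - l * (real k * z - y))"
  shows "P \<le> lower_env l k y"
  unfolding lower_env_def using assms by (auto intro!: cINF_greatest)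

lemma upper_env_ge: "cdf X_law z - exp (loss l k - l * (y - real k * z)) \<le> upper_env l k y"
proof -
  have "cdf X_law z - exp (loss l k - l * (y - real k * z)) \<le> (SUP z. cdf X_law z - exp (loss l k - l * (y - real k * z)))"
  proof (rule cSUP_upper)
    show "bdd_above (range (\<lambda>z. cdf X_law z - exp (loss l k - l * (y - real k * z))))"
    proof (rule bdd_aboveI[of _ 1])
      fix r assume "r \<in> range (\<lambda>z. cdf X_law z - exp (loss l k - l * (y - real k * z)))"
      then obtain z where "r = cdf X_law z - exp (loss l k - l * (y - real k * z))" by auto
      then show "r \<le> 1" using cdf_X_law_bounds(2)[of z] exp_ge_zero[of "loss l k - l * (y - real k * z)"] by linarith
    qed
  qed simp
  then show ?thesis by (simp add: upper_env_def)
qed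

lemma upper_env_nonneg: "0 \<le> upper_env l k y"
  by (simp add: upper_env_def)

lemma upper_env_le:
  assumes "0 \<le> P" "\<And>z. cdf X_law z - exp (loss l k - l * (y - real k * z)) \<le> P"
  shows "upper_env l k y \<le> P"
  unfolding upper_env_def using assms by (auto intro!: cSUP_least)

text \<open>The infimum is bounded by any single curve, and on such a curve the shift of
  \<open>y\<close> by \<open>T S\<close> is a factor \<open>exp (- l * T S)\<close>. Averaging over
  \<open>S\<close> therefore costs no more than the moment generating function.\<close>

lemma mean_lower_env_le:
  fixes T :: "'a \<Rightarrow> real"
  assumes X: "finite X" "X \<noteq> {}" and mgf: "(\<Sum>S\<in>X. exp (- l * T S)) / card X \<le> exp e"
  shows "(\<Sum>S\<in>X. lower_env l k (y - T S)) / card X \<le> 1"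
    and "(\<Sum>S\<in>X. lower_env l k (y - T S)) / card X \<le> cdf X_law x + exp (loss l k - l * (k * x - y) + e)"
proof -
  have c: "0 < real (card X)" using X by (simp add: card_gt_0_iff)
  have "(\<Sum>S\<in>X. lower_env l k (y - T S)) \<le> (\<Sum>S\<in>X. 1)"
    by (intro sum_mono lower_env_le_1)
  then show "(\<Sum>S\<in>X. lower_env l k (y - T S)) / card X \<le> 1" using c by (simp add: field_simps)
  have "(\<Sum>S\<in>X. lower_env l k (y - T S)) \<le>
      (\<Sum>S\<in>X. cdf X_law x + exp (loss l k - l * (k * x - y)) * exp (- l * T S))"
  proof (intro sum_mono)
    fix S
    have "lower_env l k (y - T S) \<le> cdf X_law x + exp (loss l k - l * (k * x - (y - T S)))"
      by (rule lower_env_le)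
    also have "exp (loss l k - l * (k * x - (y - T S))) = exp (loss l k - l * (k * x - y)) * exp (- l * T S)"
      by (simp add: algebra_simps flip: exp_add)
    finally show "lower_env l k (y - T S) \<le> cdf X_law x + exp (loss l k - l * (k * x - y)) * exp (- l * T S)" .
  qed
  also have "\<dots> = card X * (cdf X_law x + exp (loss l k - l * (k * x - y)) * ((\<Sum>S\<in>X. exp (- l * T S)) / card X))"
    unfolding sum.distrib sum_distrib_left[symmetric] using c by (simp add: distrib_left)
  also have "\<dots> \<le> card X * (cdf X_law x + exp (loss l k - l * (k * x - y)) * exp e)"
    using mgf c by (intro mult_left_mono add_left_mono) auto
  finally show "(\<Sum>S\<in>X. lower_env l k (y - T S)) / card X \<le> cdf X_law x + exp (loss l k - l * (k * x - y) + e)"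
    using c by (simp add: exp_add divide_le_eq mult.commute)
qed

lemma mean_upper_env_ge:
  fixes T :: "'a \<Rightarrow> real"
  assumes X: "finite X" "X \<noteq> {}" and mgf: "(\<Sum>S\<in>X. exp (l * T S)) / card X \<le> exp e"
  shows "0 \<le> (\<Sum>S\<in>X. upper_env l k (y - T S)) / card X"
    and "cdf X_law x - exp (loss l k - l * (y - k * x) + e) \<le> (\<Sum>S\<in>X. upper_env l k (y - T S)) / card X"
proof -
  have c: "0 < real (card X)" using X by (simp add: card_gt_0_iff)
  show "0 \<le> (\<Sum>S\<in>X. upper_env l k (y - T S)) / card X"
    by (intro divide_nonneg_nonneg sum_nonneg upper_env_nonneg) auto
  have "card X * (cdf X_law x - exp (loss l k - l * (y - k * x)) * exp e) \<le>
    card X * (cdf X_law x - exp (loss l k - l * (y - k * x)) * ((\<Sum>S\<in>X. exp (l * T S)) / card X))"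
    using mgf c by (intro mult_left_mono diff_left_mono) auto
  also have "\<dots> = (\<Sum>S\<in>X. cdf X_law x - exp (loss l k - l * (y - k * x)) * exp (l * T S))"
    unfolding sum_subtractf sum_distrib_left[symmetric] using c by (simp add: right_diff_distrib)
  also have "\<dots> \<le> (\<Sum>S\<in>X. upper_env l k (y - T S))"
  proof (intro sum_mono)
    fix S
    have "exp (loss l k - l * (y - k * x)) * exp (l * T S) = exp (loss l k - l * (y - T S - k * x))"
      by (simp add: algebra_simps flip: exp_add)
    then show "cdf X_law x - exp (loss l k - l * (y - k * x)) * exp (l * T S) \<le> upper_env l k (y - T S)"
      using upper_env_ge[of x l k "y - T S"] by simp
  qed
  finally show "cdf X_law x - exp (loss l k - l * (y - k * x) + e) \<le> (\<Sum>S\<in>X. upper_env l k (y - T S)) / card X"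
    using c by (simp add: exp_add le_divide_eq mult.commute)
qed

lemma sum_index_real: "(\<Sum>k\<in>{1..<n}. 2 * real k) = real n * (real n - 1)"
proof (cases n)
  case (Suc m)
  have "(\<Sum>k\<in>{1..<Suc m}. 2 * real k) = (Suc m) * (real (Suc m) - 1)"
    by (induction m) (auto simp: algebra_simps)
  then show ?thesis using Suc by simp
qed simp

text \<open>An abstract \<open>\<mu>\<close> allows two uses: random lists of size \<open>N\<close>,
  and lists of size \<open>N + 1\<close> with known place of the minimum and its rank left out. Both
  obey the recursion \<open>rec\<close>, where \<open>aL k\<close> and \<open>aR k\<close> belong to
  a left and a right sublist with \<open>k\<close> counted ranks.\<close>

lemma lower_step:
  fixes l z y \<mu> :: real and aL aR :: "nat \<Rightarrow> real"
  assumes l: "0 < l" "l \<le> 4" and N: "1 \<le> N"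
    and \<mu>: "\<mu> \<le> N" "y < 0 \<Longrightarrow> \<mu> = 0"
    and rec: "2 \<le> N \<Longrightarrow> \<mu> \<le> 1 + (\<Sum>k\<in>{1..<N}. k * (aL k + aR k)) / N"
    and a1: "\<And>k. k \<in> {1..<N} \<Longrightarrow> aL k \<le> 1" "\<And>k. k \<in> {1..<N} \<Longrightarrow> aR k \<le> 1"
    and aL: "\<And>k x. k \<in> {1..<N} \<Longrightarrow> aL k \<le> cdf X_law x +
      exp (loss l k - l * (k * x - y) + (- l * (k * (real N - k) / N - 1) + l\<^sup>2 * (real N - k) / 8))"
    and aR: "\<And>k x. k \<in> {1..<N} \<Longrightarrow> aR k \<le> cdf X_law x +
      exp (loss l k - l * (k * x - y) + (- l * (k * (real N - k) / N - 1) + l\<^sup>2 * (real N - k) / 8))"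
  shows "\<mu> \<le> N * (cdf X_law z + exp (loss l N - l * (N * z - y)))"
proof -
  define E where "E = loss l N - l * (N * z - y)"
  define W where "W = exp E"
  have W0: "0 < W" by (simp add: W_def)
  have trivial: "\<mu> \<le> N * (cdf X_law z + W)" if "1 \<le> cdf X_law z + W"
    using mult_left_mono[OF that, of "real N"] \<mu>(1) by simp
  show ?thesis
  proof (cases "y < 0 \<or> 1 \<le> z \<or> 0 \<le> E")
    case True
    then consider "y < 0" | "1 \<le> z" | "0 \<le> E" by blast
    then have "\<mu> \<le> N * (cdf X_law z + W)"
    proof cases
      case 1
      then show ?thesis using \<mu>(2) cdf_X_law_bounds W0 by (simp add: add_nonneg_nonneg)
    next
      case 2
      then show ?thesis using W0 by (intro trivial) (simp add: cdf_X_law_ge_1)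
    next
      case 3
      then have "1 \<le> W" by (simp add: W_def)
      then show ?thesis using cdf_X_law_bounds(1)[of z] by (intro trivial) linarith
    qed
    then show ?thesis by (simp add: W_def E_def)
  next
    case False
    \<comment> \<open>What remains is y >= 0, z < 1 and a negative exponent. These force sqrt N (1 -
      l / 8) > 7 and N >= 49, as the comparison of exponents and the averaging of the weights
      require.\<close>
    define q where "q = sqrt N"
    have q: "0 < q" "real N = q * q" using N by (auto simp: q_def)
    have "0 < l * (real N * z - 7 * q - l * N / 8)"
    proof -
      have "0 \<le> l * y" using False l by simp
      then have "0 < l * (N * z) - loss l N" using False by (simp add: E_def algebra_simps)
      then show ?thesis by (simp add: loss_def q_def algebra_simps power2_eq_square)
    qed
    then have big: "7 * q + l * N / 8 < N * z" using l by (simp add: zero_less_mult_iff)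
    have "q * (7 + l * q / 8) < q * (q * z)" using big q by (simp add: algebra_simps)
    then have qz: "7 + l * q / 8 < q * z" using q by simp
    have z0: "z < 1" using False by simp
    have "0 \<le> l * q / 8" using l q by simp
    then have z7: "7 < q * z" using qz by linarith
    have "q * z \<le> q * 1" using z0 q by (intro mult_left_mono) auto
    then have q7: "7 < q" and ql: "7 < sqrt N * (1 - l / 8)" using z7 qz by (auto simp: q_def algebra_simps)
    have "7 * 7 \<le> q * q" using q7 by (intro mult_mono) auto
    then have N49: "49 \<le> real N" using q by simp
    define w where "w k = exp (l * (1 - 2 * sqrt N * (1 - k / N)))" for k :: nat
    \<comment> \<open>The piece for \<open>k\<close> has length 2 k / N^2, the probability that the
      search goes on with \<open>k\<close> counted ranks on either side. The first piece, of length
      1 / N, stands for the rank given away, the summand 1 in \<open>rec\<close>.\<close>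
    define c where "c j = (if j = 0 then 0 else 1 / N + real j * (real j - 1) / (real N)\<^sup>2)" for j :: nat
    have N2: "0 < real N" using N by simp
    have c1: "c (Suc 0) - c 0 = 1 / N" by (simp add: c_def)
    have ck: "c (Suc k) - c k = 2 * real k / (real N)\<^sup>2" if "k \<in> {1..<N}" for k
      using that by (simp add: c_def diff_divide_distrib[symmetric] algebra_simps)
    have cN: "c N = 1" using N N2 by (simp add: c_def field_simps power2_eq_square)
    have pt: "a k - W * w k \<le> cdf X_law (split_pre z u)"
      if k: "k \<in> {1..<N}" and u: "c k < u" "u \<le> c (Suc k)"
        and a: "a k \<le> 1" "\<And>x. a k \<le> cdf X_law x +
          exp (loss l k - l * (k * x - y) + (- l * (k * (real N - k) / N - 1) + l\<^sup>2 * (real N - k) / 8))"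
      for k u a
    proof (cases "split_pre z u \<le> 1")
      case True
      define x where "x = split_pre z u"
      have "real N * z - k * x - k * (real N - k) / N \<le> 7 * (sqrt N - sqrt k) - 2 * sqrt N * (1 - k / N)"
      proof (rule lower_exponent[OF N49 _ _ _ _ x_def])
        show "1 \<le> k" "k < N" using k by auto
        show "1 / real N + real k * (real k - 1) / real (N\<^sup>2) < u" using u k by (simp add: c_def)
        show "u \<le> 1 / real N + (real k + 1) * real k / real (N\<^sup>2)" using u k by (simp add: c_def add.commute)
        show "x \<le> 1" using True by (simp add: x_def)
      qed
      then have "l * (real N * z - k * x - k * (real N - k) / N) \<le> l * (7 * (sqrt N - sqrt k) - 2 * sqrt N * (1 - k / N))"
        using l by (intro mult_left_mono) auto
      then have "loss l k - l * (k * x - y) + (- l * (k * (real N - k) / N - 1) + l\<^sup>2 * (real N - k) / 8)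
          \<le> E + l * (1 - 2 * sqrt N * (1 - k / N))"
        by (simp add: E_def loss_def algebra_simps diff_divide_distrib)
      then have "exp (loss l k - l * (k * x - y) + (- l * (k * (real N - k) / N - 1) + l\<^sup>2 * (real N - k) / 8)) \<le> W * w k"
        by (simp add: W_def w_def flip: exp_add)
      then show ?thesis using a(2)[of x] by (simp add: x_def)
    next
      case False
      then have "cdf X_law (split_pre z u) = 1" by (intro cdf_X_law_ge_1) simp
      moreover have "0 \<le> W * w k" using W0 by (simp add: w_def)
      ultimately show ?thesis using a(1) by linarith
    qed
    define b where "b k = (if k = 0 then 1 else (aL k + aR k) / 2 - W * w k)" for k
    have "(\<Sum>k\<in>{0..<N}. (c (Suc k) - c k) * b k) \<le> cdf X_law z"
    proof (rule steps_le_cdf_X_law)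
      fix k assume k: "k \<in> {0..<N}"
      show "c k \<le> c (Suc k)"
      proof (cases "k = 0")
        case True then show ?thesis using c1 N2 by (simp add: c_def)
      next
        case False
        then have "0 \<le> c (Suc k) - c k" using ck[of k] k by simp
        then show ?thesis by simp
      qed
      fix u assume u: "c k < u" "u \<le> c (Suc k)"
      show "b k \<le> cdf X_law (split_pre z u)"
      proof (cases "k = 0")
        case True
        \<comment> \<open>On the first piece sqrt u <= 1 / q is so small against z > 7 / q that
          \<open>split_pre z u\<close> is at least 1, where the distribution function takes the
          required value 1.\<close>
        have "0 < u" "u \<le> 1 / N" using u True by (auto simp: c_def)
        then have "sqrt u \<le> sqrt (1 / N)" by (intro real_sqrt_le_mono)
        then have "sqrt u \<le> 1 / q" by (simp add: q_def real_sqrt_divide)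
        then have "2 * sqrt u * q \<le> 2" using q by (simp add: field_simps)
        also have "\<dots> < z * q" using z7 by (simp add: mult.commute)
        finally have "2 * sqrt u < z" using q by simp
        then have "1 \<le> split_pre z u"
          using \<open>0 < u\<close> by (simp add: split_pre_def field_simps)
        then show ?thesis using True by (simp add: b_def cdf_X_law_ge_1)
      next
        case False
        then have k': "k \<in> {1..<N}" using k by auto
        have "(aL k + aR k) / 2 - W * w k \<le> cdf X_law (split_pre z u)"
        proof -
          have mid: "(a + b) / 2 - d \<le> x" if "a - d \<le> x" "b - d \<le> x" for x a b d :: real
            using that by (simp add: field_simps)
          show ?thesis
            by (rule mid[OF pt[OF k' u, of aL, OF a1(1)[OF k'] aL[OF k']] pt[OF k' u, of aR, OF a1(2)[OF k'] aR[OF k']]])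
        qed
        then show ?thesis using False by (simp add: b_def)
      qed
    qed (use cN in \<open>auto simp: c_def\<close>)
    moreover have "(\<Sum>k\<in>{0..<N}. (c (Suc k) - c k) * b k) = 1 / N + (\<Sum>k\<in>{1..<N}. (c (Suc k) - c k) * b k)"
      using N c1 by (simp add: sum.atLeast_Suc_lessThan b_def)
    moreover have "(\<Sum>k\<in>{1..<N}. (c (Suc k) - c k) * b k) =
        (\<Sum>k\<in>{1..<N}. k * (aL k + aR k) / (real N)\<^sup>2 - W * (2 * real k / (real N)\<^sup>2 * w k))"
    proof (intro sum.cong refl)
      fix k assume "k \<in> {1..<N}"
      then show "(c (Suc k) - c k) * b k = k * (aL k + aR k) / (real N)\<^sup>2 - W * (2 * real k / (real N)\<^sup>2 * w k)"
        unfolding ck[OF \<open>k \<in> {1..<N}\<close>] b_def using N2 by (simp add: field_simps)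
    qed
    moreover have "\<dots> = (\<Sum>k\<in>{1..<N}. k * (aL k + aR k)) / (real N)\<^sup>2 - W * (\<Sum>k\<in>{1..<N}. 2 * real k / (real N)\<^sup>2 * w k)"
      by (simp add: sum_subtractf sum_divide_distrib sum_distrib_left)
    moreover have "W * (\<Sum>k\<in>{1..<N}. 2 * real k / (real N)\<^sup>2 * w k) \<le> W * 1"
    proof (intro mult_left_mono)
      show "(\<Sum>k\<in>{1..<N}. 2 * real k / (real N)\<^sup>2 * w k) \<le> 1"
        unfolding w_def
      proof (rule sum_weights_exp_le_1[OF l ql N])
        show "0 \<le> 2 * real k / (real N)\<^sup>2 \<and> 2 * real k / (real N)\<^sup>2 \<le> 2 / N" if "k \<in> {1..<N}" for k
          using that N2 by (auto simp: field_simps power2_eq_square)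
        have "(\<Sum>k\<in>{1..<N}. 2 * real k / (real N)\<^sup>2) = real N * (real N - 1) / (real N)\<^sup>2"
          by (simp only: sum_index_real flip: sum_divide_distrib)
        also have "\<dots> \<le> 1" using N2 by (simp add: field_simps power2_eq_square)
        finally show "(\<Sum>k\<in>{1..<N}. 2 * real k / (real N)\<^sup>2) \<le> 1" .
      qed
    qed (use W0 in simp)
    ultimately have "1 / N + (\<Sum>k\<in>{1..<N}. k * (aL k + aR k)) / (real N)\<^sup>2 \<le> cdf X_law z + W"
      by linarith
    then have "N * (1 / N + (\<Sum>k\<in>{1..<N}. k * (aL k + aR k)) / (real N)\<^sup>2) \<le> N * (cdf X_law z + W)"
      by (intro mult_left_mono) auto
    moreover have "N * (1 / N + (\<Sum>k\<in>{1..<N}. k * (aL k + aR k)) / (real N)\<^sup>2) = 1 + (\<Sum>k\<in>{1..<N}. k * (aL k + aR k)) / N"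
      using N2 by (simp add: distrib_left power2_eq_square)
    moreover have "2 \<le> N" using N49 by linarith
    note rec[OF this]
    ultimately have "\<mu> \<le> N * (cdf X_law z + W)" by linarith
    then show ?thesis by (simp add: W_def E_def)
  qed
qed

text \<open>Here no rank is given away: the sizes s and m - s, with s uniform on 1, ..., m - 1,
  exhaust the m ranks. Size k has total probability 2 k / (m (m - 1)), and the pieces of these
  lengths fill the unit interval.\<close>

lemma upper_step:
  fixes l z y \<nu> :: real and aL aR :: "nat \<Rightarrow> real"
  assumes l: "0 < l" "l \<le> 4" and m: "49 \<le> real m" "7 < sqrt m * (1 - l / 8)"
    and rec: "(\<Sum>k\<in>{1..<m}. k * (aL k + aR k)) / (real m - 1) \<le> \<nu>"
    and a0: "\<And>k. k \<in> {1..<m} \<Longrightarrow> 0 \<le> aL k" "\<And>k. k \<in> {1..<m} \<Longrightarrow> 0 \<le> aR k"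
    and aL: "\<And>k x. k \<in> {1..<m} \<Longrightarrow> cdf X_law x -
      exp (loss l k - l * (y - k * x) + (l * (k * (real m - k) / (real m - 2)) + l\<^sup>2 * (real m - k) / 8)) \<le> aL k"
    and aR: "\<And>k x. k \<in> {1..<m} \<Longrightarrow> cdf X_law x -
      exp (loss l k - l * (y - k * x) + (l * (k * (real m - k) / (real m - 2)) + l\<^sup>2 * (real m - k) / 8)) \<le> aR k"
  shows "m * (cdf X_law z - exp (loss l m - l * (y - m * z))) \<le> \<nu>"
proof -
  define E where "E = loss l m - l * (y - m * z)"
  define W where "W = exp E"
  have W0: "0 < W" by (simp add: W_def)
  define w where "w k = exp (l * (1 - 2 * sqrt m * (1 - k / m)))" for k :: nat
  define D where "D = real m * (real m - 1)"
  define c where "c j = real j * (real j - 1) / D" for j :: nat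
  have D: "0 < D" using m by (simp add: D_def)
  have ck: "c (Suc k) - c k = 2 * real k / D" for k
    by (simp add: c_def diff_divide_distrib[symmetric] algebra_simps)
  have cm: "c m = 1" using D by (simp add: c_def flip: D_def)
  have pt: "cdf X_law (split_pre z u) \<le> a k + W * w k"
    if k: "k \<in> {1..<m}" and u: "c k < u" "u \<le> c (Suc k)"
      and a: "0 \<le> a k" "\<And>x. cdf X_law x -
      exp (loss l k - l * (y - k * x) + (l * (k * (real m - k) / (real m - 2)) + l\<^sup>2 * (real m - k) / 8)) \<le> a k"
    for k u a
  proof (cases "split_pre z u < 0")
    case True
    have "0 \<le> W * w k" using W0 by (simp add: w_def)
    then show ?thesis using True a(1) by (simp add: cdf_X_law_neg)
  next
    case False
    \<comment> \<open>Truncation at 1 does not change the distribution function, and the comparison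
      of exponents needs x in [0,1].\<close>
    define x where "x = min 1 (split_pre z u)"
    have Fx: "cdf X_law (split_pre z u) = cdf X_law x"
      by (simp add: x_def min_def cdf_X_law_ge_1)
    have "k * x - m * z + k * (real m - k) / (real m - 2) \<le> 7 * (sqrt m - sqrt k) + 1 - 2 * sqrt m * (1 - k / m)"
    proof (rule upper_exponent[OF m(1)])
      show "1 \<le> k" "k < m" using k by auto
      show "real k * (real k - 1) / (real m * (real m - 1)) < u" using u by (simp add: c_def D_def)
      show "u \<le> (real k + 1) * real k / (real m * (real m - 1))" using u by (simp add: c_def D_def add.commute)
      show "0 \<le> x" "x \<le> 1" "x \<le> split_pre z u" using False by (auto simp: x_def)
    qed
    then have "l * (k * x - m * z + k * (real m - k) / (real m - 2)) \<le> l * (7 * (sqrt m - sqrt k) + 1 - 2 * sqrt m * (1 - k / m))"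
      using l by (intro mult_left_mono) auto
    then have "loss l k - l * (y - k * x) + (l * (k * (real m - k) / (real m - 2)) + l\<^sup>2 * (real m - k) / 8)
        \<le> E + l * (1 - 2 * sqrt m * (1 - k / m))"
      by (simp add: E_def loss_def algebra_simps diff_divide_distrib)
    then have "exp (loss l k - l * (y - k * x) + (l * (k * (real m - k) / (real m - 2)) + l\<^sup>2 * (real m - k) / 8)) \<le> W * w k"
      by (simp add: W_def w_def flip: exp_add)
    then show ?thesis using a(2)[of x] by (simp add: Fx)
  qed
  have "cdf X_law z \<le> (\<Sum>k\<in>{1..<m}. (c (Suc k) - c k) * ((aL k + aR k) / 2 + W * w k))"
  proof (rule cdf_X_law_le_steps)
    fix k assume k: "k \<in> {1..<m}"
    have "0 \<le> c (Suc k) - c k" unfolding ck using D by simp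
    then show "c k \<le> c (Suc k)" by simp
    show "0 \<le> (aL k + aR k) / 2 + W * w k"
      using a0[OF k] W0 by (simp add: w_def)
    fix u assume u: "c k < u" "u \<le> c (Suc k)"
    show "cdf X_law (split_pre z u) \<le> (aL k + aR k) / 2 + W * w k"
    proof -
      have mid: "x \<le> (a + b) / 2 + d" if "x \<le> a + d" "x \<le> b + d" for x a b d :: real
        using that by (simp add: field_simps)
      show ?thesis
        by (rule mid[OF pt[OF k u, of aL, OF a0(1)[OF k] aL[OF k]] pt[OF k u, of aR, OF a0(2)[OF k] aR[OF k]]])
    qed
  qed (use cm m in \<open>auto simp: c_def\<close>)
  also have "\<dots> = (\<Sum>k\<in>{1..<m}. k * (aL k + aR k) / D + W * (2 * real k / D * w k))"
    unfolding ck using D by (intro sum.cong refl) (simp add: field_simps)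
  also have "\<dots> = (\<Sum>k\<in>{1..<m}. k * (aL k + aR k)) / D + W * (\<Sum>k\<in>{1..<m}. 2 * real k / D * w k)"
    by (simp add: sum.distrib sum_divide_distrib sum_distrib_left)
  also have "\<dots> \<le> (\<Sum>k\<in>{1..<m}. k * (aL k + aR k)) / D + W * 1"
  proof (intro add_left_mono mult_left_mono)
    show "(\<Sum>k\<in>{1..<m}. 2 * real k / D * w k) \<le> 1"
      unfolding w_def
    proof (rule sum_weights_exp_le_1[OF l m(2)])
      show "0 \<le> 2 * real k / D \<and> 2 * real k / D \<le> 2 / m" if "k \<in> {1..<m}" for k
      proof -
        have "2 * real k / D \<le> 2 * (real m - 1) / D" using that D by (intro divide_right_mono) auto
        also have "\<dots> = 2 / m"
          unfolding D_def using m by (intro nonzero_mult_divide_mult_cancel_right) linarith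
        finally show ?thesis using D by simp
      qed
      have "(\<Sum>k\<in>{1..<m}. 2 * real k / D) = D / D"
        unfolding sum_divide_distrib[symmetric] sum_index_real D_def ..
      then show "(\<Sum>k\<in>{1..<m}. 2 * real k / D) \<le> 1" using D by simp
      show "1 \<le> m" using m by linarith
    qed
  qed (use W0 in simp)
  finally have "m * (cdf X_law z - W) \<le> m * ((\<Sum>k\<in>{1..<m}. k * (aL k + aR k)) / D)"
    by (intro mult_left_mono) auto
  also have "\<dots> = (\<Sum>k\<in>{1..<m}. k * (aL k + aR k)) / (real m - 1)"
    using m by (simp add: D_def)
  also note rec
  finally show ?thesis by (simp add: W_def E_def)
qed

section \<open>From exponential to power bounds\<close>

text \<open>Restrict Euler's integral to t >= x and replace t^x by x^x there.\<close>

lemma powr_exp_le_Gamma_real: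
  fixes x :: real
  assumes "x > 0"
  shows "(x / exp 1) powr x \<le> Gamma (x + 1)"
proof -
  have I: "((\<lambda>t. t powr x / exp t) has_integral Gamma (x + 1)) {0..}"
    using Gamma_integral_real[of "x + 1"] assms by simp
  have J: "((\<lambda>t. exp (- 1 * t)) has_integral exp (- 1 * x) / 1) {x..}"
    by (rule has_integral_exp_minus_to_infinity) simp
  have J': "((\<lambda>t. if t \<in> {x..} then x powr x * exp (- t) else 0) has_integral x powr x * exp (- x)) {0..}"
    using has_integral_mult_right[OF J, of "x powr x"] assms
    by (subst has_integral_restrict) auto
  have "x powr x * exp (- x) \<le> Gamma (x + 1)"
  proof (rule has_integral_le[OF J' I])
    fix t :: real assume "t \<in> {0..}"
    then show "(if t \<in> {x..} then x powr x * exp (- t) else 0) \<le> t powr x / exp t"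
      using assms by (auto simp: exp_minus divide_inverse intro!: mult_right_mono powr_mono2)
  qed
  moreover have "x powr x * exp (- x) = (x / exp 1) powr x"
    using assms by (simp add: powr_divide exp_powr_real) (simp add: exp_minus divide_inverse)
  ultimately show ?thesis by simp
qed

text \<open>Drop the summand 1/2 in \<open>tau p\<close>. The lower bound for
  \<open>Gamma (p / 2 + 1)\<close> leaves (p / (4 e))^(p/2) / 2 under the p-th root, and 2^(1/p) <=
  1 + 1/p by convexity.\<close>

lemma sqrt_le_tau:
  assumes "1 \<le> p"
  shows "sqrt (p / (4 * exp 1)) \<le> (1 + 1 / p) * tau p"
proof -
  define z where "z = sqrt (p / (4 * exp 1))"
  have z: "z > 0" using assms by (simp add: z_def)
  have "(p / 2 / exp 1) powr (p / 2) \<le> Gamma (p / 2 + 1)"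
    using powr_exp_le_Gamma_real[of "p / 2"] assms by simp
  moreover have "(p / 2 / exp 1) powr (p / 2) = z powr p * 2 powr (p / 2)"
  proof -
    have "z powr p = (p / (4 * exp 1)) powr (p / 2)"
      unfolding z_def powr_half_sqrt[symmetric] using assms
      by (subst powr_half_sqrt[symmetric]) (auto simp: powr_powr)
    then show ?thesis using assms
      by (simp add: powr_mult[symmetric])
  qed
  ultimately have "z powr p * 2 powr (p / 2) \<le> Gamma (p / 2 + 1)" by simp
  then have le: "z powr p / 2 \<le> Gamma (p / 2 + 1) / 2 powr (p / 2 + 1)"
    by (simp add: powr_add le_divide_eq)
  have "(z powr p / 2) powr (1 / p) \<le> tau p"
    unfolding tau_def using le assms by (intro powr_mono2) auto
  moreover have "(z powr p / 2) powr (1 / p) = z / 2 powr (1 / p)"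
    using z assms by (simp add: powr_divide powr_powr)
  ultimately have "z \<le> 2 powr (1 / p) * tau p"
    by (simp add: field_simps)
  also have "\<dots> \<le> (1 + 1 / p) * tau p"
  proof (rule mult_right_mono)
    show "2 powr (1 / p) \<le> 1 + 1 / p"
      using convex_onD[OF exp_convex, of "1 / p" 0 "ln 2"] assms
      by (simp add: powr_def mult.commute)
    show "0 \<le> tau p" by (simp add: tau_def)
  qed
  finally show ?thesis by (simp add: z_def)
qed

text \<open>One factor 1 + 1/p comes from the choice of t, the other from the comparison with
  \<open>tau p\<close>. Their product is just below the prefactor of \<open>kappa p\<close>, as (2 p
  + 3) p^2 - (p + 1)^2 (2 p - 1) = 1.\<close>

lemma seven_plus_sqrt_le_kappa:
  assumes "1 \<le> p"
  shows "(1 + 1 / p) * (7 + sqrt (p / (4 * exp 1))) \<le> kappa p"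
proof -
  have t: "0 \<le> tau p" by (simp add: tau_def)
  have "(1 + 1 / p) * (7 + sqrt (p / (4 * exp 1))) \<le> (1 + 1 / p) * (7 * (1 + 1 / p) + (1 + 1 / p) * tau p)"
    using sqrt_le_tau[OF assms] assms by (intro mult_left_mono add_mono) auto
  also have "\<dots> = (1 + 1 / p)\<^sup>2 * (7 + tau p)"
    by (simp only: power2_eq_square ring_distribs mult_ac)
  also have "\<dots> \<le> (2 * p + 3) / (2 * p - 1) * (7 + tau p)"
  proof (rule mult_right_mono)
    have "(2 * p + 3) * p\<^sup>2 - (p + 1)\<^sup>2 * (2 * p - 1) = 1"
      by (simp add: power2_eq_square algebra_simps)
    then have "(p + 1)\<^sup>2 * (2 * p - 1) \<le> (2 * p + 3) * p\<^sup>2"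
      by linarith
    moreover have "1 + 1 / p = (p + 1) / p" using assms by (simp add: field_simps)
    ultimately show "(1 + 1 / p)\<^sup>2 \<le> (2 * p + 3) / (2 * p - 1)"
      using assms by (simp add: power_divide divide_simps)
  qed (use t in simp)
  finally show ?thesis by (simp add: kappa_def)
qed

text \<open>The chosen t depends on G. Multiplying by G^(1/p), a constant times exp (- 2 t^2 / p),
  removes this dependence, as t exp (- 2 t^2 / p) <= sqrt (p / (4 e)). Raising to the power p / (p +
  1) then isolates G.\<close>

lemma powr_bound_of_gaussian_tradeoff:
  assumes p: "1 \<le> p" and G: "0 \<le> G" and \<delta>: "0 \<le> \<delta>"
    and trade: "\<And>t. 0 \<le> t \<Longrightarrow> G \<le> \<delta> * (7 + t) + exp (- 2 * t\<^sup>2)"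
    and G1: "G \<le> 1"
  shows "G \<le> (p + 1) powr (1 / (p + 1)) * (\<delta> * kappa p) powr (p / (p + 1))"
proof (cases "G = 0")
  case False
  then have G0: "G > 0" using G by simp
  define L where "L = ln ((p + 1) / G)"
  define t where "t = sqrt (L / 2)"
  have "(p + 1) / G \<ge> 1" using G0 G1 p by (simp add: field_simps)
  then have L: "L \<ge> 0" by (simp add: L_def)
  have eL: "exp (- L) = G / (p + 1)"
    using G0 p by (simp add: L_def exp_minus)
  have "G \<le> \<delta> * (7 + t) + exp (- 2 * t\<^sup>2)"
    using L by (intro trade) (simp add: t_def)
  also have "exp (- 2 * t\<^sup>2) = G / (p + 1)"
    using L eL by (simp add: t_def)
  finally have "G \<le> (1 + 1 / p) * (\<delta> * (7 + t))"
    using p by (simp add: field_simps)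
  moreover have Gp: "G powr (1 / p) = (p + 1) powr (1 / p) * exp (- L / p)"
  proof -
    have "G = (p + 1) * exp (- L)" using eL p by simp
    also have "\<dots> powr (1 / p) = (p + 1) powr (1 / p) * exp (- L / p)"
      using p by (simp add: powr_mult) (simp add: powr_def)
    finally show ?thesis .
  qed
  ultimately have "G * G powr (1 / p) \<le> (1 + 1 / p) * (\<delta> * (7 + t)) * ((p + 1) powr (1 / p) * exp (- L / p))"
    using G p \<delta> L by (intro mult_mono) (auto simp: t_def)
  also have "\<dots> = (p + 1) powr (1 / p) * (\<delta> * ((1 + 1 / p) * (exp (- L / p) * (7 + t))))"
    by (simp add: mult_ac)
  also have "\<dots> \<le> (p + 1) powr (1 / p) * (\<delta> * ((1 + 1 / p) * (7 + sqrt (p / (4 * exp 1)))))"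
  proof (intro mult_left_mono)
    have "exp (- L / p) * 7 \<le> 7" using L p by simp
    moreover have "exp (- L / p) * t \<le> sqrt (p / (4 * exp 1))"
    proof (rule real_le_rsqrt)
      \<comment> \<open>The maximum of x exp (- x) is 1 / e, used with x = 2 L / p = 4 t^2 /
        p.\<close>
      have "2 * L / p \<le> exp (2 * L / p - 1)"
        using exp_ge_add_one_self[of "2 * L / p - 1"] by simp
      then have "exp (- (2 * L / p)) * (2 * L / p) \<le> exp (- (2 * L / p)) * exp (2 * L / p - 1)"
        by (intro mult_left_mono) auto
      also have "\<dots> = exp (- 1)" by (simp flip: exp_add)
      finally have *: "exp (- (2 * L / p)) * (2 * L / p) \<le> exp (- 1)" .
      have "(exp (- L / p) * t)\<^sup>2 = exp (- (2 * L / p)) * (2 * L / p) * (p / 4)"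
        using L p by (simp add: t_def power_mult_distrib exp_double[symmetric] flip: exp_of_nat_mult)
      also have "\<dots> \<le> exp (- 1) * (p / 4)"
        using * p by (intro mult_right_mono) auto
      finally show "(exp (- L / p) * t)\<^sup>2 \<le> p / (4 * exp 1)"
        by (simp add: exp_minus field_simps)
    qed
    ultimately show "exp (- L / p) * (7 + t) \<le> 7 + sqrt (p / (4 * exp 1))"
      unfolding distrib_left by (rule add_mono)
  qed (use p \<delta> in auto)
  also have "\<dots> \<le> (p + 1) powr (1 / p) * (\<delta> * kappa p)"
    using seven_plus_sqrt_le_kappa[OF p] \<delta> by (intro mult_left_mono) auto
  finally have "(G * G powr (1 / p)) powr (p / (p + 1)) \<le> ((p + 1) powr (1 / p) * (\<delta> * kappa p)) powr (p / (p + 1))"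
    using p G by (intro powr_mono2) auto
  moreover have "(G * G powr (1 / p)) powr (p / (p + 1)) = G"
  proof -
    have "G * G powr (1 / p) = G powr (1 + 1 / p)" using G0 by (simp add: powr_add)
    moreover have "(1 + 1 / p) * (p / (p + 1)) = 1"
      using p by (simp add: divide_simps)
    ultimately show ?thesis using G0 p by (simp add: powr_powr del: times_divide_eq_right)
  qed
  moreover have "0 \<le> kappa p"
  proof -
    have "0 \<le> tau p" by (simp add: tau_def)
    then show ?thesis using p by (simp add: kappa_def)
  qed
  ultimately show ?thesis
    using p \<delta> by (simp add: powr_mult powr_powr)
qed simp

section \<open>Induction on the size\<close>

lemma avg_all_eq_mean:
  assumes "s < n"
  shows "finite {S. S \<subseteq> {1..<n} \<and> card S = s}" "{S. S \<subseteq> {1..<n} \<and> card S = s} \<noteq> {}"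
    and "avg_all n s H = (\<Sum>S | S \<subseteq> {1..<n} \<and> card S = s. H S) / card {S. S \<subseteq> {1..<n} \<and> card S = s}"
proof -
  have c: "card {S. S \<subseteq> {1..<n} \<and> card S = s} = n - 1 choose s"
    using n_subsets[of "{1..<n}" s] by simp
  show "finite {S. S \<subseteq> {1..<n} \<and> card S = s}"
    by (rule finite_subset[of _ "Pow {1..<n}"]) auto
  have "0 < n - 1 choose s" using assms by auto
  then show "{S. S \<subseteq> {1..<n} \<and> card S = s} \<noteq> {}" using c by (metis card.empty less_irrefl)
  show "avg_all n s H = (\<Sum>S | S \<subseteq> {1..<n} \<and> card S = s. H S) / card {S. S \<subseteq> {1..<n} \<and> card S = s}"
    unfolding avg_all_def c by (rule refl)
qed

lemma avg_in_eq_mean: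
  assumes "1 \<le> s" "s < n" "0 < i" "i < n"
  shows "finite {S. S \<subseteq> {1..<n} \<and> card S = s \<and> i \<in> S}" "{S. S \<subseteq> {1..<n} \<and> card S = s \<and> i \<in> S} \<noteq> {}"
    and "avg_in n s i H = (\<Sum>S | S \<subseteq> {1..<n} \<and> card S = s \<and> i \<in> S. H S) / card {S. S \<subseteq> {1..<n} \<and> card S = s \<and> i \<in> S}"
proof -
  have "real (card {S. S \<subseteq> {1..<n} \<and> card S = s \<and> i \<in> S}) = (\<Sum>S | S \<subseteq> {1..<n} \<and> card S = s \<and> i \<in> S. 1)"
    by simp
  also have "\<dots> = (\<Sum>S | S \<subseteq> {1..<n} - {i} \<and> card S = s - 1. 1)"
    using assms by (intro sum_subsets_containing) auto
  also have "\<dots> = real (n - 2 choose (s - 1))"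
  proof -
    have cP: "card ({1..<n} - {i}) = n - 2" using assms by (simp add: numeral_2_eq_2)
    have "card {B. B \<subseteq> {1..<n} - {i} \<and> card B = s - 1} = n - 2 choose (s - 1)"
      unfolding cP[symmetric] by (rule n_subsets) simp
    then show ?thesis by simp
  qed
  finally have c: "card {S. S \<subseteq> {1..<n} \<and> card S = s \<and> i \<in> S} = n - 2 choose (s - 1)" by simp
  show "finite {S. S \<subseteq> {1..<n} \<and> card S = s \<and> i \<in> S}"
    by (rule finite_subset[of _ "Pow {1..<n}"]) auto
  have "0 < n - 2 choose (s - 1)" using assms by auto
  then show "{S. S \<subseteq> {1..<n} \<and> card S = s \<and> i \<in> S} \<noteq> {}" using c by (metis card.empty less_irrefl)
  show "avg_in n s i H = (\<Sum>S | S \<subseteq> {1..<n} \<and> card S = s \<and> i \<in> S. H S) / card {S. S \<subseteq> {1..<n} \<and> card S = s \<and> i \<in> S}"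
    unfolding avg_in_def c by (rule refl)
qed

lemma mean_linear:
  fixes f g h :: "'a \<Rightarrow> real"
  assumes "\<And>S. S \<in> X \<Longrightarrow> f S = c + a * g S + b * h S" "finite X" "X \<noteq> {}"
  shows "(\<Sum>S\<in>X. f S) / card X = c + a * ((\<Sum>S\<in>X. g S) / card X) + b * ((\<Sum>S\<in>X. h S) / card X)"
proof -
  have "(\<Sum>S\<in>X. f S) = (\<Sum>S\<in>X. c + a * g S + b * h S)"
    by (intro sum.cong assms(1)) auto
  then show ?thesis using assms(2,3)
    by (simp add: sum.distrib sum_distrib_left add_divide_distrib card_gt_0_iff)
qed

lemma sum_two_sides:
  fixes f g :: "nat \<Rightarrow> real"
  assumes "1 \<le> N"
  shows "(\<Sum>s<N. 1 + real s * f s + real (N - 1 - s) * g (N - 1 - s)) = N + (\<Sum>k\<in>{1..<N}. k * (f k + g k))"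
proof -
  have "(\<Sum>s<N. real (N - 1 - s) * g (N - 1 - s)) = (\<Sum>s<N. real s * g s)"
    using sum.nat_diff_reindex[of "\<lambda>s. real s * g s" N] by simp
  then have "(\<Sum>s<N. 1 + real s * f s + real (N - 1 - s) * g (N - 1 - s)) = N + (\<Sum>s<N. real s * (f s + g s))"
    by (simp add: sum.distrib distrib_left)
  also have "(\<Sum>s<N. real s * (f s + g s)) = (\<Sum>k\<in>{1..<N}. k * (f k + g k))"
    using assms by (simp add: lessThan_atLeast0 sum.atLeast_Suc_lessThan)
  finally show ?thesis .
qed

lemma exp_drift_le:
  fixes l \<mu> w :: real and N k :: nat
  assumes "0 < l" "real k * (real N - k) / N - 1 \<le> \<mu>" "w \<le> real N - k"
  shows "exp (- l * \<mu> + (- l)\<^sup>2 * w / 8) \<le> exp (- l * (k * (real N - k) / N - 1) + l\<^sup>2 * (real N - k) / 8)"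
proof -
  have "l * (k * (real N - k) / N - 1) \<le> l * \<mu>" using assms by (intro mult_left_mono) auto
  moreover have "l\<^sup>2 * w \<le> l\<^sup>2 * (real N - k)" using assms by (intro mult_left_mono) auto
  ultimately show ?thesis by simp
qed

lemma drift_left:
  fixes N k :: nat
  assumes "2 \<le> N" "k < N"
  shows "real k * (real N - k) / N - 1 \<le> real k * (real N - k) / (real N - 1)"
proof -
  have "real k * (real N - k) / N \<le> real k * (real N - k) / (real N - 1)"
    using assms by (intro divide_left_mono mult_nonneg_nonneg mult_pos_pos) auto
  then show ?thesis by linarith
qed

text \<open>For a right sublist with k ranks besides the pivot's, s = N - 1 - k, and the mean number
  of exchanges falls short of k (N - k) / (N - 1) by at most 1. Allowing for this 1 gives the left
  and the right sublist a common drift.\<close>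

lemma drift_right:
  fixes N k :: nat
  assumes "2 \<le> N" "k < N"
  shows "real k * (real N - k) / N - 1 \<le> (real N - 1 - k) * (real k + 1) / (real N - 1)"
proof -
  have "(real N - 1 - k) * (real k + 1) / (real N - 1) = real k * (real N - k) / (real N - 1) + 1 - 2 * real k / (real N - 1)"
  proof -
    have "(real N - 1 - k) * (real k + 1) = real k * (real N - k) + (real N - 1) - 2 * real k"
      by (simp add: algebra_simps)
    then show ?thesis using assms by (simp add: add_divide_distrib diff_divide_distrib)
  qed
  moreover have "real k * (real N - k) / N \<le> real k * (real N - k) / (real N - 1)"
    using assms by (intro divide_left_mono mult_nonneg_nonneg mult_pos_pos) auto
  moreover have "2 * real k / (real N - 1) \<le> 2" using assms by (simp add: field_simps)
  ultimately show ?thesis by linarith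
qed

text \<open>The two claims need each other: the right sublist of a random list has its minimum, the
  pivot, at a known place, and a list with its minimum in front is that minimum followed by a random
  list. On \<open>Suc N\<close> elements \<open>mean_at 1\<close> counts \<open>N\<close> ranks,
  hence the common right-hand side.\<close>

lemma mean_le_lower_env:
  assumes l: "0 < l" "l \<le> 4"
  shows "(\<forall>A y. finite A \<longrightarrow> card A = N \<longrightarrow> mean_all A y \<le> N * lower_env l N y) \<and>
    (\<forall>A i y. finite A \<longrightarrow> card A = Suc N \<longrightarrow> i < Suc N \<longrightarrow> mean_at 1 A i y \<le> N * lower_env l N y)"
proof (induction N rule: less_induct)
  case (less N)
  note IH = less.IH
  have IHa: "mean_all B y \<le> card B * lower_env l (card B) y" if "finite B" "card B < N" for B y
    using IH[OF that(2)] that(1) by blast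
  have IHm: "mean_at 1 B i y \<le> real (card B - 1) * lower_env l (card B - 1) y"
    if "finite B" "i < card B" "card B < Suc N" for B i y
    using IH[of "card B - 1"] that by auto
  have env: "\<mu> \<le> N * lower_env l N y"
    if "1 \<le> N" "\<mu> \<le> N" "\<And>z. \<mu> \<le> N * (cdf X_law z + exp (loss l N - l * (real N * z - y)))" for \<mu> y :: real
  proof -
    have "\<mu> / N \<le> lower_env l N y"
      by (rule le_lower_env) (use that in \<open>auto simp: divide_le_eq mult.commute\<close>)
    then show ?thesis using that(1) by (simp add: divide_le_eq mult.commute)
  qed
  have U: "mean_all A y \<le> N * lower_env l N y" if A: "finite A" "card A = N" for A y
  proof (cases "N = 0")
    case True
    then show ?thesis using mean_all_bounds(2)[OF A(1), of y] A by simp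
  next
    case False
    define T where "T S = real (exchanges N S)" for S
    define aL where "aL k = avg_all N k (\<lambda>S. lower_env l k (y - T S))" for k
    \<comment> \<open>A right sublist with \<open>k\<close> counted ranks has \<open>k + 1\<close>
      elements including the pivot, so \<open>N - 1 - k\<close> entries are small.\<close>
    define aR where "aR k = avg_all N (N - 1 - k) (\<lambda>S. lower_env l k (y - T S))" for k
    have rec: "mean_all A y \<le> 1 + (\<Sum>k\<in>{1..<N}. k * (aL k + aR k)) / N" if N: "2 \<le> N"
    proof -
      have "mean_all A y \<le> (\<Sum>s<N. avg_all N s (\<lambda>S. 1 + real (card S) * lower_env l (card S) (y - exchanges N S) +
          real (N - 1 - card S) * lower_env l (N - 1 - card S) (y - exchanges N S))) / N"
        using IHa IHm N A by (intro mean_all_le_recursion) auto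
      also have "(\<Sum>s<N. avg_all N s (\<lambda>S. 1 + real (card S) * lower_env l (card S) (y - exchanges N S) +
          real (N - 1 - card S) * lower_env l (N - 1 - card S) (y - exchanges N S))) =
          (\<Sum>s<N. 1 + real s * aL s + real (N - 1 - s) * aR (N - 1 - s))"
      proof (intro sum.cong refl)
        fix s assume "s \<in> {..<N}"
        then have s: "s < N" "N - 1 - (N - 1 - s) = s" by auto
        show "avg_all N s (\<lambda>S. 1 + real (card S) * lower_env l (card S) (y - exchanges N S) +
          real (N - 1 - card S) * lower_env l (N - 1 - card S) (y - exchanges N S)) =
          1 + real s * aL s + real (N - 1 - s) * aR (N - 1 - s)"
          unfolding aL_def aR_def s(2) avg_all_eq_mean(3)[OF s(1)]
          by (rule mean_linear[OF _ avg_all_eq_mean(1,2)[OF s(1)]]) (simp add: T_def)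
      qed
      also have "\<dots> = N + (\<Sum>k\<in>{1..<N}. k * (aL k + aR k))"
        using N by (intro sum_two_sides) simp
      finally show ?thesis using N by (simp add: add_divide_distrib)
    qed
    have mgfL: "avg_all N k (\<lambda>S. exp (- l * T S)) \<le> exp (- l * (k * (real N - k) / N - 1) + l\<^sup>2 * (real N - k) / 8)"
      and mgfR: "avg_all N (N - 1 - k) (\<lambda>S. exp (- l * T S)) \<le> exp (- l * (k * (real N - k) / N - 1) + l\<^sup>2 * (real N - k) / 8)"
      if k: "k \<in> {1..<N}" for k
    proof -
      have N: "2 \<le> N" "1 \<le> k" "k < N" using k by auto
      show "avg_all N k (\<lambda>S. exp (- l * T S)) \<le> exp (- l * (k * (real N - k) / N - 1) + l\<^sup>2 * (real N - k) / 8)"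
        unfolding T_def
        by (rule order.trans[OF avg_all_mgf(1)[OF N(3,1,2)] exp_drift_le[OF l(1) drift_left]]) (use N in auto)
      have eq: "real (N - 1 - k) * (real N - real (N - 1 - k)) / (real N - 1) = (real N - 1 - k) * (real k + 1) / (real N - 1)"
        using N by (simp add: of_nat_diff) (simp add: algebra_simps)
      have s: "N - 1 - k < N" using N by simp
      have drift: "real k * (real N - k) / N - 1 \<le> real (N - 1 - k) * (real N - real (N - 1 - k)) / (real N - 1)"
        unfolding eq by (rule drift_right[OF N(1,3)])
      have w: "real (N - 1 - k - 1) \<le> real N - k" using N by linarith
      show "avg_all N (N - 1 - k) (\<lambda>S. exp (- l * T S)) \<le> exp (- l * (k * (real N - k) / N - 1) + l\<^sup>2 * (real N - k) / 8)"
        unfolding T_def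
        by (rule order.trans[OF avg_all_mgf(2)[OF s N(1)] exp_drift_le[OF l(1) drift w]])
    qed
    show ?thesis
    proof (rule env)
      fix z
      show "mean_all A y \<le> N * (cdf X_law z + exp (loss l N - l * (real N * z - y)))"
      proof (rule lower_step[OF l _ _ _ rec])
        show "1 \<le> N" "mean_all A y \<le> N" "y < 0 \<Longrightarrow> mean_all A y = 0"
          using False mean_all_bounds[OF A(1)] A(2) by auto
        fix k assume k: "k \<in> {1..<N}"
        then have s: "k < N" "N - 1 - k < N" by auto
        note L = mean_lower_env_le[OF avg_all_eq_mean(1,2)[OF s(1)] mgfL[OF k, unfolded avg_all_eq_mean(3)[OF s(1)]]]
        note R = mean_lower_env_le[OF avg_all_eq_mean(1,2)[OF s(2)] mgfR[OF k, unfolded avg_all_eq_mean(3)[OF s(2)]]]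
        show "aL k \<le> 1" unfolding aL_def avg_all_eq_mean(3)[OF s(1)] by (rule L(1))
        show "aR k \<le> 1" unfolding aR_def avg_all_eq_mean(3)[OF s(2)] by (rule R(1))
        fix x
        show "aL k \<le> cdf X_law x + exp (loss l k - l * (real k * x - y) + (- l * (k * (real N - k) / N - 1) + l\<^sup>2 * (real N - k) / 8))"
          unfolding aL_def avg_all_eq_mean(3)[OF s(1)] by (rule L(2))
        show "aR k \<le> cdf X_law x + exp (loss l k - l * (real k * x - y) + (- l * (k * (real N - k) / N - 1) + l\<^sup>2 * (real N - k) / 8))"
          unfolding aR_def avg_all_eq_mean(3)[OF s(2)] by (rule R(2))
      qed
    qed (use False mean_all_bounds(2)[OF A(1), of y] A(2) in auto)
  qed
  moreover have "mean_at 1 A i y \<le> N * lower_env l N y"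
    if A: "finite A" "card A = Suc N" and i: "i < Suc N" for A i y
  proof -
    have bd: "mean_at 1 A i y \<le> N" "y < 0 \<Longrightarrow> mean_at 1 A i y = 0"
      using mean_at_bounds(2)[OF A(1), of i y 1] mean_at_bounds(4)[OF A(1), of i 1 y] A i by auto
    consider "N = 0" | "1 \<le> N" "i = 0" | "1 \<le> N" "0 < i" by linarith
    then show ?thesis
    proof cases
      case 1
      then show ?thesis using bd by simp
    next
      case 2
      have "Min A \<in> A" using A by (intro Min_in) auto
      then have "card (A - {Min A}) = N" using A by simp
      then show ?thesis using U[of "A - {Min A}" y] mean_at_Min_first(1)[of A y] A 2 by simp
    next
      case 3
      define n where "n = Suc N"
      define T where "T S = real (exchanges n S)" for S
      \<comment> \<open>The left sublist contains the minimum of \<open>A\<close>, whose rank is not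
        counted, so \<open>k\<close> counted ranks mean \<open>k + 1\<close> small entries. On the
        right, without the pivot, they mean \<open>N - k\<close> small entries.\<close>
      define aL where "aL k = avg_in n (Suc k) i (\<lambda>S. lower_env l k (y - T S))" for k
      define aR where "aR k = avg_in n (N - k) i (\<lambda>S. lower_env l k (y - T S))" for k
      have i': "0 < i" "i < n" using 3 i by (auto simp: n_def)
      have rec: "mean_at 1 A i y \<le> 1 + (\<Sum>k\<in>{1..<N}. k * (aL k + aR k)) / N"
      proof -
        have "mean_at 1 A i y \<le> (\<Sum>s\<in>{1..<n}. avg_in n s i (\<lambda>S. 1 + real (card S - 1) * lower_env l (card S - 1) (y - exchanges n S) +
            real (n - 1 - card S) * lower_env l (n - 1 - card S) (y - exchanges n S))) / real (n - 1)"
          using IHm A i' by (intro mean_at_1_le_recursion) (auto simp: n_def)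
        also have "(\<Sum>s\<in>{1..<n}. avg_in n s i (\<lambda>S. 1 + real (card S - 1) * lower_env l (card S - 1) (y - exchanges n S) +
            real (n - 1 - card S) * lower_env l (n - 1 - card S) (y - exchanges n S))) =
            (\<Sum>s<N. avg_in n (Suc s) i (\<lambda>S. 1 + real (card S - 1) * lower_env l (card S - 1) (y - exchanges n S) +
            real (n - 1 - card S) * lower_env l (n - 1 - card S) (y - exchanges n S)))"
          unfolding n_def One_nat_def lessThan_atLeast0 by (rule sum.shift_bounds_Suc_ivl)
        also have "\<dots> = (\<Sum>s<N. 1 + real s * aL s + real (N - 1 - s) * aR (N - 1 - s))"
        proof (intro sum.cong refl)
          fix s assume "s \<in> {..<N}"
          then have s: "1 \<le> Suc s" "Suc s < n" "N - (N - 1 - s) = Suc s" by (auto simp: n_def)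
          show "avg_in n (Suc s) i (\<lambda>S. 1 + real (card S - 1) * lower_env l (card S - 1) (y - exchanges n S) +
            real (n - 1 - card S) * lower_env l (n - 1 - card S) (y - exchanges n S)) =
            1 + real s * aL s + real (N - 1 - s) * aR (N - 1 - s)"
            unfolding aL_def aR_def s(3) avg_in_eq_mean(3)[OF s(1,2) i']
            by (rule mean_linear[OF _ avg_in_eq_mean(1,2)[OF s(1,2) i']]) (auto simp: T_def n_def)
        qed
        also have "\<dots> = N + (\<Sum>k\<in>{1..<N}. k * (aL k + aR k))"
          using 3 by (intro sum_two_sides) simp
        finally show ?thesis using 3 by (simp add: add_divide_distrib n_def)
      qed
      have mgfL: "avg_in n (Suc k) i (\<lambda>S. exp (- l * T S)) \<le> exp (- l * (k * (real N - k) / N - 1) + l\<^sup>2 * (real N - k) / 8)"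
        and mgfR: "avg_in n (N - k) i (\<lambda>S. exp (- l * T S)) \<le> exp (- l * (k * (real N - k) / N - 1) + l\<^sup>2 * (real N - k) / 8)"
        if k: "k \<in> {1..<N}" for k
      proof -
        have N: "2 \<le> N" "1 \<le> k" "k < N" using k by auto
        have s: "1 \<le> Suc k" "Suc k < n" "1 \<le> N - k" "N - k < n" "3 \<le> n" using N by (auto simp: n_def)
        show "avg_in n (Suc k) i (\<lambda>S. exp (- l * T S)) \<le> exp (- l * (k * (real N - k) / N - 1) + l\<^sup>2 * (real N - k) / 8)"
          unfolding T_def
        proof (rule avg_in_mgf[OF s(1,2,5) i', of "- l"])
          fix \<mu> assume m: "(real (Suc k) - 1) * (real n - real (Suc k)) / (real n - 2) \<le> \<mu>"
            and le: "avg_in n (Suc k) i (\<lambda>S. exp (- l * exchanges n S)) \<le> exp (- l * \<mu> + (- l)\<^sup>2 * (real n - real (Suc k)) / 8)"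
          have "real k * (real N - k) / N - 1 \<le> \<mu>"
            using m drift_left[OF N(1,3)] by (simp add: n_def)
          from order.trans[OF le exp_drift_le[OF l(1) this]]
          show "avg_in n (Suc k) i (\<lambda>S. exp (- l * exchanges n S)) \<le> exp (- l * (k * (real N - k) / N - 1) + l\<^sup>2 * (real N - k) / 8)"
            by (simp add: n_def)
        qed
        show "avg_in n (N - k) i (\<lambda>S. exp (- l * T S)) \<le> exp (- l * (k * (real N - k) / N - 1) + l\<^sup>2 * (real N - k) / 8)"
          unfolding T_def
        proof (rule avg_in_mgf[OF s(3,4,5) i', of "- l"])
          fix \<mu> assume m: "(real (N - k) - 1) * (real n - real (N - k)) / (real n - 2) \<le> \<mu>"
            and le: "avg_in n (N - k) i (\<lambda>S. exp (- l * exchanges n S)) \<le> exp (- l * \<mu> + (- l)\<^sup>2 * real (N - k - 1) / 8)"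
          have "(real (N - k) - 1) * (real n - real (N - k)) / (real n - 2) = (real N - 1 - k) * (real k + 1) / (real N - 1)"
            using N by (simp add: n_def of_nat_diff algebra_simps)
          then have "real k * (real N - k) / N - 1 \<le> \<mu>"
            using m drift_right[OF N(1,3)] by linarith
          moreover have "real (N - k - 1) \<le> real N - k" using N by (simp add: of_nat_diff)
          ultimately show "avg_in n (N - k) i (\<lambda>S. exp (- l * exchanges n S)) \<le> exp (- l * (k * (real N - k) / N - 1) + l\<^sup>2 * (real N - k) / 8)"
            by (intro order.trans[OF le] exp_drift_le[OF l(1)])
        qed
      qed
      show ?thesis
      proof (rule env)
        fix z
        show "mean_at 1 A i y \<le> N * (cdf X_law z + exp (loss l N - l * (real N * z - y)))"
        proof (rule lower_step[OF l 3(1) bd rec])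
          fix k assume k: "k \<in> {1..<N}"
          then have s: "1 \<le> Suc k" "Suc k < n" "1 \<le> N - k" "N - k < n" by (auto simp: n_def)
          note L = mean_lower_env_le[OF avg_in_eq_mean(1,2)[OF s(1,2) i'] mgfL[OF k, unfolded avg_in_eq_mean(3)[OF s(1,2) i']]]
          note R = mean_lower_env_le[OF avg_in_eq_mean(1,2)[OF s(3,4) i'] mgfR[OF k, unfolded avg_in_eq_mean(3)[OF s(3,4) i']]]
          show "aL k \<le> 1" unfolding aL_def avg_in_eq_mean(3)[OF s(1,2) i'] by (rule L(1))
          show "aR k \<le> 1" unfolding aR_def avg_in_eq_mean(3)[OF s(3,4) i'] by (rule R(1))
          fix x
          show "aL k \<le> cdf X_law x + exp (loss l k - l * (real k * x - y) + (- l * (k * (real N - k) / N - 1) + l\<^sup>2 * (real N - k) / 8))"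
            unfolding aL_def avg_in_eq_mean(3)[OF s(1,2) i'] by (rule L(2))
          show "aR k \<le> cdf X_law x + exp (loss l k - l * (real k * x - y) + (- l * (k * (real N - k) / N - 1) + l\<^sup>2 * (real N - k) / 8))"
            unfolding aR_def avg_in_eq_mean(3)[OF s(3,4) i'] by (rule R(2))
        qed
      qed (use 3 bd in auto)
    qed
  qed
  ultimately show ?case by blast
qed

text \<open>If the minimum is not in front, both sublists have their minimum at a known place and
  the recursion applies. If it is in front, it is split off, and the random rest is averaged over
  the position of its own minimum, which leads back to the same claim at size
  \<open>m - 1\<close>.\<close>

lemma upper_env_le_mean_at:
  assumes l: "0 < l" "l \<le> 4" and "finite A" "card A = m" "i < m"
  shows "m * upper_env l m y \<le> mean_at 0 A i y"
  using assms(3-)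
proof (induction m arbitrary: A i y rule: less_induct)
  case (less m)
  note A = less.prems
  have bd: "0 \<le> mean_at 0 A i y" "m \<le> y \<Longrightarrow> mean_at 0 A i y = m"
    using mean_at_bounds[OF A(1), of i] A by auto
  have m0: "0 < real m" using A by simp
  have "m * (cdf X_law z - exp (loss l m - l * (y - real m * z))) \<le> mean_at 0 A i y" for z
  proof (cases "z < 0 \<or> m \<le> y \<or> 0 \<le> loss l m - l * (y - real m * z)")
    case True
    then consider "z < 0" | "m \<le> y" | "0 \<le> loss l m - l * (y - real m * z)" by blast
    then show ?thesis
    proof cases
      case 1
      then have "m * (cdf X_law z - exp (loss l m - l * (y - real m * z))) \<le> 0"
        using m0 by (simp add: cdf_X_law_neg mult_le_0_iff)
      then show ?thesis using bd by linarith
    next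
      case 2
      have "m * (cdf X_law z - exp (loss l m - l * (y - real m * z))) \<le> real m * 1"
      proof (intro mult_left_mono)
        show "cdf X_law z - exp (loss l m - l * (y - real m * z)) \<le> 1"
          using cdf_X_law_bounds(2)[of z] exp_ge_zero[of "loss l m - l * (y - real m * z)"] by linarith
      qed simp
      then show ?thesis using bd(2)[OF 2] by simp
    next
      case 3
      then have "1 \<le> exp (loss l m - l * (y - real m * z))" by simp
      then have "cdf X_law z - exp (loss l m - l * (y - real m * z)) \<le> 0"
        using cdf_X_law_bounds(2)[of z] by linarith
      then have "m * (cdf X_law z - exp (loss l m - l * (y - real m * z))) \<le> 0"
        using m0 by (simp add: mult_le_0_iff)
      then show ?thesis using bd by linarith
    qed
  next
    case False
    \<comment> \<open>What remains is z >= 0, y < m and a negative exponent, whence 7 sqrt m + l m /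
      8 < y < m. This excludes small m.\<close>
    define q where "q = sqrt m"
    have q: "0 < q" "real m = q * q" using m0 by (auto simp: q_def)
    have "loss l m < l * y - l * (m * z)" using False by (simp add: algebra_simps)
    moreover have "0 \<le> l * (m * z)" using False l by simp
    ultimately have "loss l m < l * y" by linarith
    then have "l * (7 * q + l * m / 8) < l * y"
      by (simp add: loss_def q_def algebra_simps power2_eq_square)
    then have y7: "7 * q + l * m / 8 < y" using l by simp
    then have "q * (7 + l * q / 8) < q * q" using False q by (simp add: algebra_simps)
    then have q7': "7 + l * q / 8 < q" using q by simp
    have "0 \<le> l * q / 8" using l q by simp
    then have q7: "7 < q" using q7' by linarith
    have ql: "7 < sqrt m * (1 - l / 8)" using q7' by (simp add: q_def algebra_simps)
    have "7 * 7 \<le> q * q" using q7 by (intro mult_mono) auto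
    then have m49: "49 \<le> real m" using q by simp
    have y0: "0 \<le> y"
    proof -
      have "0 \<le> 7 * q + l * m / 8" using q l by simp
      then show ?thesis using y7 by linarith
    qed
    show ?thesis
    proof (cases "i = 0")
      case True
      define W where "W = exp (loss l m - l * (y - real m * z))"
      define B where "B = A - {Min A}"
      have "Min A \<in> A" using A by (intro Min_in) auto
      then have B: "finite B" "card B = m - 1" using A by (auto simp: B_def)
      then have "B \<noteq> {}" using m49 by auto
      note B = B this
      have m1: "real (m - 1) = real m - 1" using m49 by (simp add: of_nat_diff)
      \<comment> \<open>The bound for size m - 1 is at least as good: the loss is smaller and, as z
        >= 0, the gap y - (m - 1) z is larger. The one missing share of the bound for m is covered
        by the rank of the minimum, which costs no exchange.\<close>
      have "cdf X_law z - W \<le> cdf X_law z - exp (loss l (m - 1) - l * (y - real (m - 1) * z))"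
      proof -
        have "loss l (m - 1) \<le> loss l m"
          unfolding loss_def using l by (intro add_mono mult_left_mono divide_right_mono real_sqrt_le_mono) auto
        moreover have "l * (real (m - 1) * z) \<le> l * (real m * z)"
          using l False by (intro mult_left_mono mult_right_mono) auto
        ultimately show ?thesis by (simp add: W_def right_diff_distrib)
      qed
      also have "\<dots> \<le> upper_env l (m - 1) y" by (rule upper_env_ge)
      finally have env: "cdf X_law z - W \<le> upper_env l (m - 1) y" .
      have "real (m - 1) * (real (m - 1) * (cdf X_law z - W)) \<le> (\<Sum>j<card B. mean_at 0 B j y)"
      proof -
        have "(\<Sum>j<card B. real (m - 1) * (cdf X_law z - W)) \<le> (\<Sum>j<card B. mean_at 0 B j y)"
        proof (intro sum_mono)
          fix j assume "j \<in> {..<card B}"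
          then have "real (m - 1) * upper_env l (m - 1) y \<le> mean_at 0 B j y"
            using B A by (intro less.IH) auto
          moreover have "real (m - 1) * (cdf X_law z - W) \<le> real (m - 1) * upper_env l (m - 1) y"
            using env by (intro mult_left_mono) auto
          ultimately show "real (m - 1) * (cdf X_law z - W) \<le> mean_at 0 B j y" by linarith
        qed
        then show ?thesis by (simp only: B(2) sum_constant card_lessThan)
      qed
      then have "real (m - 1) * (cdf X_law z - W) \<le> mean_all B y"
        unfolding mean_all_eq_mean_at[OF B(1,3)] using B m49 by (simp add: le_divide_eq m1 mult.commute)
      moreover have "mean_at 0 A i y = 1 + mean_all B y"
        using mean_at_Min_first(2)[of A y] A m49 True y0 by (simp add: B_def)
      moreover have "cdf X_law z - W \<le> 1"
        using cdf_X_law_bounds(2)[of z] exp_ge_zero[of "loss l m - l * (y - real m * z)"] unfolding W_def by linarith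
      moreover have "real m * (cdf X_law z - W) = real (m - 1) * (cdf X_law z - W) + (cdf X_law z - W)"
        unfolding m1 by (simp add: left_diff_distrib)
      ultimately have "real m * (cdf X_law z - W) \<le> mean_at 0 A i y" by linarith
      then show ?thesis by (simp only: W_def)
    next
      case False
      then have i': "0 < i" "i < m" using A by auto
      define T where "T S = real (exchanges m S)" for S
      define aL where "aL k = avg_in m k i (\<lambda>S. upper_env l k (y - T S))" for k
      define aR where "aR k = avg_in m (m - k) i (\<lambda>S. upper_env l k (y - T S))" for k
      have rec: "(\<Sum>k\<in>{1..<m}. k * (aL k + aR k)) / (real m - 1) \<le> mean_at 0 A i y"
      proof -
        have "(\<Sum>s\<in>{1..<m}. avg_in m s i (\<lambda>S. real (card S) * upper_env l (card S) (y - exchanges m S) +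
            real (m - card S) * upper_env l (m - card S) (y - exchanges m S))) / real (m - 1) \<le> mean_at 0 A i y"
          using less.IH A i' by (intro mean_at_0_ge_recursion) auto
        moreover have "(\<Sum>s\<in>{1..<m}. avg_in m s i (\<lambda>S. real (card S) * upper_env l (card S) (y - exchanges m S) +
            real (m - card S) * upper_env l (m - card S) (y - exchanges m S))) =
            (\<Sum>s\<in>{1..<m}. real s * aL s + real (m - s) * aR (m - s))"
        proof (intro sum.cong refl)
          fix s assume "s \<in> {1..<m}"
          then have s: "1 \<le> s" "s < m" "m - (m - s) = s" by auto
          have "avg_in m s i (\<lambda>S. real (card S) * upper_env l (card S) (y - exchanges m S) +
            real (m - card S) * upper_env l (m - card S) (y - exchanges m S)) =
            0 + real s * aL s + real (m - s) * aR (m - s)"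
            unfolding aL_def aR_def s(3) avg_in_eq_mean(3)[OF s(1,2) i']
            by (rule mean_linear[OF _ avg_in_eq_mean(1,2)[OF s(1,2) i']]) (auto simp: T_def)
          then show "avg_in m s i (\<lambda>S. real (card S) * upper_env l (card S) (y - exchanges m S) +
            real (m - card S) * upper_env l (m - card S) (y - exchanges m S)) =
            real s * aL s + real (m - s) * aR (m - s)" by simp
        qed
        moreover have "\<dots> = (\<Sum>k\<in>{1..<m}. k * (aL k + aR k))"
        proof -
          have "(\<Sum>s\<in>{1..<m}. real (m - s) * aR (m - s)) = (\<Sum>k\<in>{1..<m}. k * aR k)"
            by (rule sum.reindex_bij_witness[where i = "\<lambda>k. m - k" and j = "\<lambda>k. m - k"]) auto
          then show ?thesis by (simp add: sum.distrib distrib_left)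
        qed
        moreover have "real (m - 1) = real m - 1" using m49 by (simp add: of_nat_diff)
        ultimately show ?thesis by simp
      qed
      have mgf: "avg_in m s i (\<lambda>S. exp (l * T S)) \<le> exp (l * (k * (real m - k) / (real m - 2)) + l\<^sup>2 * (real m - k) / 8)"
        if k: "k \<in> {1..<m}" "s = k \<or> s = m - k" for k s
      proof -
        have s: "1 \<le> s" "s < m" "3 \<le> m" using k m49 by auto
        have prod: "real s * (real m - s) = k * (real m - k)" using k by (auto simp: of_nat_diff)
        show ?thesis unfolding T_def
        proof (rule avg_in_mgf[OF s i', of l])
          fix \<mu> assume m: "\<mu> \<le> real s * (real m - real s) / (real m - 2)"
            and le: "avg_in m s i (\<lambda>S. exp (l * exchanges m S)) \<le> exp (l * \<mu> + l\<^sup>2 * (real m - real s) / 8)"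
              "avg_in m s i (\<lambda>S. exp (l * exchanges m S)) \<le> exp (l * \<mu> + l\<^sup>2 * real (s - 1) / 8)"
          have "l * \<mu> \<le> l * (k * (real m - k) / (real m - 2))"
            using m l unfolding prod by (intro mult_left_mono) auto
          \<comment> \<open>For s = k the window of size m - s is used, for s = m - k the one of
            size s - 1; neither exceeds m - k.\<close>
          moreover have "l\<^sup>2 * (real m - real s) \<le> l\<^sup>2 * (real m - k) \<or> l\<^sup>2 * real (s - 1) \<le> l\<^sup>2 * (real m - k)"
            using k by (auto simp: of_nat_diff intro: mult_left_mono)
          ultimately have "l * \<mu> + l\<^sup>2 * (real m - real s) / 8 \<le> l * (k * (real m - k) / (real m - 2)) + l\<^sup>2 * (real m - k) / 8 \<or>
              l * \<mu> + l\<^sup>2 * real (s - 1) / 8 \<le> l * (k * (real m - k) / (real m - 2)) + l\<^sup>2 * (real m - k) / 8"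
            by linarith
          then show "avg_in m s i (\<lambda>S. exp (l * exchanges m S)) \<le> exp (l * (k * (real m - k) / (real m - 2)) + l\<^sup>2 * (real m - k) / 8)"
            using order.trans[OF le(1)] order.trans[OF le(2)] by (metis exp_le_cancel_iff)
        qed
      qed
      show ?thesis
      proof (rule upper_step[OF l m49 ql rec])
        fix k assume k: "k \<in> {1..<m}"
        then have s: "1 \<le> k" "k < m" "1 \<le> m - k" "m - k < m" by auto
        have g: "avg_in m k i (\<lambda>S. exp (l * T S)) \<le> exp (l * (k * (real m - k) / (real m - 2)) + l\<^sup>2 * (real m - k) / 8)"
          "avg_in m (m - k) i (\<lambda>S. exp (l * T S)) \<le> exp (l * (k * (real m - k) / (real m - 2)) + l\<^sup>2 * (real m - k) / 8)"
          using mgf[OF k] by auto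
        note L = mean_upper_env_ge[OF avg_in_eq_mean(1,2)[OF s(1,2) i'] g(1)[unfolded avg_in_eq_mean(3)[OF s(1,2) i']]]
        note R = mean_upper_env_ge[OF avg_in_eq_mean(1,2)[OF s(3,4) i'] g(2)[unfolded avg_in_eq_mean(3)[OF s(3,4) i']]]
        show "0 \<le> aL k" unfolding aL_def avg_in_eq_mean(3)[OF s(1,2) i'] by (rule L(1))
        show "0 \<le> aR k" unfolding aR_def avg_in_eq_mean(3)[OF s(3,4) i'] by (rule R(1))
        fix x
        show "cdf X_law x - exp (loss l k - l * (y - real k * x) + (l * (k * (real m - k) / (real m - 2)) + l\<^sup>2 * (real m - k) / 8)) \<le> aL k"
          unfolding aL_def avg_in_eq_mean(3)[OF s(1,2) i'] by (rule L(2))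
        show "cdf X_law x - exp (loss l k - l * (y - real k * x) + (l * (k * (real m - k) / (real m - 2)) + l\<^sup>2 * (real m - k) / 8)) \<le> aR k"
          unfolding aR_def avg_in_eq_mean(3)[OF s(3,4) i'] by (rule R(2))
      qed
    qed
  qed
  then have "upper_env l m y \<le> mean_at 0 A i y / m"
    using bd m0 by (intro upper_env_le) (auto simp: le_divide_eq mult.commute)
  then show ?case using m0 by (simp add: le_divide_eq mult.commute)
qed

section \<open>Back to the law of the number of exchanges, and the final bound\<close>

lemma pair_pmf_of_set:
  fixes A :: "'a set" and B :: "'b set"
  assumes "finite A" "A \<noteq> {}" "finite B" "B \<noteq> {}"
  shows "pair_pmf (pmf_of_set A) (pmf_of_set B) = pmf_of_set (A \<times> B)"
proof (rule pmf_eqI)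
  fix z :: "'a \<times> 'b"
  obtain a b where z: "z = (a, b)" by (cases z)
  have "A \<times> B \<noteq> {}" "finite (A \<times> B)" using assms by auto
  then show "pmf (pair_pmf (pmf_of_set A) (pmf_of_set B)) z = pmf (pmf_of_set (A \<times> B)) z"
    using assms by (simp add: z pmf_pair pmf_of_set indicator_def card_cartesian_product)
qed

lemma cdf_scaled_Y_law:
  assumes n: "1 \<le> n"
  shows "cdf (scaled_Y_law n) x = mean_all {1..n} (n * x) / n"
proof -
  let ?P = "permutations_of_set {1..n}" and ?q = "\<lambda>z. quickselect_exchanges (fst z) (snd z)"
  have P: "finite ?P" "?P \<noteq> {}" "finite {1..n}" "{1..n} \<noteq> {}" using n by auto
  have "cdf (scaled_Y_law n) x = measure (measure_pmf (Y_pmf n)) {y. real y / n \<le> x}"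
    by (simp add: cdf_def scaled_Y_law_def measure_distr vimage_def)
  also have "\<dots> = measure (measure_pmf (pmf_of_set (?P \<times> {1..n}))) {z. real (?q z) / n \<le> x}"
    unfolding Y_pmf_def quickselect_input_def pair_pmf_of_set[OF P]
    by (simp add: measure_map_pmf vimage_def case_prod_beta)
  also have "\<dots> = card (?P \<times> {1..n} \<inter> {z. real (?q z) / n \<le> x}) / card (?P \<times> {1..n})"
    using P by (intro measure_pmf_of_set) auto
  also have "real (card (?P \<times> {1..n} \<inter> {z. real (?q z) / n \<le> x})) = (\<Sum>z\<in>?P \<times> {1..n}. of_bool (real (?q z) \<le> n * x))"
    using P n by (simp add: Int_def divide_le_eq mult.commute)
  also have "\<dots> = (\<Sum>xs\<in>?P. \<Sum>r\<in>{1..n}. of_bool (real (quickselect_exchanges xs r) \<le> n * x))"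
    unfolding sum.cartesian_product by (intro sum.cong refl) (auto simp: case_prod_beta)
  also have "\<dots> = (\<Sum>xs\<in>?P. cheap_ranks 0 xs (n * x))"
    using length_finite_permutations_of_set by (intro sum.cong refl) (fastforce simp: cheap_ranks_def)
  finally show ?thesis by (simp add: mean_all_def card_cartesian_product)
qed

text \<open>If 7 + t exceeds sqrt n, the right side is at least 1, because
  \<open>X_density_norm\<close> is. Otherwise the comparison is made at x + s and x - s with s = (7
  + t) / sqrt n, and the bounded density pays for the shift.\<close>

lemma cdf_diff_gaussian_tradeoff:
  assumes n: "1 \<le> n" and t: "0 \<le> t"
  shows "\<bar>cdf (scaled_Y_law n) x - cdf X_law x\<bar> \<le> X_density_norm / sqrt n * (7 + t) + exp (- 2 * t\<^sup>2)"
proof -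
  define q where "q = sqrt n"
  have q: "0 < q" "real n = q * q" using n by (auto simp: q_def)
  define FY where "FY = cdf (scaled_Y_law n) x"
  have FY: "FY = mean_all {1..n} (n * x) / n" unfolding FY_def by (rule cdf_scaled_Y_law[OF n])
  have FYb: "0 \<le> FY" "FY \<le> 1"
    unfolding FY using mean_all_bounds[of "{1..n}" "n * x"] n by (auto simp: divide_le_eq)
  have M1: "1 \<le> X_density_norm" by (rule X_density_norm_ge_1)
  have diff1: "\<bar>FY - cdf X_law x\<bar> \<le> 1" using FYb cdf_X_law_bounds[of x] by linarith
  consider "t = 0" | "q < 7 + t" | "0 < t" "7 + t \<le> q" using t by linarith
  then have "\<bar>FY - cdf X_law x\<bar> \<le> X_density_norm / q * (7 + t) + exp (- 2 * t\<^sup>2)"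
  proof cases
    case 1
    have "0 \<le> X_density_norm / q * (7 + t)" using M1 q t by (intro mult_nonneg_nonneg) auto
    then show ?thesis using diff1 1 by simp
  next
    case 2
    have "1 * 1 \<le> X_density_norm * ((7 + t) / q)" using M1 2 q by (intro mult_mono) auto
    then have "1 \<le> X_density_norm / q * (7 + t)" by simp
    then show ?thesis using diff1 exp_ge_zero[of "- 2 * t\<^sup>2"] by linarith
  next
    case 3
    \<comment> \<open>This minimises l^2 n / 8 - l t sqrt n, with value - 2 t^2; the part 7 l sqrt n
      of the loss is cancelled by the 7 in \<open>s\<close>. As t < q, it stays below 4.\<close>
    define l where "l = 4 * t / q"
    define s where "s = (7 + t) / q"
    have l: "0 < l" "l \<le> 4" using 3 q by (auto simp: l_def field_simps)
    have s: "0 \<le> s" using 3 q by (simp add: s_def)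
    have ex: "loss l n - l * (n * s) = - 2 * t\<^sup>2"
      using q by (simp add: loss_def l_def s_def q_def[symmetric] power2_eq_square field_simps)
    have Ms: "X_density_norm * s = X_density_norm / q * (7 + t)" by (simp add: s_def)
    have "FY \<le> lower_env l n (n * x)"
      using mean_le_lower_env[OF l, of n] n unfolding FY by (simp add: divide_le_eq mult.commute)
    also have "\<dots> \<le> cdf X_law (x + s) + exp (loss l n - l * (n * (x + s) - n * x))"
      by (rule lower_env_le)
    also have "loss l n - l * (n * (x + s) - n * x) = - 2 * t\<^sup>2"
      using ex by (simp add: algebra_simps)
    also have "cdf X_law (x + s) \<le> cdf X_law x + X_density_norm * s"
      by (rule cdf_X_law_add_le[OF s])
    finally have up: "FY - cdf X_law x \<le> X_density_norm / q * (7 + t) + exp (- 2 * t\<^sup>2)"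
      unfolding Ms by simp
    have "cdf X_law x \<le> cdf X_law (x - s) + X_density_norm * s"
      using cdf_X_law_add_le[OF s, of "x - s"] by simp
    moreover have "cdf X_law (x - s) - exp (- 2 * t\<^sup>2) \<le> FY"
    proof -
      have "loss l n - l * (n * x - n * (x - s)) = - 2 * t\<^sup>2"
        using ex by (simp add: algebra_simps)
      then have "cdf X_law (x - s) - exp (- 2 * t\<^sup>2) \<le> upper_env l n (n * x)"
        using upper_env_ge[of "x - s" l n "n * x"] by simp
      also have "n * upper_env l n (n * x) \<le> mean_all {1..n} (n * x)"
      proof -
        have "(\<Sum>i<n. n * upper_env l n (n * x)) \<le> (\<Sum>i<n. mean_at 0 {1..n} i (n * x))"
          by (intro sum_mono upper_env_le_mean_at[OF l]) auto
        then show ?thesis using n mean_all_eq_mean_at[of "{1..n}" "n * x"] by (simp add: le_divide_eq mult.commute)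
      qed
      then have "upper_env l n (n * x) \<le> FY" unfolding FY using n by (simp add: le_divide_eq mult.commute)
      finally show ?thesis .
    qed
    ultimately show ?thesis using up unfolding Ms by linarith
  qed
  then show ?thesis by (simp add: FY_def q_def)
qed

theorem theorem3p5:
  fixes \<epsilon> :: real and n :: nat
  assumes "0 < \<epsilon>" and "\<epsilon> \<le> 1 / 4" and "1 \<le> n"
  shows "ks_dist (scaled_Y_law n) X_law \<le> omega \<epsilon> * real n powr (- 1 / 2 + \<epsilon>)"
proof -
  \<comment> \<open>The condition p >= 1 amounts to \<epsilon> <= 1/4, and p / (p + 1) = 1 - 2
    \<epsilon> turns the factor 1 / sqrt n of the tradeoff into the exponent - 1/2 +
    \<epsilon>.\<close>
  define p where "p = - 1 + 1 / (2 * \<epsilon>)"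
  have p: "1 \<le> p" "p + 1 = 1 / (2 * \<epsilon>)" "1 / (p + 1) = 2 * \<epsilon>"
    using assms by (auto simp: p_def field_simps)
  have "p / (p + 1) = 1 - 1 / (p + 1)" using p(1) by (simp add: field_simps)
  then have pp: "p / (p + 1) = 1 - 2 * \<epsilon>" unfolding p(3) .
  have n0: "0 < real n" using assms by simp
  have bound: "\<bar>cdf (scaled_Y_law n) x - cdf X_law x\<bar> \<le> omega \<epsilon> * real n powr (- 1 / 2 + \<epsilon>)" for x
  proof -
    let ?G = "\<bar>cdf (scaled_Y_law n) x - cdf X_law x\<bar>"
    have "0 \<le> cdf (scaled_Y_law n) x" "cdf (scaled_Y_law n) x \<le> 1"
      unfolding cdf_scaled_Y_law[OF assms(3)] using mean_all_bounds[of "{1..n}" "n * x"] n0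
      by (auto simp: divide_le_eq)
    then have "?G \<le> 1" using cdf_X_law_bounds[of x] by linarith
    then have "?G \<le> (p + 1) powr (1 / (p + 1)) * (X_density_norm / sqrt n * kappa p) powr (p / (p + 1))"
      using cdf_diff_gaussian_tradeoff[OF assms(3)] X_density_norm_nonneg
      by (intro powr_bound_of_gaussian_tradeoff[OF p(1)]) auto
    also have "\<dots> = (1 / (2 * \<epsilon>)) powr (2 * \<epsilon>) * (X_density_norm / sqrt n * kappa p) powr (1 - 2 * \<epsilon>)"
      by (intro arg_cong2[where f = "(*)"] arg_cong2[where f = "(powr)"] p(2,3) pp refl)
    also have "X_density_norm / sqrt n * kappa p = X_density_norm * kappa p * real n powr (- 1 / 2)"
    proof -
      have "real n powr (- 1 / 2) = 1 / sqrt n"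
        using n0 by (simp add: powr_minus_divide powr_half_sqrt)
      then show ?thesis by simp
    qed
    also have "(X_density_norm * kappa p * real n powr (- 1 / 2)) powr (1 - 2 * \<epsilon>) =
        (X_density_norm * kappa p) powr (1 - 2 * \<epsilon>) * (real n powr (- 1 / 2)) powr (1 - 2 * \<epsilon>)"
      by (rule powr_mult)
    also have "(real n powr (- 1 / 2)) powr (1 - 2 * \<epsilon>) = real n powr (- 1 / 2 + \<epsilon>)"
      unfolding powr_powr by (rule arg_cong[where f = "(powr) (real n)"]) (simp add: algebra_simps)
    finally show ?thesis by (simp add: omega_def p_def mult.assoc)
  qed
  show ?thesis
    unfolding ks_dist_def by (rule cSUP_least) (use bound in auto)
qed

end
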